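(* Let $\mathcal{C}$ be a polyhedral complex in $\mathbb{R}^n$, let $F:|\mathcal{C}|\to\mathbb{R}$ be affine-linear on each cell of $\mathcal{C}$, and let $[a,b]$ be an interval of transversal thresholds for $F$ on $\mathcal{C}$. Then there exist a polytopal complex $\mathcal{D}$ with $|\mathcal{D}|\subseteq|\mathcal{C}|$ and a strong deformation retraction of $|\mathcal{C}|$ onto $|\mathcal{D}|$ whose time-one map $\Phi:|\mathcal{C}|\to|\mathcal{D}|$ satisfies: $F(\Phi(x))=F(x)$ for every $x\in|\mathcal{C}|$ with $F(x)\in[a,b]$, and for every $c\in[a,b]$, $$\Phi(\{x\in|\mathcal{C}|:F(x)\le c\})=\{y\in|\mathcal{D}|:F(y)\le c\},\qquad \Phi(\{x\in|\mathcal{C}|:F(x)\ge c\})=\{y\in|\mathcal{D}|:F(y)\ge c\}.$$ Furthermore, for every $c\in[a,b]$ there is a PL homeomorphism $\phi:(|\mathcal{D}|\cap F^{-1}(c))\times[a,b]\to|\mathcal{D}|\cap F^{-1}([a,b])$ such that for each $t\in[a,b]$ the restriction of $\phi$ to $(|\mathcal{D}|\cap F^{-1}(c))\times\{t\}$ is a PL homeomorphism onto $|\mathcal{D}|\cap F^{-1}(t)$.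
   Context: A polyhedral set in $\mathbb{R}^n$ is an intersection of finitely many closed affine half-spaces; a polytope is a bounded polyhedral set. A face of a polyhedral set $P$ is $\emptyset$, $P$, or $P\cap H$ for a hyperplane $H$ meeting $P$ with $P$ contained in one closed half-space of $H$. A polyhedral complex is a finite set $\mathcal{C}$ of polyhedral sets (cells) such that every face of a cell is a cell and any two cells intersect in a common face; $|\mathcal{C}|$ is the union of its cells; a polytopal complex is a polyhedral complex all of whose cells are polytopes. For $F:|\mathcal{C}|\to\mathbb{R}$ affine-linear on each cell, a cell $C$ is flat if $F$ is constant on $C$ (all $0$-cells are flat). A closed interval $[a,b]$ is an interval of transversal thresholds for $F$ on $\mathcal{C}$ if no flat cell $C$ of $\mathcal{C}$ has $F(C)\subseteq[a,b]$. A strong deformation retraction of $X$ onto $A\subseteq X$ is a continuous $H:X\times[0,1]\to X$ with $H(x,0)=x$, $H(x,1)\in A$, $H(a,t)=a$ for all $x\in X$, $a\in A$, $t$. *)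

theory Defs
  imports "HOL-Analysis.Analysis"
begin

definition pface_of :: "'a::euclidean_space set \<Rightarrow> 'a set \<Rightarrow> bool" where
  "pface_of T P \<longleftrightarrow> T = {} \<or> T = P \<or>
     (\<exists>u d. u \<noteq> 0 \<and> P \<inter> {x. u \<bullet> x = d} \<noteq> {} \<and> P \<subseteq> {x. u \<bullet> x \<le> d} \<and>
            T = P \<inter> {x. u \<bullet> x = d})"

definition polyhedral_complex :: "'a::euclidean_space set set \<Rightarrow> bool" where
  "polyhedral_complex \<C> \<longleftrightarrow> finite \<C> \<and> (\<forall>C\<in>\<C>. polyhedron C) \<and>
     (\<forall>C\<in>\<C>. \<forall>T. pface_of T C \<longrightarrow> T \<in> \<C>) \<and>
     (\<forall>C\<in>\<C>. \<forall>C'\<in>\<C>. pface_of (C \<inter> C') C \<and> pface_of (C \<inter> C') C')"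

definition polytopal_complex :: "'a::euclidean_space set set \<Rightarrow> bool" where
  "polytopal_complex \<C> \<longleftrightarrow> polyhedral_complex \<C> \<and> (\<forall>C\<in>\<C>. polytope C)"

definition cellwise_affine :: "'a::euclidean_space set set \<Rightarrow> ('a \<Rightarrow> real) \<Rightarrow> bool" where
  "cellwise_affine \<C> F \<longleftrightarrow> (\<forall>C\<in>\<C>. \<exists>u d. \<forall>x\<in>C. F x = u \<bullet> x + d)"

definition flat_cell :: "('a \<Rightarrow> real) \<Rightarrow> 'a set \<Rightarrow> bool" where
  "flat_cell F C \<longleftrightarrow> C \<noteq> {} \<and> (\<exists>k. \<forall>x\<in>C. F x = k)"

definition transversal_thresholds ::
  "'a set set \<Rightarrow> ('a \<Rightarrow> real) \<Rightarrow> real \<Rightarrow> real \<Rightarrow> bool" where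
  "transversal_thresholds \<C> F a b \<longleftrightarrow> \<not> (\<exists>C\<in>\<C>. flat_cell F C \<and> F ` C \<subseteq> {a..b})"

definition strong_deformation_retraction ::
  "'a::topological_space set \<Rightarrow> 'a set \<Rightarrow> ('a \<times> real \<Rightarrow> 'a) \<Rightarrow> bool" where
  "strong_deformation_retraction X A H \<longleftrightarrow> A \<subseteq> X \<and>
     continuous_on (X \<times> {0..1}) H \<and> H ` (X \<times> {0..1}) \<subseteq> X \<and>
     (\<forall>x\<in>X. H (x, 0) = x \<and> H (x, 1) \<in> A) \<and>
     (\<forall>y\<in>A. \<forall>t\<in>{0..1}. H (y, t) = y)"

definition pl_map :: "'a::euclidean_space set \<Rightarrow> ('a \<Rightarrow> 'b::euclidean_space) \<Rightarrow> bool" where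
  "pl_map S f \<longleftrightarrow> (\<exists>\<P>. finite \<P> \<and> \<Union>\<P> = S \<and>
     (\<forall>P\<in>\<P>. polyhedron P \<and> (\<exists>g c. linear g \<and> (\<forall>x\<in>P. f x = g x + c))))"

definition pl_homeomorphism ::
  "'a::euclidean_space set \<Rightarrow> 'b::euclidean_space set \<Rightarrow> ('a \<Rightarrow> 'b) \<Rightarrow> bool" where
  "pl_homeomorphism S T f \<longleftrightarrow> (\<exists>g. homeomorphism S T f g \<and> pl_map S f \<and> pl_map T g)"

end

theory Submission
  imports Defs
begin

text \<open>
  Projecting every cell along the directions of its lineality space on which \<open>F\<close> is constant, and
  then cutting along the levels \<open>a\<close> and \<open>b\<close>, produces a complex of pointed cells; \<open>\<D>\<close> consists of
  its bounded cells. A pointed unbounded cell is pushed backwards along a relatively interior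
  direction of its recession cone until it leaves the cell. If the direction depends only on the
  recession cone, and cells are treated in order of decreasing dimension of this cone, then the
  pushes agree on common faces. They preserve the cells of the cut complex, and they preserve \<open>F\<close> on
  cells over \<open>[a, b]\<close>, where \<open>F\<close> is bounded and thus constant along recession directions. The
  straight-line homotopy to the resulting map stays in each cell.

  For the product structure, transversality implies that every cell meeting \<open>F\<^sup>-\<^sup>1[a, b]\<close> meets each
  level \<open>t\<close> of \<open>[a, b]\<close> in its relative interior. Hence the cells \<open>G \<inter> F\<^sup>-\<^sup>1(J)\<close> and
  \<open>(G \<inter> F\<^sup>-\<^sup>1(c)) \<times> J\<close>, with \<open>J\<close> one of \<open>{a}\<close>, \<open>{b}\<close>, \<open>[a, b]\<close>, have the same face poset. The
  simplicial map between their barycentric subdivisions is a PL homeomorphism, and it preserves levels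
  because barycentres of corresponding cells can be chosen at equal heights.
\<close>

section \<open>Recession cones\<close>

text \<open>Only lineality directions on which \<open>F\<close> is constant may be projected away,
  because the retraction has to keep the levels in \<open>{a..b}\<close>. Lines along which
  \<open>F\<close> varies are broken by the cut instead: none of \<open>{..a}\<close>,
  \<open>{a..b}\<close>, \<open>{b..}\<close> is the whole real line. Pointedness is exactly what
  makes a slide stop after finite time. The obstacle is to make the slides of different cells fit
  together. Among cells with recession cones of the same dimension, a face of a sliding cell either
  has the same cone, hence the same direction and the same exit time, or its cone is a proper face
  of the larger cone, hence of smaller dimension, and then it must not move. A relatively interior
  direction guarantees the latter. Outside \<open>{a..b}\<close> levels may change, but no point
  crosses a threshold; this is enough for the images of sublevel and superlevel sets. Boundedness of
  a cut cell and boundedness of a whole slab over \<open>{a..b}\<close> are different conditions, so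
  it takes an argument of its own that they single out the same points over
  \<open>{a..b}\<close>.\<close>

lemma pface_of_iff_face_of:
  assumes "polyhedron P"
  shows "pface_of T P \<longleftrightarrow> T face_of P"
proof -
  have "convex P"
    using assms by (rule polyhedron_imp_convex)
  then have "T face_of P" if "pface_of T P"
    using that unfolding pface_of_def
    by (auto intro: face_of_refl face_of_Int_supporting_hyperplane_le)
  moreover have "pface_of T P" if "T exposed_face_of P"
    using that unfolding exposed_face_of pface_of_def by blast
  ultimately show ?thesis
    using exposed_face_of_polyhedron[OF assms] by blast
qed

text \<open>Faces of polyhedra are exposed, so the hyperplane description may be replaced by
  \<open>face_of\<close>. One intersection condition is enough because \<open>C\<close> and
  \<open>C'\<close> can be exchanged.\<close>

lemma polyhedral_complex_iff:
  "polyhedral_complex \<C> \<longleftrightarrow> finite \<C> \<and> (\<forall>C\<in>\<C>. polyhedron C) \<and>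
     (\<forall>C\<in>\<C>. \<forall>T. T face_of C \<longrightarrow> T \<in> \<C>) \<and>
     (\<forall>C\<in>\<C>. \<forall>C'\<in>\<C>. C \<inter> C' face_of C)"
proof (cases "\<forall>C\<in>\<C>. polyhedron C")
  case True
  then have "pface_of T C \<longleftrightarrow> T face_of C" if "C \<in> \<C>" for T C
    using that pface_of_iff_face_of by blast
  then show ?thesis
    unfolding polyhedral_complex_def using True by auto (metis Int_commute)
qed (auto simp: polyhedral_complex_def)

text \<open>A point that is not relatively interior lies in a proper face, which is a polyhedron of
  smaller dimension.\<close>

lemma polyhedron_point_in_rel_interior_face:
  fixes P :: "'a::euclidean_space set"
  assumes "polyhedron P" "x \<in> P"
  obtains G where "G face_of P" "x \<in> rel_interior G"
proof -
  have "\<exists>G. G face_of P \<and> x \<in> rel_interior G"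
    using assms
  \<comment> \<open>An affine dimension is at least -1, so after the shift \<open>nat\<close>
    preserves strict inequalities.\<close>
  proof (induction "nat (aff_dim P + 1)" arbitrary: P rule: less_induct)
    case less
    show ?case
    proof (cases "x \<in> rel_interior P")
      case True
      then show ?thesis
        using face_of_refl less.prems(1) polyhedron_imp_convex by blast
    next
      case False
      then have "x \<in> rel_frontier P"
        using less.prems closure_subset by (auto simp: rel_frontier_def)
      then obtain T where T: "T face_of P" "T \<noteq> P" "x \<in> T"
        using rel_frontier_of_polyhedron_alt[OF less.prems(1)] by auto
      have "aff_dim T < aff_dim P"
        using T face_of_aff_dim_lt less.prems(1) polyhedron_imp_convex by blast
      then have "nat (aff_dim T + 1) < nat (aff_dim P + 1)"
        using aff_dim_geq[of T] by linarith
      moreover have "polyhedron T"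
        using T face_of_polyhedron_polyhedron less.prems(1) by blast
      ultimately obtain G where "G face_of T" "x \<in> rel_interior G"
        using less.hyps T by blast
      then show ?thesis
        using T face_of_trans by blast
    qed
  qed
  then show ?thesis
    using that by blast
qed

text \<open>The recession cone of a nonempty set. Quantifying over all base points makes it additive
  for arbitrary \<open>P\<close>; for closed convex sets one base point turns out to be
  enough.\<close>

definition recession :: "'a::real_vector set \<Rightarrow> 'a set" where
  "recession P = {v. \<forall>x\<in>P. \<forall>t\<ge>0. x + t *\<^sub>R v \<in> P}"

lemma recessionD: "v \<in> recession P \<Longrightarrow> x \<in> P \<Longrightarrow> 0 \<le> t \<Longrightarrow> x + t *\<^sub>R v \<in> P"
  by (simp add: recession_def)

lemma zero_in_recession [simp]: "0 \<in> recession P"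
  by (simp add: recession_def)

lemma recession_add: "v \<in> recession P \<Longrightarrow> w \<in> recession P \<Longrightarrow> v + w \<in> recession P"
  unfolding recession_def by (simp add: scaleR_right_distrib flip: add.assoc)

lemma recession_scaleR: "v \<in> recession P \<Longrightarrow> 0 \<le> c \<Longrightarrow> c *\<^sub>R v \<in> recession P"
  unfolding recession_def by simp

lemma convex_recession: "convex (recession P)"
  by (rule convexI) (simp add: recession_add recession_scaleR)

text \<open>Segments from \<open>y\<close> to remote points of the ray contain points converging to
  \<open>y + t *\<^sub>R v\<close>, because the starting point of the ray loses its influence;
  closedness gives the limit.\<close>

lemma recessionI_ray:
  fixes P :: "'a::real_normed_vector set"
  assumes "closed P" "convex P" "x \<in> P" and ray: "\<And>t. 0 \<le> t \<Longrightarrow> x + t *\<^sub>R v \<in> P"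
  shows "v \<in> recession P"
  unfolding recession_def
proof (intro CollectI ballI allI impI)
  fix y and t :: real assume y: "y \<in> P" and t: "0 \<le> t"
  define z where "z n = y + t *\<^sub>R v + inverse (real (Suc n)) *\<^sub>R (x - y)" for n
  have "z n \<in> P" for n
  proof -
    let ?e = "inverse (real (Suc n))"
    \<comment> \<open>The remote point at parameter \<open>Suc n * t\<close> gets weight
      \<open>1 / Suc n\<close>, so that the step \<open>t *\<^sub>R v\<close> comes out
      exactly.\<close>
    have "(1 - ?e) *\<^sub>R y + ?e *\<^sub>R (x + (real (Suc n) * t) *\<^sub>R v) \<in> P"
      using t y by (intro convexD_alt assms(2) ray) (auto simp: field_simps)
    also have "(1 - ?e) *\<^sub>R y + ?e *\<^sub>R (x + (real (Suc n) * t) *\<^sub>R v) = z n"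
    proof -
      have "?e *\<^sub>R (real (Suc n) * t) *\<^sub>R v = t *\<^sub>R v"
        by simp
      then show ?thesis
        by (simp only: z_def scaleR_add_right scaleR_diff_left scaleR_diff_right scaleR_one) simp
    qed
    finally show ?thesis .
  qed
  moreover have "z \<longlonglongrightarrow> y + t *\<^sub>R v + 0 *\<^sub>R (x - y)"
    unfolding z_def by (intro tendsto_intros LIMSEQ_inverse_real_of_nat)
  ultimately show "y + t *\<^sub>R v \<in> P"
    using closed_sequentially[OF assms(1)] by fastforce
qed

lemma recession_mono_face:
  fixes P :: "'a::euclidean_space set"
  assumes "closed P" "convex P" "G face_of P" "G \<noteq> {}"
  shows "recession G \<subseteq> recession P"
proof
  fix v assume v: "v \<in> recession G"
  obtain x where "x \<in> G"
    using assms by blast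
  then show "v \<in> recession P"
    using assms face_of_imp_subset recessionD[OF v] by (intro recessionI_ray[of P x]) blast+
qed

text \<open>If a backward and a forward step from \<open>x\<close> both stay in \<open>P\<close>,
  then \<open>x\<close> lies strictly between two points of \<open>P\<close>, and a face containing
  \<open>x\<close> contains both.\<close>

lemma face_of_back_along_ray:
  assumes "G face_of P" "x \<in> G" "x - s *\<^sub>R w \<in> P" "0 < s" "w \<in> recession P" "0 \<le> t"
  shows "x - s *\<^sub>R w \<in> G" "x + t *\<^sub>R w \<in> G"
proof -
  have "x - s *\<^sub>R w \<in> G \<and> x + t *\<^sub>R w \<in> G" if "0 < t" for t
  proof (cases "w = 0")
    case False
    have "x = (1 - s / (s + t)) *\<^sub>R (x - s *\<^sub>R w) + (s / (s + t)) *\<^sub>R (x + t *\<^sub>R w)"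
    proof -
      have "(1 - s / (s + t)) *\<^sub>R (x - s *\<^sub>R w) + (s / (s + t)) *\<^sub>R (x + t *\<^sub>R w)
        = x + (- (1 - s / (s + t)) * s + (s / (s + t)) * t) *\<^sub>R w"
        by (simp add: algebra_simps)
      also have "- (1 - s / (s + t)) * s + (s / (s + t)) * t = 0"
        using that assms by (simp add: field_simps)
      finally show ?thesis by simp
    qed
    moreover have "x - s *\<^sub>R w \<noteq> x + t *\<^sub>R w"
    proof
      assume "x - s *\<^sub>R w = x + t *\<^sub>R w"
      then have "(s + t) *\<^sub>R w = 0"
        by (simp add: scaleR_add_left diff_eq_eq algebra_simps)
      then show False
        using False that assms(4) by simp
    qed
    ultimately have "x \<in> open_segment (x - s *\<^sub>R w) (x + t *\<^sub>R w)"
      unfolding in_segment using that assms by (intro conjI exI[of _ "s / (s + t)"]) (auto simp: field_simps)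
    moreover have "x + t *\<^sub>R w \<in> P"
      using assms that face_of_imp_subset by (intro recessionD) auto
    ultimately show ?thesis
      using face_ofD[OF assms(1)] assms by blast
  qed (use assms in auto)
  \<comment> \<open>For \<open>t = 0\<close> there is no open segment; the backward claim then comes
    from the forward step with parameter 1.\<close>
  from this[of 1] this[of t] show "x - s *\<^sub>R w \<in> G" "x + t *\<^sub>R w \<in> G"
    using assms by (cases "t = 0"; auto)+
qed

text \<open>The face property of \<open>G\<close>, applied at each point
  \<open>x + t *\<^sub>R v\<close> of a ray in \<open>G\<close>, puts
  \<open>x + t *\<^sub>R v1\<close> and \<open>x + t *\<^sub>R v2\<close> into \<open>G\<close>; so
  both rays stay in \<open>G\<close>.\<close>

lemma recession_face_of:
  fixes P :: "'a::euclidean_space set"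
  assumes "closed P" "convex P" "G face_of P" "G \<noteq> {}"
  shows "recession G face_of recession P"
  unfolding face_of_def
proof (intro conjI ballI impI)
  show "recession G \<subseteq> recession P"
    using assms by (rule recession_mono_face)
  show "convex (recession G)"
    by (rule convex_recession)
next
  fix v1 v2 v
  assume v12: "v1 \<in> recession P" "v2 \<in> recession P" and v: "v \<in> recession G" "v \<in> open_segment v1 v2"
  obtain x where x: "x \<in> G"
    using assms by blast
  have xP: "x \<in> P"
    using assms x face_of_imp_subset by blast
  have G: "closed G" "convex G"
    using assms face_of_imp_closed face_of_imp_convex by blast+
  have *: "x + t *\<^sub>R v1 \<in> G \<and> x + t *\<^sub>R v2 \<in> G" if "0 \<le> t" for t
  proof (cases "t = 0")
    case False
    obtain u where u: "0 < u" "u < 1" "v = (1 - u) *\<^sub>R v1 + u *\<^sub>R v2" and "v1 \<noteq> v2"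
      using v by (auto simp: in_segment)
    have "x + t *\<^sub>R v = (1 - u) *\<^sub>R (x + t *\<^sub>R v1) + u *\<^sub>R (x + t *\<^sub>R v2)"
      by (simp add: u algebra_simps)
    then have "x + t *\<^sub>R v \<in> open_segment (x + t *\<^sub>R v1) (x + t *\<^sub>R v2)"
      using u \<open>v1 \<noteq> v2\<close> False by (auto simp: in_segment)
    then show ?thesis
      using face_ofD[OF assms(3)] recessionD v12 v x xP that by blast
  qed (simp add: x)
  then show "v1 \<in> recession G" "v2 \<in> recession G"
    using recessionI_ray[OF G x] by blast+
qed

text \<open>The directions from \<open>x\<close> to points running off to infinity accumulate at a
  unit vector by compactness of the sphere, and the ray in this direction is a limit of segments
  inside \<open>P\<close>.\<close>

lemma unbounded_imp_recession_nonzero: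
  fixes P :: "'a::euclidean_space set"
  assumes "closed P" "convex P" "\<not> bounded P"
  shows "\<exists>v\<in>recession P. v \<noteq> 0"
proof -
  obtain x where x: "x \<in> P"
    using assms(3) by fastforce
  have "\<exists>y\<in>P. real n < dist x y" for n
    using assms(3) unfolding bounded_any_center[of P x] by (meson not_le)
  then obtain y where y: "\<And>n. y n \<in> P" "\<And>n. real n < dist x (y n)"
    by metis
  define d where "d n = (y n - x) /\<^sub>R norm (y n - x)" for n
  have ne: "y n \<noteq> x" for n
    using y(2)[of n] by auto
  have "d n \<in> sphere 0 1" for n
    using ne by (simp add: d_def)
  then obtain l r where l: "l \<in> sphere 0 1" "strict_mono (r :: nat \<Rightarrow> nat)" "(d \<circ> r) \<longlonglongrightarrow> l"
    using compact_sphere[of 0 1] unfolding compact_def by (metis (full_types))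
  have "l \<in> recession P"
  proof (rule recessionI_ray[OF assms(1,2) x])
    fix t :: real assume t: "0 \<le> t"
    have "\<forall>\<^sub>F n in sequentially. x + t *\<^sub>R (d \<circ> r) n \<in> P"
    proof -
      obtain N :: nat where N: "t < real N"
        using reals_Archimedean2 by blast
      have "x + t *\<^sub>R d (r n) \<in> P" if "N \<le> n" for n
      proof -
        have "real n \<le> real (r n)"
          using seq_suble[OF l(2)] by simp
        then have "t \<le> norm (y (r n) - x)"
          using N that y(2)[of "r n"] by (simp add: dist_norm norm_minus_commute)
        moreover have "x + t *\<^sub>R d (r n) =
            (1 - t / norm (y (r n) - x)) *\<^sub>R x + (t / norm (y (r n) - x)) *\<^sub>R y (r n)"
          by (simp add: d_def algebra_simps divide_inverse)
        ultimately show ?thesis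
          using t ne[of "r n"] by (simp, intro convexD_alt assms(2) x y) (auto simp: field_simps)
      qed
      then show ?thesis
        by (auto simp: eventually_sequentially)
    qed
    moreover have "(\<lambda>n. x + t *\<^sub>R (d \<circ> r) n) \<longlonglongrightarrow> x + t *\<^sub>R l"
      by (intro tendsto_intros l)
    ultimately show "x + t *\<^sub>R l \<in> P"
      using Lim_in_closed_set[OF assms(1)] by (metis trivial_limit_sequentially)
  qed
  then show ?thesis
    using l(1) by (intro bexI[of _ l]) auto
qed

lemma bounded_imp_recession_zero:
  fixes P :: "'a::euclidean_space set"
  assumes "bounded P" "P \<noteq> {}"
  shows "recession P = {0}"
proof -
  have "v = 0" if v: "v \<in> recession P" for v
  proof (rule ccontr)
    assume "v \<noteq> 0"
    obtain x where x: "x \<in> P"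
      using assms by blast
    obtain B where B: "\<And>y. y \<in> P \<Longrightarrow> norm y \<le> B"
      using assms(1) bounded_iff by blast
    have "0 \<le> B"
      using B x norm_ge_zero order_trans by blast
    \<comment> \<open>The step has length \<open>2 * B + 1\<close>, while two points of
      \<open>P\<close> are at distance at most \<open>2 * B\<close>.\<close>
    let ?t = "(B + B + 1) / norm v"
    have "norm (?t *\<^sub>R v) \<le> norm (x + ?t *\<^sub>R v) + norm x"
      using norm_triangle_ineq4[of "x + ?t *\<^sub>R v" x] by simp
    also have "\<dots> \<le> B + B"
      using B x recessionD[OF v x, of ?t] \<open>0 \<le> B\<close> by (intro add_mono B) auto
    finally show False
      using \<open>v \<noteq> 0\<close> \<open>0 \<le> B\<close> by simp
  qed
  then show ?thesis
    by auto
qed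

lemma recession_inner_eq_0:
  fixes P :: "'a::euclidean_space set"
  assumes "P \<noteq> {}" "v \<in> recession P" and bd: "\<And>x. x \<in> P \<Longrightarrow> u \<bullet> x \<in> {a..b}"
  shows "u \<bullet> v = 0"
proof (rule ccontr)
  assume nz: "u \<bullet> v \<noteq> 0"
  obtain x where x: "x \<in> P"
    using assms by blast
  have ab: "a \<le> b"
    using bd[OF x] by simp
  \<comment> \<open>This multiple of \<open>v\<close> changes \<open>u \<bullet> x\<close> by
    \<open>b - a + 1\<close>, more than the length of the interval, whatever the sign of
    \<open>u \<bullet> v\<close>.\<close>
  let ?t = "(b - a + 1) / \<bar>u \<bullet> v\<bar>"
  have "x + ?t *\<^sub>R v \<in> P"
    using x ab assms(2) by (intro recessionD) auto
  from bd[OF this] have "u \<bullet> x + ?t * (u \<bullet> v) \<in> {a..b}"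
    by (simp add: inner_add_right)
  moreover have "?t * (u \<bullet> v) = b - a + 1 \<or> ?t * (u \<bullet> v) = - (b - a + 1)"
    using nz by (cases "0 \<le> u \<bullet> v") (auto simp: field_simps)
  ultimately show False
    using bd[OF x] by auto
qed

section \<open>Retraction of a pointed complex onto its bounded cells\<close>

lemma continuous_on_Min_family:
  fixes f :: "'i \<Rightarrow> 'a::topological_space \<Rightarrow> real"
  assumes "finite I" "I \<noteq> {}" "\<And>i. i \<in> I \<Longrightarrow> continuous_on S (f i)"
  shows "continuous_on S (\<lambda>x. Min ((\<lambda>i. f i x) ` I))"
  using assms
proof (induction I rule: finite_ne_induct)
  case (insert i I)
  have "Min ((\<lambda>i. f i x) ` insert i I) = min (f i x) (Min ((\<lambda>i. f i x) ` I))" for x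
    using insert.hyps by simp
  with insert show ?case
    by (simp add: continuous_on_min)
qed simp

text \<open>Only half-spaces whose normal has negative inner product with \<open>w\<close> can be
  left when moving backwards, and there is one because \<open>- w\<close> is not a recession
  direction. The exit time is thus a minimum of finitely many affine functions, hence
  continuous.\<close>

lemma polyhedron_exit_time:
  fixes P :: "'a::euclidean_space set"
  assumes "polyhedron P" "- w \<notin> recession P"
  obtains s where "continuous_on P s" "\<And>x t. x \<in> P \<Longrightarrow> 0 \<le> t \<Longrightarrow> x - t *\<^sub>R w \<in> P \<longleftrightarrow> t \<le> s x"
proof -
  obtain H where H: "finite H" "P = \<Inter>H" "\<And>h. h \<in> H \<Longrightarrow> \<exists>a b. a \<noteq> 0 \<and> h = {x. a \<bullet> x \<le> b}"
    using assms(1) unfolding polyhedron_def by auto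
  then obtain a b where ab: "\<And>h. h \<in> H \<Longrightarrow> h = {x. a h \<bullet> x \<le> b h}"
    by metis
  have P: "x \<in> P \<longleftrightarrow> (\<forall>h\<in>H. a h \<bullet> x \<le> b h)" for x
    using H(2) ab by blast
  define I where "I = {h \<in> H. a h \<bullet> w < 0}"
  have I: "finite I"
    using H(1) by (simp add: I_def)
  have "I \<noteq> {}"
  proof
    assume "I = {}"
    then have "a h \<bullet> w \<ge> 0" if "h \<in> H" for h
      using that by (force simp: I_def)
    then have "x + t *\<^sub>R - w \<in> P" if "x \<in> P" "0 \<le> t" for x t
      using that unfolding P by (auto simp: inner_diff_right) (smt (verit) mult_nonneg_nonneg)
    then show False
      using assms(2) by (simp add: recession_def)
  qed
  define s where "s x = Min ((\<lambda>h. (b h - a h \<bullet> x) / - (a h \<bullet> w)) ` I)" for x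
  show ?thesis
  proof
    show "continuous_on P s"
      unfolding s_def using I \<open>I \<noteq> {}\<close>
      by (intro continuous_on_Min_family continuous_intros) (auto simp: I_def)
    fix x and t :: real assume x: "x \<in> P" and t: "0 \<le> t"
    have "x - t *\<^sub>R w \<in> P \<longleftrightarrow> (\<forall>h\<in>H. a h \<bullet> x - t * (a h \<bullet> w) \<le> b h)"
      by (simp add: P inner_diff_right)
    also have "\<dots> \<longleftrightarrow> (\<forall>h\<in>I. a h \<bullet> x - t * (a h \<bullet> w) \<le> b h)"
    proof (intro iffI ballI)
      fix h assume *: "\<forall>h\<in>I. a h \<bullet> x - t * (a h \<bullet> w) \<le> b h" and h: "h \<in> H"
      show "a h \<bullet> x - t * (a h \<bullet> w) \<le> b h"
      proof (cases "h \<in> I")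
        case False
        then have "t * (a h \<bullet> w) \<ge> 0"
          using h t by (simp add: I_def)
        moreover have "a h \<bullet> x \<le> b h"
          using x h P by blast
        ultimately show ?thesis
          by linarith
      qed (use * in blast)
    qed (auto simp: I_def)
    also have "\<dots> \<longleftrightarrow> (\<forall>h\<in>I. t \<le> (b h - a h \<bullet> x) / - (a h \<bullet> w))"
      by (intro ball_cong refl) (auto simp: I_def pos_le_divide_eq field_simps)
    also have "\<dots> \<longleftrightarrow> t \<le> s x"
      unfolding s_def using I \<open>I \<noteq> {}\<close> by simp
    finally show "x - t *\<^sub>R w \<in> P \<longleftrightarrow> t \<le> s x" .
  qed
qed

text \<open>For nonempty closed convex \<open>P\<close> this says that \<open>P\<close> contains no
  line. The recession cone of the empty set is the whole space, so the empty cell is excepted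
  wherever cells are assumed to be pointed.\<close>

definition pointed :: "'a::real_vector set \<Rightarrow> bool" where
  "pointed P \<longleftrightarrow> (\<forall>v. v \<in> recession P \<longrightarrow> - v \<in> recession P \<longrightarrow> v = 0)"

text \<open>The choice sees \<open>P\<close> only through \<open>recession P\<close>, so cells with
  the same recession cone get literally the same direction.\<close>

definition escape_direction :: "'a::euclidean_space set \<Rightarrow> 'a" where
  "escape_direction P = (SOME w. w \<in> rel_interior (recession P))"

lemma escape_direction_in_rel_interior:
  "escape_direction P \<in> rel_interior (recession P)"
proof -
  have "rel_interior (recession P) \<noteq> {}"
    using convex_recession rel_interior_eq_empty zero_in_recession by blast
  then show ?thesis
    unfolding escape_direction_def by (simp add: some_in_eq)
qed

lemma escape_direction_in_recession: "escape_direction P \<in> recession P"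
  using escape_direction_in_rel_interior rel_interior_subset by blast

text \<open>Otherwise pointedness forces the direction to be 0. But if 0 is relatively interior to
  the cone, the cone contains \<open>- v\<close> along with every \<open>v\<close>, and pointedness
  makes it trivial.\<close>

lemma minus_escape_direction_notin_recession:
  fixes P :: "'a::euclidean_space set"
  assumes "pointed P" "recession P \<noteq> {0}"
  shows "- escape_direction P \<notin> recession P"
proof
  let ?w = "escape_direction P"
  assume "- ?w \<in> recession P"
  then have "?w = 0"
    using assms(1) escape_direction_in_recession by (auto simp: pointed_def)
  obtain v where v: "v \<in> recession P" "v \<noteq> 0"
    using assms(2) zero_in_recession by blast
  obtain e where e: "e > 1" "(1 - e) *\<^sub>R v + e *\<^sub>R ?w \<in> recession P"
    using escape_direction_in_rel_interior[of P] v convex_rel_interior_iff[OF convex_recession[of P]]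
    by blast
  then have "(1 / (e - 1)) *\<^sub>R ((1 - e) *\<^sub>R v) \<in> recession P"
    by (intro recession_scaleR[of "(1 - e) *\<^sub>R v"]) (simp_all add: \<open>?w = 0\<close>)
  also have "(1 / (e - 1)) *\<^sub>R ((1 - e) *\<^sub>R v) = - v"
  proof -
    have "(1 - e) / (e - 1) = - 1"
      using e(1) by (simp add: field_simps)
    then show ?thesis
      by simp
  qed
  finally show False
    using assms(1) v by (auto simp: pointed_def)
qed

text \<open>The description is well defined only if \<open>P\<close> is pointed and unbounded, so that the ray in
  direction \<^term>\<open>- escape_direction P\<close> leaves \<open>P\<close> in finite time.\<close>
definition slide :: "'a::euclidean_space set \<Rightarrow> 'a \<Rightarrow> 'a" where
  "slide P x = x - (THE s. \<forall>t\<ge>0. x - t *\<^sub>R escape_direction P \<in> P \<longleftrightarrow> t \<le> s) *\<^sub>R escape_direction P"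

lemma slide_exit_time:
  fixes P :: "'a::euclidean_space set"
  assumes "polyhedron P" "pointed P" "recession P \<noteq> {0}"
  obtains s where "continuous_on P s" "\<And>x. x \<in> P \<Longrightarrow> 0 \<le> s x"
    "\<And>x t. x \<in> P \<Longrightarrow> 0 \<le> t \<Longrightarrow> x - t *\<^sub>R escape_direction P \<in> P \<longleftrightarrow> t \<le> s x"
    "\<And>x. x \<in> P \<Longrightarrow> slide P x = x - s x *\<^sub>R escape_direction P"
proof -
  obtain s where s: "continuous_on P s"
    "\<And>x t. x \<in> P \<Longrightarrow> 0 \<le> t \<Longrightarrow> x - t *\<^sub>R escape_direction P \<in> P \<longleftrightarrow> t \<le> s x"
    using polyhedron_exit_time minus_escape_direction_notin_recession assms by metis
  have pos: "0 \<le> s x" if "x \<in> P" for x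
    using s(2)[OF that, of 0] that by simp
  have "slide P x = x - s x *\<^sub>R escape_direction P" if x: "x \<in> P" for x
  proof -
    have "(THE s. \<forall>t\<ge>0. x - t *\<^sub>R escape_direction P \<in> P \<longleftrightarrow> t \<le> s) = s x"
    proof (rule the_equality)
      show "\<forall>t\<ge>0. x - t *\<^sub>R escape_direction P \<in> P \<longleftrightarrow> t \<le> s x"
        using s(2) x by blast
      fix s' assume s': "\<forall>t\<ge>0. x - t *\<^sub>R escape_direction P \<in> P \<longleftrightarrow> t \<le> s'"
      then have eq: "t \<le> s' \<longleftrightarrow> t \<le> s x" if "0 \<le> t" for t
        using that s(2) x by blast
      have "0 \<le> s'"
        using eq[of 0] pos[OF x] by simp
      then show "s' = s x"
        using eq[of s'] eq[of "s x"] pos[OF x] by linarith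
    qed
    then show ?thesis
      by (simp add: slide_def)
  qed
  then show ?thesis
    using that s pos by blast
qed

text \<open>The face with the exit point in its relative interior cannot have the full recession
  cone: the escape direction would be available in this face, and relative interiority would allow a
  further step back, past the exit time.\<close>

lemma slide_exits:
  fixes P :: "'a::euclidean_space set"
  assumes "polyhedron P" "pointed P" "recession P \<noteq> {0}" "x \<in> P"
  shows "slide P x \<in> P" "x - slide P x \<in> recession P"
    and "\<exists>T. T face_of P \<and> slide P x \<in> T \<and> recession T \<noteq> recession P"
proof -
  let ?w = "escape_direction P"
  obtain s where s: "\<And>x. x \<in> P \<Longrightarrow> 0 \<le> s x"
    "\<And>x t. x \<in> P \<Longrightarrow> 0 \<le> t \<Longrightarrow> x - t *\<^sub>R ?w \<in> P \<longleftrightarrow> t \<le> s x"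
    "\<And>x. x \<in> P \<Longrightarrow> slide P x = x - s x *\<^sub>R ?w"
    using slide_exit_time assms(1-3) by metis
  show y: "slide P x \<in> P"
    using s assms(4) by auto
  show "x - slide P x \<in> recession P"
    using s assms(4) by (simp add: recession_scaleR escape_direction_in_recession)
  obtain T where T: "T face_of P" "slide P x \<in> rel_interior T"
    using polyhedron_point_in_rel_interior_face[OF assms(1) y] .
  have "recession T \<noteq> recession P"
  proof
    assume "recession T = recession P"
    then have w: "?w \<in> recession T"
      using escape_direction_in_recession by blast
    have yT: "slide P x \<in> T"
      using T(2) rel_interior_subset by blast
    have "slide P x + 1 *\<^sub>R ?w \<in> T"
      using recessionD[OF w yT, of 1] by simp
    moreover have "convex T"
      using T(1) face_of_imp_convex by blast
    ultimately obtain e where e: "e > 1" "(1 - e) *\<^sub>R (slide P x + 1 *\<^sub>R ?w) + e *\<^sub>R slide P x \<in> T"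
      using T(2) convex_rel_interior_iff by blast
    have "(1 - e) *\<^sub>R (slide P x + 1 *\<^sub>R ?w) + e *\<^sub>R slide P x = x - (s x + (e - 1)) *\<^sub>R ?w"
      using s(3)[OF assms(4)] by (simp add: algebra_simps)
    then have "x - (s x + (e - 1)) *\<^sub>R ?w \<in> P"
      using e(2) T(1) face_of_imp_subset by fastforce
    then show False
      using s(1)[OF assms(4)] s(2)[OF assms(4), of "s x + (e - 1)"] e(1) by linarith
  qed
  then show "\<exists>T. T face_of P \<and> slide P x \<in> T \<and> recession T \<noteq> recession P"
    using T rel_interior_subset by blast
qed

lemma continuous_on_slide:
  fixes P :: "'a::euclidean_space set"
  assumes "polyhedron P" "pointed P" "recession P \<noteq> {0}"
  shows "continuous_on P (slide P)"
proof -
  obtain s where s: "continuous_on P s" "\<And>x. x \<in> P \<Longrightarrow> slide P x = x - s x *\<^sub>R escape_direction P"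
    using slide_exit_time assms by metis
  show ?thesis
    using s(2) by (simp cong: continuous_on_cong) (intro continuous_intros s(1))
qed

text \<open>On a face with fewer recession directions the slide of the big cell is stationary: a point of
  such a face from which one can move back along a relatively interior recession direction would
  force all recession directions of \<open>P\<close> into the face.\<close>
lemma slide_face:
  fixes P :: "'a::euclidean_space set"
  assumes "polyhedron P" "pointed P" "recession P \<noteq> {0}" "G face_of P" "x \<in> G"
  shows "slide P x = (if recession G = recession P then slide G x else x)"
proof -
  let ?w = "escape_direction P"
  have P: "closed P" "convex P"
    using assms polyhedron_imp_closed polyhedron_imp_convex by auto
  have xP: "x \<in> P"
    using assms face_of_imp_subset by blast
  have w: "?w \<in> recession P"
    by (rule escape_direction_in_recession)
  show ?thesis
  proof (cases "recession G = recession P")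
    case True
    then have dir: "escape_direction G = ?w"
      by (simp add: escape_direction_def)
    \<comment> \<open>Stepping back from a point of \<open>G\<close> inside \<open>P\<close> never
      leaves the face, so both exit times are described by the same condition.\<close>
    have "x - t *\<^sub>R ?w \<in> P \<longleftrightarrow> x - t *\<^sub>R ?w \<in> G" if "0 \<le> t" for t
    proof (cases "t = 0")
      case False
      then show ?thesis
        using face_of_back_along_ray(1)[OF assms(4,5) _ _ w, of t t] that assms(4) face_of_imp_subset
        by fastforce
    qed (use assms xP in auto)
    then show ?thesis
      by (simp add: True slide_def dir cong: imp_cong)
  next
    case False
    obtain s where s: "\<And>x. x \<in> P \<Longrightarrow> 0 \<le> s x"
      "\<And>x t. x \<in> P \<Longrightarrow> 0 \<le> t \<Longrightarrow> x - t *\<^sub>R ?w \<in> P \<longleftrightarrow> t \<le> s x"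
      "\<And>x. x \<in> P \<Longrightarrow> slide P x = x - s x *\<^sub>R ?w"
      using slide_exit_time assms(1-3) by metis
    have G: "closed G" "convex G" "G \<noteq> {}"
      using assms P face_of_imp_closed face_of_imp_convex by blast+
    have "s x = 0"
    proof (rule ccontr)
      assume "s x \<noteq> 0"
      then have pos: "0 < s x"
        using s(1)[OF xP] by simp
      have "x - s x *\<^sub>R ?w \<in> P"
        using s(2)[OF xP] pos by simp
      then have "x + t *\<^sub>R ?w \<in> G" if "0 \<le> t" for t
        using face_of_back_along_ray(2)[OF assms(4,5) _ pos w that] by blast
      then have "?w \<in> recession G"
        using recessionI_ray[OF G(1,2) assms(5)] by blast
      then have "recession G \<inter> rel_interior (recession P) \<noteq> {}"
        using escape_direction_in_rel_interior by blast
      then show False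
        using False face_of_disjoint_rel_interior[OF recession_face_of[OF P assms(4) G(3)]] by blast
    qed
    then show ?thesis
      using False s(3)[OF xP] by simp
  qed
qed

section \<open>Sliding the cells of a complex, by dimension of the recession cone\<close>

lemma polyhedral_complex_subcomplex:
  assumes "polyhedral_complex \<C>" "\<D> \<subseteq> \<C>" "\<And>P T. P \<in> \<D> \<Longrightarrow> T face_of P \<Longrightarrow> T \<in> \<D>"
  shows "polyhedral_complex \<D>"
  using assms unfolding polyhedral_complex_iff by (intro conjI; (blast intro: finite_subset)?)

text \<open>The empty cell is admitted explicitly because \<^term>\<open>recession {}\<close> is the whole space.\<close>
definition recession_skeleton :: "nat \<Rightarrow> 'a::euclidean_space set set \<Rightarrow> 'a set set" where
  "recession_skeleton k \<C> = {P \<in> \<C>. P = {} \<or> aff_dim (recession P) \<le> int k}"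

lemma polyhedral_complex_recession_skeleton:
  assumes "polyhedral_complex \<C>"
  shows "polyhedral_complex (recession_skeleton k \<C>)"
proof (rule polyhedral_complex_subcomplex[OF assms])
  show "recession_skeleton k \<C> \<subseteq> \<C>"
    by (auto simp: recession_skeleton_def)
  fix P T assume P: "P \<in> recession_skeleton k \<C>" and T: "T face_of P"
  have poly: "closed P" "convex P" "T \<in> \<C>"
    using P T assms by (auto simp: polyhedral_complex_iff recession_skeleton_def
        polyhedron_imp_closed polyhedron_imp_convex)
  show "T \<in> recession_skeleton k \<C>"
  proof (cases "T = {}")
    case False
    then have "P \<noteq> {}"
      using T by auto
    moreover have "aff_dim (recession T) \<le> aff_dim (recession P)"
      using recession_mono_face[OF poly(1,2) T False] by (rule aff_dim_subset)
    ultimately show ?thesis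
      using P poly by (auto simp: recession_skeleton_def)
  qed (use poly in \<open>auto simp: recession_skeleton_def\<close>)
qed

text \<open>Staying in the cells makes the straight-line homotopy possible. The recession condition
  controls \<open>F\<close>, which is constant in recession directions of cells where it is affine
  and bounded. Both survive composition, since the recession cone of a nonempty face lies in that of
  the cell.\<close>

definition moves_along_recession :: "'a::euclidean_space set set \<Rightarrow> ('a \<Rightarrow> 'a) \<Rightarrow> bool" where
  "moves_along_recession \<C> r \<longleftrightarrow> (\<forall>P\<in>\<C>. \<forall>x\<in>P. r x \<in> P \<and> x - r x \<in> recession P)"

text \<open>Cells whose cone has the top dimension \<open>k + 1\<close> slide, all others stay
  fixed. This is consistent on faces: the cone of a face is either the same or a proper face of
  smaller dimension, and on a face of the second kind the slide of the larger cell is the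
  identity.\<close>

lemma recession_skeleton_retract_step:
  fixes \<C> :: "'a::euclidean_space set set"
  assumes \<C>: "polyhedral_complex \<C>" and pt: "\<And>P. P \<in> \<C> \<Longrightarrow> P \<noteq> {} \<Longrightarrow> pointed P"
    and skel: "recession_skeleton (Suc k) \<C> = \<C>"
  obtains r where "continuous_on (\<Union>\<C>) r" "moves_along_recession \<C> r"
    "\<And>x. x \<in> \<Union>\<C> \<Longrightarrow> r x \<in> \<Union>(recession_skeleton k \<C>)"
    "\<And>x. x \<in> \<Union>(recession_skeleton k \<C>) \<Longrightarrow> r x = x"
proof -
  have fin: "finite \<C>" and poly: "\<And>P. P \<in> \<C> \<Longrightarrow> polyhedron P"
    and face: "\<And>P T. P \<in> \<C> \<Longrightarrow> T face_of P \<Longrightarrow> T \<in> \<C>"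
    and int: "\<And>P Q. P \<in> \<C> \<Longrightarrow> Q \<in> \<C> \<Longrightarrow> P \<inter> Q face_of P"
    using \<C> by (auto simp: polyhedral_complex_iff)
  have le: "aff_dim (recession P) \<le> int k + 1" if "P \<in> \<C>" "P \<noteq> {}" for P
  proof -
    have "P \<in> recession_skeleton (Suc k) \<C>"
      using skel that by simp
    then show ?thesis
      using that by (simp add: recession_skeleton_def)
  qed
  define maximal where "maximal P \<longleftrightarrow> aff_dim (recession P) = int k + 1" for P :: "'a set"
  have max_nz: "recession P \<noteq> {0}" if "maximal P" for P
  proof
    assume "recession P = {0}"
    then have "aff_dim (recession P) = 0"
      by (simp only: aff_dim_sing)
    then show False
      using that by (simp add: maximal_def)
  qed
  define sl where "sl P x = (if maximal P then slide P x else x)" for P x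
  have sl_face: "sl G x = sl P x" if P: "P \<in> \<C>" and G: "G face_of P" and x: "x \<in> G" for P G x
  proof -
    have ne: "P \<noteq> {}" "G \<noteq> {}"
      using G x face_of_imp_subset by blast+
    have cl: "closed P" "convex P"
      using poly[OF P] polyhedron_imp_closed polyhedron_imp_convex by auto
    have rf: "recession G face_of recession P"
      using recession_face_of cl G ne by blast
    show ?thesis
    proof (cases "maximal P")
      case True
      show ?thesis
      proof (cases "recession G = recession P")
        case True
        then show ?thesis
          using slide_face[OF poly[OF P] pt[OF P ne(1)] max_nz[OF \<open>maximal P\<close>] G x] \<open>maximal P\<close>
          by (simp add: sl_def maximal_def)
      next
        case False
        then have "aff_dim (recession G) < aff_dim (recession P)"
          using face_of_aff_dim_lt[OF convex_recession rf] by blast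
        then have "\<not> maximal G"
          using True by (simp add: maximal_def)
        then show ?thesis
          using slide_face[OF poly[OF P] pt[OF P ne(1)] max_nz[OF \<open>maximal P\<close>] G x] False
          by (simp add: sl_def)
      qed
    next
      case False
      have "aff_dim (recession G) \<le> aff_dim (recession P)"
        using rf face_of_imp_subset aff_dim_subset by blast
      then have "\<not> maximal G"
        using False le[OF P ne(1)] by (simp add: maximal_def)
      then show ?thesis
        using False by (simp add: sl_def)
    qed
  qed
  define r where "r x = sl (SOME P. P \<in> \<C> \<and> x \<in> P) x" for x
  have r: "r x = sl P x" if P: "P \<in> \<C>" "x \<in> P" for P x
  proof -
    define Q where "Q = (SOME P. P \<in> \<C> \<and> x \<in> P)"
    have Q: "Q \<in> \<C>" "x \<in> Q"
      using someI[of "\<lambda>P. P \<in> \<C> \<and> x \<in> P" P] that unfolding Q_def by auto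
    \<comment> \<open>Two cells containing \<open>x\<close> are compared through their intersection,
      a face of both.\<close>
    have "sl (P \<inter> Q) x = sl P x" "sl (P \<inter> Q) x = sl Q x"
      using sl_face[OF P(1) int[OF P(1) Q(1)]] sl_face[OF Q(1)] int[OF Q(1) P(1)] P Q
      by (auto simp: Int_commute)
    then show ?thesis
      by (simp add: r_def flip: Q_def)
  qed
  show ?thesis
  proof
    have "continuous_on P r" if P: "P \<in> \<C>" for P
    proof (cases "P = {}")
      case False
      have "continuous_on P (sl P)"
        unfolding sl_def using continuous_on_slide[OF poly[OF P] pt[OF P False]] max_nz
        by (cases "maximal P") auto
      then show ?thesis
        using r[OF P] by (simp cong: continuous_on_cong)
    qed simp
    then show "continuous_on (\<Union>\<C>) r"
      using fin poly polyhedron_imp_closed by (intro continuous_on_closed_Union[of \<C> id, simplified]) auto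
    show "moves_along_recession \<C> r"
      unfolding moves_along_recession_def
      using slide_exits[OF poly pt max_nz] by (auto simp: r sl_def)
    show "r x = x" if x: "x \<in> \<Union>(recession_skeleton k \<C>)" for x
    proof -
      obtain P where P: "P \<in> recession_skeleton k \<C>" "x \<in> P"
        using x by blast
      then have "\<not> maximal P"
        by (auto simp: maximal_def recession_skeleton_def)
      then show ?thesis
        using r[of P x] P by (simp add: recession_skeleton_def sl_def)
    qed
    show "r x \<in> \<Union>(recession_skeleton k \<C>)" if x: "x \<in> \<Union>\<C>" for x
    proof -
      obtain P where P: "P \<in> \<C>" "x \<in> P"
        using x by blast
      show ?thesis
      proof (cases "maximal P")
        case True
        have ne: "P \<noteq> {}"
          using P by blast
        obtain T where T: "T face_of P" "slide P x \<in> T" "recession T \<noteq> recession P"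
          using slide_exits(3)[OF poly[OF P(1)] pt[OF P(1) ne] max_nz[OF True] P(2)] by blast
        \<comment> \<open>The cone of the exit face is a proper face of the cone of
          \<open>P\<close>, so its dimension drops.\<close>
        have "recession T face_of recession P"
          using poly[OF P(1)] polyhedron_imp_closed polyhedron_imp_convex T
          by (intro recession_face_of) auto
        then have "aff_dim (recession T) < aff_dim (recession P)"
          using face_of_aff_dim_lt[OF convex_recession] T(3) by blast
        then have "T \<in> recession_skeleton k \<C>"
          using face[OF P(1) T(1)] le[OF P(1) ne] by (simp add: recession_skeleton_def)
        then show ?thesis
          using r[OF P] True T(2) by (auto simp: sl_def)
      next
        case False
        then have "P \<in> recession_skeleton k \<C>"
          using P le[OF P(1)] by (force simp: recession_skeleton_def maximal_def)
        then show ?thesis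
          using r[OF P] False P by (auto simp: sl_def)
      qed
    qed
  qed
qed

lemma recession_skeleton_retract:
  fixes \<C> :: "'a::euclidean_space set set"
  assumes "polyhedral_complex \<C>" "\<And>P. P \<in> \<C> \<Longrightarrow> P \<noteq> {} \<Longrightarrow> pointed P"
    and "recession_skeleton k \<C> = \<C>"
  shows "\<exists>r. continuous_on (\<Union>\<C>) r \<and> moves_along_recession \<C> r \<and>
    (\<forall>x\<in>\<Union>\<C>. r x \<in> \<Union>(recession_skeleton 0 \<C>)) \<and> (\<forall>x\<in>\<Union>(recession_skeleton 0 \<C>). r x = x)"
  using assms
proof (induction k arbitrary: \<C>)
  case 0
  then show ?case
    by (intro exI[of _ "\<lambda>x. x"]) (auto simp: moves_along_recession_def)
next
  case (Suc k)
  obtain r where r: "continuous_on (\<Union>\<C>) r" "moves_along_recession \<C> r"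
    "\<And>x. x \<in> \<Union>\<C> \<Longrightarrow> r x \<in> \<Union>(recession_skeleton k \<C>)"
    "\<And>x. x \<in> \<Union>(recession_skeleton k \<C>) \<Longrightarrow> r x = x"
    using recession_skeleton_retract_step Suc.prems by blast
  let ?S = "recession_skeleton k \<C>"
  have S: "polyhedral_complex ?S"
    using Suc.prems polyhedral_complex_recession_skeleton by blast
  have "?S \<subseteq> \<C>" "recession_skeleton k ?S = ?S" and S0: "recession_skeleton 0 ?S = recession_skeleton 0 \<C>"
    by (auto simp: recession_skeleton_def)
  then obtain q where q: "continuous_on (\<Union>?S) q" "moves_along_recession ?S q"
    "\<forall>x\<in>\<Union>?S. q x \<in> \<Union>(recession_skeleton 0 \<C>)" "\<forall>x\<in>\<Union>(recession_skeleton 0 \<C>). q x = x"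
    using Suc.IH[OF S] Suc.prems(2) by (metis (no_types, lifting) subset_iff)
  have "moves_along_recession \<C> (q \<circ> r)"
    unfolding moves_along_recession_def
  proof (intro ballI)
    fix P x assume P: "P \<in> \<C>" "x \<in> P"
    have rx: "r x \<in> P" "x - r x \<in> recession P"
      using r(2) P by (auto simp: moves_along_recession_def)
    obtain Q where Q: "Q \<in> ?S" "r x \<in> Q"
      using r(3) P by blast
    \<comment> \<open>The map \<open>q\<close> respects only cells of the skeleton, and
      \<open>P\<close> need not be one. The common face of \<open>P\<close> and \<open>Q\<close> is,
      so \<open>q\<close> keeps \<open>r x\<close> inside \<open>P\<close>.\<close>
    let ?T = "P \<inter> Q"
    have T: "?T face_of P" "?T face_of Q"
      using Suc.prems(1) P Q \<open>?S \<subseteq> \<C>\<close> unfolding polyhedral_complex_iff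
      by (blast, metis Int_commute subset_iff)
    then have "?T \<in> ?S"
      using S Q by (auto simp: polyhedral_complex_iff)
    then have qr: "q (r x) \<in> ?T" "r x - q (r x) \<in> recession ?T"
      using q(2) rx Q by (auto simp: moves_along_recession_def)
    have "polyhedron P"
      using P Suc.prems(1) by (simp add: polyhedral_complex_iff)
    then have "recession ?T \<subseteq> recession P"
      using T qr(1) by (intro recession_mono_face polyhedron_imp_closed polyhedron_imp_convex) auto
    then have "(x - r x) + (r x - q (r x)) \<in> recession P"
      using rx(2) qr(2) recession_add by blast
    then show "(q \<circ> r) x \<in> P \<and> x - (q \<circ> r) x \<in> recession P"
      using qr by simp
  qed
  moreover have "continuous_on (\<Union>\<C>) (q \<circ> r)"
    using r(1,3) by (intro continuous_on_compose continuous_on_subset[OF q(1)]) auto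
  moreover have "\<Union>(recession_skeleton 0 \<C>) \<subseteq> \<Union>?S"
    by (auto simp: recession_skeleton_def)
  moreover have "(q \<circ> r) x \<in> \<Union>(recession_skeleton 0 \<C>)" if "x \<in> \<Union>\<C>" for x
    using q(3) r(3)[OF that] unfolding comp_apply by blast
  moreover have "(q \<circ> r) x = x" if "x \<in> \<Union>(recession_skeleton 0 \<C>)" for x
  proof -
    have "r x = x"
      using that \<open>\<Union>(recession_skeleton 0 \<C>) \<subseteq> \<Union>?S\<close> by (intro r(4)) blast
    then show ?thesis
      using q(4) that by (metis comp_apply)
  qed
  ultimately show ?case
    by blast
qed

text \<open>A pointed complex is retracted onto its bounded cells by sliding, for \<open>k\<close> from the dimension
  of the space down to 1, all cells with \<open>k\<close>-dimensional recession cone.\<close>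
proposition pointed_complex_retract_bounded:
  fixes \<C> :: "'a::euclidean_space set set"
  assumes "polyhedral_complex \<C>" "\<And>P. P \<in> \<C> \<Longrightarrow> P \<noteq> {} \<Longrightarrow> pointed P"
  obtains r where "continuous_on (\<Union>\<C>) r" "moves_along_recession \<C> r"
    "\<And>x. x \<in> \<Union>\<C> \<Longrightarrow> r x \<in> \<Union>{P\<in>\<C>. bounded P}" "\<And>x. x \<in> \<Union>{P\<in>\<C>. bounded P} \<Longrightarrow> r x = x"
proof -
  have "recession_skeleton DIM('a) \<C> = \<C>"
    by (auto simp: recession_skeleton_def aff_dim_le_DIM)
  moreover have "recession_skeleton 0 \<C> = {P\<in>\<C>. bounded P}"
  proof -
    have "bounded P \<longleftrightarrow> aff_dim (recession P) \<le> 0" if "P \<in> \<C>" "P \<noteq> {}" for P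
    proof
      assume "bounded P"
      then show "aff_dim (recession P) \<le> 0"
        using bounded_imp_recession_zero that by fastforce
    next
      assume "aff_dim (recession P) \<le> 0"
      moreover have "aff_dim (recession P) \<ge> 0"
        using zero_in_recession[of P] aff_dim_negative_iff[of "recession P"] by (metis empty_iff linorder_not_le)
      ultimately have "recession P = {0}"
        using zero_in_recession[of P] aff_dim_eq_0[of "recession P"] by (metis order_antisym singletonD)
      moreover have "polyhedron P"
        using assms(1) that by (simp add: polyhedral_complex_iff)
      ultimately show "bounded P"
        using unbounded_imp_recession_nonzero[of P] polyhedron_imp_closed[of P]
          polyhedron_imp_convex[of P] by blast
    qed
    then show ?thesis
      by (auto simp: recession_skeleton_def)
  qed
  ultimately show ?thesis
    using recession_skeleton_retract[OF assms] that by metis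
qed

section \<open>Removing flat lineality\<close>

text \<open>The point \<open>x\<close> is the midpoint of \<open>x + t *\<^sub>R v\<close> and
  \<open>x - t *\<^sub>R v\<close>.\<close>

lemma face_of_contains_line:
  assumes "G face_of P" "x \<in> G" "\<And>t::real. x + t *\<^sub>R v \<in> P"
  shows "x + t *\<^sub>R v \<in> G"
proof (cases "t *\<^sub>R v = 0")
  case False
  have "x + t *\<^sub>R v \<noteq> x + (- t) *\<^sub>R v"
  proof
    assume "x + t *\<^sub>R v = x + (- t) *\<^sub>R v"
    then have "t *\<^sub>R v + t *\<^sub>R v = 0"
      by (simp add: eq_neg_iff_add_eq_0)
    then have "2 *\<^sub>R (t *\<^sub>R v) = 0"
      by (simp only: scaleR_2)
    then show False
      using False by simp
  qed
  moreover have "x = (1 - 1 / 2) *\<^sub>R (x + t *\<^sub>R v) + (1 / 2) *\<^sub>R (x + (- t) *\<^sub>R v)"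
    by (simp add: algebra_simps flip: scaleR_add_left)
  ultimately have "x \<in> open_segment (x + t *\<^sub>R v) (x + (- t) *\<^sub>R v)"
    unfolding in_segment by (intro conjI exI[of _ "1 / 2"]) auto
  then show ?thesis
    using face_ofD[OF assms(1)] assms(2,3) by blast
qed (use assms in auto)

text \<open>The part of the lineality space that a projection can remove without changing
  \<open>F\<close>.\<close>

definition flat_lineality :: "('a::real_vector \<Rightarrow> real) \<Rightarrow> 'a set \<Rightarrow> 'a set" where
  "flat_lineality F P = {v. \<forall>x\<in>P. \<forall>t. x + t *\<^sub>R v \<in> P \<and> F (x + t *\<^sub>R v) = F x}"

lemma flat_linealityD:
  "\<lbrakk>v \<in> flat_lineality F P; x \<in> P\<rbrakk> \<Longrightarrow> x + t *\<^sub>R v \<in> P"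
  "\<lbrakk>v \<in> flat_lineality F P; x \<in> P\<rbrakk> \<Longrightarrow> F (x + t *\<^sub>R v) = F x"
  by (auto simp: flat_lineality_def)

lemma subspace_flat_lineality: "subspace (flat_lineality F P)"
  unfolding subspace_def
proof (intro conjI ballI allI)
  fix v w assume v: "v \<in> flat_lineality F P" and w: "w \<in> flat_lineality F P"
  have "(x + t *\<^sub>R v) + t *\<^sub>R w \<in> P \<and> F ((x + t *\<^sub>R v) + t *\<^sub>R w) = F x" if "x \<in> P" for x t
    using flat_linealityD[OF v that] flat_linealityD[OF w] by simp
  then show "v + w \<in> flat_lineality F P"
    by (simp add: flat_lineality_def scaleR_add_right add.assoc)
qed (auto simp: flat_lineality_def)

text \<open>One flat line is enough: its two rays give recession directions valid at every point of
  \<open>P\<close>, and the slope of the affine function along \<open>v\<close> does not depend on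
  the point.\<close>

lemma flat_linealityI_line:
  fixes P :: "'a::euclidean_space set"
  assumes P: "closed P" "convex P" and F: "\<And>y. y \<in> P \<Longrightarrow> F y = u \<bullet> y + d"
    and x: "x \<in> P" and line: "\<And>t. x + t *\<^sub>R v \<in> P" "\<And>t. F (x + t *\<^sub>R v) = F x"
  shows "v \<in> flat_lineality F P"
proof -
  have pos: "v \<in> recession P"
    using recessionI_ray[OF P x] line(1) by blast
  have neg: "- v \<in> recession P"
    using line(1) by (intro recessionI_ray[OF P x]) (metis scaleR_minus_left scaleR_minus_right)
  have in_P: "y + t *\<^sub>R v \<in> P" if "y \<in> P" for y t
  proof (cases "0 \<le> t")
    case True
    then show ?thesis
      using recessionD[OF pos that] by blast
  next
    case False
    then show ?thesis
      using recessionD[OF neg that, of "- t"] by simp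
  qed
  have "u \<bullet> v = 0"
    using F[OF line(1)[of 1]] F[OF x] line(2)[of 1] by (simp add: inner_add_right)
  then have "F (y + t *\<^sub>R v) = F y" if "y \<in> P" for y t
    using F[OF in_P[OF that]] F[OF that] by (simp add: inner_add_right)
  then show ?thesis
    using in_P by (simp add: flat_lineality_def)
qed

text \<open>A face inherits all lines of \<open>P\<close> through its points, and conversely a
  single flat line in the face gives a flat direction of \<open>P\<close>.\<close>

lemma flat_lineality_face:
  fixes P :: "'a::euclidean_space set"
  assumes P: "closed P" "convex P" and F: "\<And>y. y \<in> P \<Longrightarrow> F y = u \<bullet> y + d"
    and G: "G face_of P" "G \<noteq> {}"
  shows "flat_lineality F G = flat_lineality F P"
proof (intro subset_antisym subsetI)
  have GP: "G \<subseteq> P"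
    using G(1) face_of_imp_subset by blast
  obtain x where x: "x \<in> G"
    using G(2) by blast
  fix v
  show "v \<in> flat_lineality F P" if v: "v \<in> flat_lineality F G"
    using flat_linealityD[OF v x] x GP by (intro flat_linealityI_line[OF P F, of x]) auto
  show "v \<in> flat_lineality F G" if v: "v \<in> flat_lineality F P"
  proof -
    have "y + t *\<^sub>R v \<in> G \<and> F (y + t *\<^sub>R v) = F y" if y: "y \<in> G" for y t
      using face_of_contains_line[OF G(1) y] flat_linealityD[OF v] y GP by blast
    then show ?thesis
      by (simp add: flat_lineality_def)
  qed
qed

section \<open>Orthogonal projection along flat directions\<close>

lemma orthogonal_projection_exists:
  fixes L :: "'a::euclidean_space set"
  assumes "subspace L"
  shows "\<exists>\<pi>. linear \<pi> \<and> (\<forall>x. x - \<pi> x \<in> L) \<and> (\<forall>x. \<forall>v\<in>L. \<pi> x \<bullet> v = 0)"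
proof -
  obtain B where B: "pairwise orthogonal B" "span B = L" "independent B"
    using orthogonal_basis_subspace[OF assms] by metis
  have fin: "finite B"
    using B(3) independent_imp_finite by blast
  let ?p = "\<lambda>x. \<Sum>b\<in>B. (b \<bullet> x / (b \<bullet> b)) *\<^sub>R b"
  have "linear ?p"
    by (intro linear_compose_sum linear_scaleR_left ballI linearI)
      (auto simp: inner_add_right add_divide_distrib algebra_simps)
  then have "linear (\<lambda>x. x - ?p x)"
    by (intro linear_compose_sub linear_ident)
  moreover have "?p x \<in> L" for x
    using B(2) by (metis (no_types, lifting) span_base span_scale span_sum)
  moreover have "(x - ?p x) \<bullet> v = 0" if "v \<in> L" for x v
    using Gram_Schmidt_step[OF B(1), of v x] that B(2) by (simp add: orthogonal_def inner_commute)
  ultimately show ?thesis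
    by (intro exI[of _ "\<lambda>x. x - ?p x"]) auto
qed

definition perp_projection :: "'a::euclidean_space set \<Rightarrow> 'a \<Rightarrow> 'a" where
  "perp_projection L = (SOME \<pi>. linear \<pi> \<and> (\<forall>x. x - \<pi> x \<in> L) \<and> (\<forall>x. \<forall>v\<in>L. \<pi> x \<bullet> v = 0))"

definition perp :: "'a::euclidean_space set \<Rightarrow> 'a set" where
  "perp L = {x. \<forall>v\<in>L. x \<bullet> v = 0}"

lemma subspace_perp: "subspace (perp L)"
  by (auto simp: perp_def subspace_def inner_add_left)

lemma perp_projection:
  fixes L :: "'a::euclidean_space set"
  assumes "subspace L"
  shows "linear (perp_projection L)" "x - perp_projection L x \<in> L" "perp_projection L x \<in> perp L"
    and "x \<in> perp L \<Longrightarrow> perp_projection L x = x"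
proof -
  have *: "linear (perp_projection L)" "\<And>x. x - perp_projection L x \<in> L"
    "\<And>x. perp_projection L x \<in> perp L"
    using someI_ex[OF orthogonal_projection_exists[OF assms]]
    unfolding perp_projection_def perp_def by auto
  then show "linear (perp_projection L)" "x - perp_projection L x \<in> L" "perp_projection L x \<in> perp L"
    by auto
  assume "x \<in> perp L"
  then have "x - perp_projection L x \<in> perp L"
    using *(3) subspace_diff subspace_perp by blast
  then have "(x - perp_projection L x) \<bullet> (x - perp_projection L x) = 0"
    using *(2)[of x] unfolding perp_def by blast
  then show "perp_projection L x = x"
    by simp
qed

text \<open>Faces of the slice are cut out by faces of \<open>P\<close>, namely by their preimages
  under the projection. This makes the family of slices closed under faces.\<close>

lemma face_of_perp_slice:
  fixes P :: "'a::euclidean_space set"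
  assumes L: "subspace L" "\<And>x v. x \<in> P \<Longrightarrow> v \<in> L \<Longrightarrow> x + v \<in> P" and P: "convex P"
    and T: "T face_of (P \<inter> perp L)"
  shows "{x \<in> P. perp_projection L x \<in> T} face_of P" "T = {x \<in> P. perp_projection L x \<in> T} \<inter> perp L"
proof -
  let ?\<pi> = "perp_projection L" and ?G = "{x \<in> P. perp_projection L x \<in> T}"
  have lin: "linear ?\<pi>"
    using perp_projection(1)[OF L(1)] .
  have \<pi>P: "?\<pi> x \<in> P \<inter> perp L" if "x \<in> P" for x
  proof -
    have "- (x - ?\<pi> x) \<in> L"
      using perp_projection(2)[OF L(1)] subspace_neg[OF L(1)] by blast
    then have "x + - (x - ?\<pi> x) \<in> P"
      using L(2) that by blast
    then show ?thesis
      using perp_projection(3)[OF L(1)] by simp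
  qed
  have TP: "T \<subseteq> P \<inter> perp L"
    using T face_of_imp_subset by blast
  then show "T = ?G \<inter> perp L"
    using perp_projection(4)[OF L(1)] by (auto simp: subset_iff)
  show "?G face_of P"
    unfolding face_of_def
  proof (intro conjI ballI impI)
    show "?G \<subseteq> P" by blast
    have "?G = P \<inter> ?\<pi> -` T" by auto
    then show "convex ?G"
      using P lin T face_of_imp_convex by (metis convex_Int convex_linear_vimage)
    fix y z x assume y: "y \<in> P" and z: "z \<in> P" and x: "x \<in> ?G" "x \<in> open_segment y z"
    obtain u where u: "0 < u" "u < 1" "x = (1 - u) *\<^sub>R y + u *\<^sub>R z"
      using x(2) by (auto simp: in_segment)
    have eq: "?\<pi> x = (1 - u) *\<^sub>R ?\<pi> y + u *\<^sub>R ?\<pi> z"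
      by (simp add: u linear_add[OF lin] linear_scale[OF lin])
    have "?\<pi> y \<in> T \<and> ?\<pi> z \<in> T"
    \<comment> \<open>If the projections coincide there is no open segment to apply the face
      property to, but then all three projected points are equal.\<close>
    proof (cases "?\<pi> y = ?\<pi> z")
      case True
      then have "?\<pi> x = ?\<pi> y"
        using eq by (simp flip: scaleR_add_left)
      then show ?thesis
        using x(1) True by simp
    next
      case False
      then have "?\<pi> x \<in> open_segment (?\<pi> y) (?\<pi> z)"
        using u eq by (auto simp: in_segment)
      then show ?thesis
        using face_ofD[OF T] \<pi>P y z x(1) by blast
    qed
    then show "y \<in> ?G" "z \<in> ?G"
      using y z by auto
  qed
qed

text \<open>Intersecting cells have the same flat lineality space, so the orthogonal projections along
  these spaces fit together.\<close>
proposition lineality_reduction: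
  fixes \<C> :: "'a::euclidean_space set set"
  assumes \<C>: "polyhedral_complex \<C>" and F: "cellwise_affine \<C> F" and tr: "transversal_thresholds \<C> F a b"
  obtains \<E> q where "polyhedral_complex \<E>" "cellwise_affine \<E> F" "transversal_thresholds \<E> F a b"
    "\<And>P. P \<in> \<E> \<Longrightarrow> P \<noteq> {} \<Longrightarrow> flat_lineality F P = {0}" "\<Union>\<E> \<subseteq> \<Union>\<C>"
    "continuous_on (\<Union>\<C>) q" "\<And>x. x \<in> \<Union>\<C> \<Longrightarrow> F (q x) = F x" "\<And>x. x \<in> \<Union>\<E> \<Longrightarrow> q x = x"
    "\<And>P x. P \<in> \<C> \<Longrightarrow> x \<in> P \<Longrightarrow> \<exists>Q\<in>\<E>. Q \<subseteq> P \<and> q x \<in> Q"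
proof -
  have fin: "finite \<C>" and poly: "\<And>P. P \<in> \<C> \<Longrightarrow> polyhedron P"
    and face: "\<And>P T. P \<in> \<C> \<Longrightarrow> T face_of P \<Longrightarrow> T \<in> \<C>"
    and int: "\<And>P Q. P \<in> \<C> \<Longrightarrow> Q \<in> \<C> \<Longrightarrow> P \<inter> Q face_of P"
    using \<C> by (auto simp: polyhedral_complex_iff)
  have cl: "closed P" "convex P" if "P \<in> \<C>" for P
    using poly[OF that] polyhedron_imp_closed polyhedron_imp_convex by auto
  have Faff: "\<exists>u d. \<forall>x\<in>P. F x = u \<bullet> x + d" if "P \<in> \<C>" for P
    using F that by (auto simp: cellwise_affine_def)
  define L where "L P = flat_lineality F P" for P
  have sub: "subspace (L P)" for P
    unfolding L_def by (rule subspace_flat_lineality)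
  have L_face: "L G = L P" if PC: "P \<in> \<C>" and G: "G face_of P" "G \<noteq> {}" for P G
  proof -
    obtain u d where "\<forall>x\<in>P. F x = u \<bullet> x + d"
      using Faff[OF PC] by blast
    then show ?thesis
      unfolding L_def using flat_lineality_face[OF cl[OF PC] _ G] by blast
  qed
  \<comment> \<open>Both spaces equal that of the common face, which is nonempty because of
    \<open>x\<close>.\<close>
  have L_eq: "L P = L Q" if "P \<in> \<C>" "Q \<in> \<C>" "x \<in> P" "x \<in> Q" for P Q x
    using L_face[OF that(1) int[OF that(1,2)]] L_face[OF that(2) int[OF that(2,1)]] that(3,4)
    by (auto simp: Int_commute)
  let ?\<pi> = "\<lambda>P. perp_projection (L P)"
  have \<pi>_in: "?\<pi> P x \<in> P" and \<pi>_F: "F (?\<pi> P x) = F x" if "x \<in> P" for P x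
    using flat_linealityD[of "x - ?\<pi> P x" F P x "- 1"] perp_projection(2)[OF sub, of x P] that
    by (simp_all add: L_def)
  define red where "red P = P \<inter> perp (L P)" for P
  define \<E> where "\<E> = red ` \<C>"
  have red_face: "\<exists>G\<in>\<C>. G face_of P \<and> T = red G \<and> (\<forall>x\<in>G. ?\<pi> P x \<in> T)" if P: "P \<in> \<C>" and T: "T face_of red P" for P T
  proof (cases "T = {}")
    case True
    have "{} \<in> \<C>"
      using face[OF P] by blast
    then show ?thesis
      using True by (intro bexI[of _ "{}"]) (auto simp: red_def)
  next
    case False
    let ?G = "{x \<in> P. ?\<pi> P x \<in> T}"
    have "x + v \<in> P" if "x \<in> P" "v \<in> L P" for x v
      using flat_linealityD(1)[of v F P x 1] that by (simp add: L_def)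
    note * = face_of_perp_slice[OF sub this cl(2)[OF P] T[unfolded red_def]]
    have "?G \<noteq> {}"
      using *(2) False by blast
    then have "T = red ?G"
      using *(2) L_face[OF P *(1)] by (simp add: red_def)
    then show ?thesis
      using face[OF P *(1)] *(1) by (intro bexI[of _ ?G]) auto
  qed
  have E1: "polyhedral_complex \<E>"
    unfolding polyhedral_complex_iff
  proof (intro conjI ballI allI impI)
    show "finite \<E>"
      using fin by (simp add: \<E>_def)
    fix R assume "R \<in> \<E>"
    then obtain P where P: "P \<in> \<C>" "R = red P"
      by (auto simp: \<E>_def)
    show "polyhedron R"
      unfolding P(2) red_def
      by (intro polyhedron_Int poly[OF P(1)] affine_imp_polyhedron[OF subspace_imp_affine[OF subspace_perp]])
    show "T \<in> \<E>" if "T face_of R" for T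
      using red_face[OF P(1)] that P(2) by (auto simp: \<E>_def)
    fix R' assume "R' \<in> \<E>"
    then obtain Q where Q: "Q \<in> \<C>" "R' = red Q"
      by (auto simp: \<E>_def)
    show "R \<inter> R' face_of R"
    proof (cases "P \<inter> Q = {}")
      case True
      then have "R \<inter> R' = {}"
        by (auto simp: P Q red_def)
      then show ?thesis by simp
    next
      case False
      then have "L P = L Q"
        using L_eq P Q by blast
      then have "R \<inter> R' = (P \<inter> Q) \<inter> perp (L P)"
        by (auto simp: P Q red_def)
      then show ?thesis
        using face_of_slice[OF int[OF P(1) Q(1)] subspace_imp_convex[OF subspace_perp]]
        by (simp add: P red_def)
    qed
  qed
  have E2: "cellwise_affine \<E> F"
    unfolding cellwise_affine_def
  proof
    fix R assume "R \<in> \<E>"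
    then obtain P where P: "P \<in> \<C>" "R \<subseteq> P"
      by (auto simp: \<E>_def red_def)
    then show "\<exists>u d. \<forall>x\<in>R. F x = u \<bullet> x + d"
      using Faff[OF P(1)] by blast
  qed
  \<comment> \<open>The projection preserves \<open>F\<close>, so a flat slice over
    \<open>{a..b}\<close> would come from a flat cell over \<open>{a..b}\<close>.\<close>
  have E3: "transversal_thresholds \<E> F a b"
    unfolding transversal_thresholds_def
  proof
    assume "\<exists>R\<in>\<E>. flat_cell F R \<and> F ` R \<subseteq> {a..b}"
    then obtain P where P: "P \<in> \<C>" "flat_cell F (red P)" "F ` red P \<subseteq> {a..b}"
      by (auto simp: \<E>_def)
    have "?\<pi> P x \<in> red P" if "x \<in> P" for x
      using \<pi>_in[OF that] perp_projection(3)[OF sub] by (simp add: red_def)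
    then have *: "\<exists>y\<in>red P. F x = F y" if "x \<in> P" for x
      using \<pi>_F[OF that] that by (metis)
    obtain k where k: "\<And>y. y \<in> red P \<Longrightarrow> F y = k" and ne: "red P \<noteq> {}"
      using P(2) by (auto simp: flat_cell_def)
    have "F x = k" if "x \<in> P" for x
      using *[OF that] k by auto
    moreover have "P \<noteq> {}"
      using ne by (auto simp: red_def)
    moreover have "k \<in> {a..b}"
      using P(3) k ne by blast
    ultimately have "flat_cell F P" "F ` P \<subseteq> {a..b}"
      by (auto simp: flat_cell_def)
    then show False
      using tr P(1) by (auto simp: transversal_thresholds_def)
  qed
  have E4: "flat_lineality F R = {0}" if R: "R \<in> \<E>" "R \<noteq> {}" for R
  proof -
    obtain P where P: "P \<in> \<C>" "R = red P"
      using R(1) by (auto simp: \<E>_def)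
    obtain u d where ud: "\<And>x. x \<in> P \<Longrightarrow> F x = u \<bullet> x + d"
      using Faff[OF P(1)] by blast
    obtain x where x: "x \<in> R"
      using R(2) by blast
    have "v = 0" if v: "v \<in> flat_lineality F R" for v
    proof -
      \<comment> \<open>A flat direction of the slice is a flat direction of \<open>P\<close>, hence
        in \<open>L P\<close>; as a difference of two points of the slice it is also orthogonal to
        \<open>L P\<close>.\<close>
      have "v \<in> L P"
        unfolding L_def using flat_linealityD[OF v x] x P(2)
        by (intro flat_linealityI_line[OF cl[OF P(1)] ud, of x]) (auto simp: red_def)
      moreover have "x + 1 *\<^sub>R v \<in> perp (L P)" "x \<in> perp (L P)"
        using flat_linealityD(1)[OF v x, of 1] x P(2) unfolding red_def by blast+
      then have "(x + 1 *\<^sub>R v) - x \<in> perp (L P)"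
        using subspace_diff[OF subspace_perp] by blast
      ultimately have "v \<bullet> v = 0"
        by (simp add: perp_def)
      then show ?thesis
        by simp
    qed
    then show ?thesis
      using subspace_0[OF subspace_flat_lineality] by blast
  qed
  define q where "q x = ?\<pi> (SOME P. P \<in> \<C> \<and> x \<in> P) x" for x
  have q: "q x = ?\<pi> P x" if P: "P \<in> \<C>" "x \<in> P" for P x
  proof -
    define Q where "Q = (SOME P. P \<in> \<C> \<and> x \<in> P)"
    have "Q \<in> \<C> \<and> x \<in> Q"
      unfolding Q_def using someI[of "\<lambda>P. P \<in> \<C> \<and> x \<in> P" P] that by blast
    then have "L Q = L P"
      using L_eq P by blast
    then show ?thesis
      unfolding q_def by (simp flip: Q_def)
  qed
  have qred: "q x \<in> red P" if "P \<in> \<C>" "x \<in> P" for P x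
    using q[OF that] \<pi>_in[OF that(2)] perp_projection(3)[OF sub] by (simp add: red_def)
  show ?thesis
  proof
    show "polyhedral_complex \<E>" "cellwise_affine \<E> F" "transversal_thresholds \<E> F a b"
      by fact+
    show "\<And>P. P \<in> \<E> \<Longrightarrow> P \<noteq> {} \<Longrightarrow> flat_lineality F P = {0}"
      by fact
    show "\<Union>\<E> \<subseteq> \<Union>\<C>"
      by (auto simp: \<E>_def red_def)
    show "continuous_on (\<Union>\<C>) q"
    proof -
      have "continuous_on P q" if P: "P \<in> \<C>" for P
      proof -
        have "continuous_on P (?\<pi> P)"
          using perp_projection(1)[OF sub] linear_continuous_on linear_conv_bounded_linear by blast
        then show ?thesis
          using q[OF P] by (simp cong: continuous_on_cong)
      qed
      then show ?thesis
        using fin cl by (intro continuous_on_closed_Union[of \<C> id, simplified]) auto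
    qed
    show "F (q x) = F x" if "x \<in> \<Union>\<C>" for x
      using that q \<pi>_F by auto
    show "q x = x" if x: "x \<in> \<Union>\<E>" for x
    proof -
      obtain P where P: "P \<in> \<C>" "x \<in> P" "x \<in> perp (L P)"
        using x by (auto simp: \<E>_def red_def)
      then show ?thesis
        using q perp_projection(4)[OF sub] by simp
    qed
    show "\<exists>Q\<in>\<E>. Q \<subseteq> P \<and> q x \<in> Q" if "P \<in> \<C>" "x \<in> P" for P x
      using qred[OF that] that(1) by (intro bexI[of _ "red P"]) (auto simp: \<E>_def red_def)
  qed
qed

section \<open>Barycentric coordinates in cell families\<close>

text \<open>A ray from a relatively interior point meets the relative frontier only once: if
  \<open>c' < c\<close>, then \<open>y\<close> would lie strictly between \<open>p\<close> and
  \<open>y'\<close> and be relatively interior.\<close>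

lemma rel_frontier_ray_le:
  fixes S :: "'a::euclidean_space set"
  assumes S: "convex S" "closed S" and p: "p \<in> rel_interior S"
    and y: "y \<in> rel_frontier S" "y' \<in> rel_frontier S"
    and c: "0 < c" "0 < c'" and eq: "c *\<^sub>R (y - p) = c' *\<^sub>R (y' - p)"
  shows "c \<le> c'"
proof (rule ccontr)
  assume "\<not> c \<le> c'"
  have yy: "y - p = (c' / c) *\<^sub>R (y' - p)"
  proof -
    have "y - p = (1 / c) *\<^sub>R (c *\<^sub>R (y - p))"
      using c by simp
    also have "\<dots> = (c' / c) *\<^sub>R (y' - p)"
      by (simp add: eq)
    finally show ?thesis .
  qed
  have "y' \<in> S"
    using y(2) S(2) by (simp add: rel_frontier_def)
  then have "y' - (1 - c' / c) *\<^sub>R (y' - p) \<in> rel_interior S"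
    using c \<open>\<not> c \<le> c'\<close> by (intro rel_interior_convex_shrink S p) (auto simp: field_simps)
  also have "y' - (1 - c' / c) *\<^sub>R (y' - p) = y"
    using yy by (simp add: algebra_simps)
  finally show False
    using y(1) by (simp add: rel_frontier_def)
qed

text \<open>A finite face poset realised by compact convex cells, with a chosen centre in each.
  Indices and order are kept apart from the cells, so that two geometrically different families can
  realise the same poset.\<close>

locale cell_family =
  fixes I :: "'i set" and prec :: "'i \<Rightarrow> 'i \<Rightarrow> bool" (infix "\<lhd>" 50)
    and cell :: "'i \<Rightarrow> 'a::euclidean_space set" and p :: "'i \<Rightarrow> 'a"
  assumes finite_index: "finite I"
    and less_trans: "\<lbrakk>i \<lhd> j; j \<lhd> k\<rbrakk> \<Longrightarrow> i \<lhd> k"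
    and compact_cell: "i \<in> I \<Longrightarrow> compact (cell i)"
    and convex_cell: "i \<in> I \<Longrightarrow> convex (cell i)"
    and center: "i \<in> I \<Longrightarrow> p i \<in> rel_interior (cell i)"
    and disjoint: "\<lbrakk>i \<in> I; j \<in> I; i \<noteq> j\<rbrakk> \<Longrightarrow> rel_interior (cell i) \<inter> rel_interior (cell j) = {}"
    and frontier: "i \<in> I \<Longrightarrow> rel_frontier (cell i) = (\<Union>j\<in>{j\<in>I. j \<lhd> i}. cell j)"
begin

text \<open>Otherwise the frontier condition would put the centre of \<open>cell i\<close> on the
  frontier of \<open>cell i\<close>.\<close>

lemma irrefl: "i \<in> I \<Longrightarrow> \<not> i \<lhd> i"
  using center[of i] frontier[of i] rel_interior_subset[of "cell i"]
  by (auto simp: rel_frontier_def)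

text \<open>Strictly monotone by transitivity and irreflexivity, hence a measure for induction and a
  way to find the top of a chain.\<close>

definition rank :: "'i \<Rightarrow> nat" where
  "rank i = card {j\<in>I. j \<lhd> i}"

lemma rank_less: "\<lbrakk>i \<in> I; i \<lhd> j\<rbrakk> \<Longrightarrow> rank i < rank j"
  unfolding rank_def
proof (rule psubset_card_mono)
  assume "i \<in> I" "i \<lhd> j"
  then show "{k \<in> I. k \<lhd> i} \<subset> {k \<in> I. k \<lhd> j}"
    using irrefl less_trans by blast
qed (simp add: finite_index)

lemma rel_frontier_subset: "i \<in> I \<Longrightarrow> rel_frontier (cell i) \<subseteq> cell i"
  using compact_cell compact_imp_closed by (fastforce simp: rel_frontier_def)

lemma inj_center: "inj_on p I"
  using center disjoint by (fastforce simp: inj_on_def)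

definition chain :: "'i set \<Rightarrow> bool" where
  "chain s \<longleftrightarrow> s \<subseteq> I \<and> (\<forall>i\<in>s. \<forall>j\<in>s. i = j \<or> i \<lhd> j \<or> j \<lhd> i)"

lemma chain_subset: "\<lbrakk>chain s; t \<subseteq> s\<rbrakk> \<Longrightarrow> chain t"
  unfolding chain_def by (meson subsetD subset_trans)

lemma chainD:
  assumes "chain s"
  shows "s \<subseteq> I" "finite s" "inj_on p s"
proof -
  show "s \<subseteq> I"
    using assms by (simp add: chain_def)
  then show "finite s" "inj_on p s"
    using finite_index finite_subset inj_center inj_on_subset by blast+
qed

text \<open>Coordinates in the barycentric subdivision: the support is a chain, so the weights
  vanish off \<open>I\<close>. They are functions of indices, not of points, so that the same
  weights make sense in another family on the same poset.\<close>

definition barycentric :: "'a \<Rightarrow> ('i \<Rightarrow> real) \<Rightarrow> bool" where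
  "barycentric x \<beta> \<longleftrightarrow> (\<forall>i. 0 \<le> \<beta> i) \<and> chain {i. \<beta> i \<noteq> 0} \<and> sum \<beta> I = 1 \<and> (\<Sum>i\<in>I. \<beta> i *\<^sub>R p i) = x"

text \<open>Coning from the centre: the ray from \<open>p i\<close> through \<open>x\<close> leaves
  \<open>cell i\<close> in a smaller cell, where coordinates exist by induction, and
  \<open>x\<close> divides the segment from \<open>p i\<close> to the exit point.\<close>

lemma barycentric_exists:
  assumes "i \<in> I" "x \<in> cell i"
  shows "\<exists>\<beta>. barycentric x \<beta> \<and> (\<forall>j. \<beta> j \<noteq> 0 \<longrightarrow> j = i \<or> j \<lhd> i)"
  using assms
proof (induction "rank i" arbitrary: i x rule: less_induct)
  case less
  show ?case
  proof (cases "x = p i")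
    case True
    let ?\<beta> = "\<lambda>j. if j = i then 1 else 0 :: real"
    have "(\<Sum>j\<in>I. ?\<beta> j *\<^sub>R p j) = (\<Sum>j\<in>I. if j = i then p j else 0)"
      by (intro sum.cong) auto
    then have "barycentric x ?\<beta>"
      using less.prems True finite_index by (auto simp: barycentric_def chain_def)
    then show ?thesis
      by (intro exI[of _ ?\<beta>]) auto
  next
    case False
    have "p i + (x - p i) \<in> affine hull cell i"
      using less.prems hull_subset[of "cell i" affine] by auto
    then obtain d where d: "0 < d" "p i + d *\<^sub>R (x - p i) \<in> rel_frontier (cell i)"
      and ri: "\<And>e. \<lbrakk>0 \<le> e; e < d\<rbrakk> \<Longrightarrow> p i + e *\<^sub>R (x - p i) \<in> rel_interior (cell i)"
      using ray_to_rel_frontier[of "cell i" "p i" "x - p i"] compact_imp_bounded[OF compact_cell]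
        center less.prems(1) False by (metis right_minus_eq)
    \<comment> \<open>If \<open>d < 1\<close>, the frontier point would lie strictly between the
      relatively interior centre and \<open>x\<close>, hence in the relative interior.\<close>
    have "1 \<le> d"
    proof (rule ccontr)
      assume "\<not> 1 \<le> d"
      have "x - (1 - d) *\<^sub>R (x - p i) \<in> rel_interior (cell i)"
        using less.prems d \<open>\<not> 1 \<le> d\<close> center convex_cell by (intro rel_interior_convex_shrink) auto
      also have "x - (1 - d) *\<^sub>R (x - p i) = p i + d *\<^sub>R (x - p i)"
        by (simp add: algebra_simps)
      finally show False
        using d(2) by (simp add: rel_frontier_def)
    qed
    obtain j where j: "j \<in> I" "j \<lhd> i" "p i + d *\<^sub>R (x - p i) \<in> cell j"
      using d(2) frontier less.prems(1) by auto
    obtain \<gamma> where \<gamma>: "barycentric (p i + d *\<^sub>R (x - p i)) \<gamma>" "\<And>k. \<gamma> k \<noteq> 0 \<Longrightarrow> k = j \<or> k \<lhd> j"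
      using less.hyps[OF rank_less] j by blast
    \<comment> \<open>The weight of the exit point in \<open>x\<close>; the remaining
      \<open>1 - 1 / d\<close> goes to \<open>p i\<close>.\<close>
    let ?c = "1 / d"
    let ?\<beta> = "\<lambda>k. ?c * \<gamma> k + (if k = i then 1 - ?c else 0)"
    have c: "0 < ?c" "?c \<le> 1"
      using \<open>1 \<le> d\<close> by auto
    have \<gamma>': "\<gamma> k = 0" if "\<not> k \<lhd> i" for k
      using \<gamma>(2)[of k] j less_trans that by blast
    have "chain {k. \<gamma> k \<noteq> 0}"
      using \<gamma>(1) by (simp add: barycentric_def)
    then have "chain (insert i {k. \<gamma> k \<noteq> 0})"
      using \<gamma>' less.prems(1) unfolding chain_def by blast
    moreover have "{k. ?\<beta> k \<noteq> 0} \<subseteq> insert i {k. \<gamma> k \<noteq> 0}"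
      by auto
    ultimately have "chain {k. ?\<beta> k \<noteq> 0}"
      by (rule chain_subset)
    moreover have "sum ?\<beta> I = 1"
      using \<gamma>(1) less.prems(1) finite_index
      by (simp add: barycentric_def sum.distrib flip: sum_distrib_left sum_divide_distrib)
    moreover have "(\<Sum>k\<in>I. ?\<beta> k *\<^sub>R p k) = x"
    proof -
      have "(\<Sum>k\<in>I. ?\<beta> k *\<^sub>R p k) = (\<Sum>k\<in>I. ?c *\<^sub>R (\<gamma> k *\<^sub>R p k) + (if k = i then (1 - ?c) *\<^sub>R p k else 0))"
        by (intro sum.cong) (auto simp: algebra_simps)
      also have "\<dots> = ?c *\<^sub>R (\<Sum>k\<in>I. \<gamma> k *\<^sub>R p k) + (1 - ?c) *\<^sub>R p i"
        using less.prems(1) finite_index by (simp add: sum.distrib scaleR_sum_right)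
      also have "\<dots> = ?c *\<^sub>R (p i + d *\<^sub>R (x - p i)) + (1 - ?c) *\<^sub>R p i"
        using \<gamma>(1) by (simp add: barycentric_def)
      also have "\<dots> = x"
        using \<open>0 < d\<close> by (simp add: algebra_simps)
      finally show ?thesis .
    qed
    moreover have "0 \<le> ?\<beta> k" for k
      using \<gamma>(1) c by (auto simp: barycentric_def)
    ultimately have "barycentric x ?\<beta>"
      by (simp add: barycentric_def)
    moreover have "k = i \<or> k \<lhd> i" if "?\<beta> k \<noteq> 0" for k
      using that \<gamma>'[of k] by (auto split: if_splits)
    ultimately show ?thesis
      by blast
  qed
qed

lemma barycentric_notin: "barycentric x \<beta> \<Longrightarrow> i \<notin> I \<Longrightarrow> \<beta> i = 0"
  using chainD(1)[of "{i. \<beta> i \<noteq> 0}"] by (auto simp: barycentric_def)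

lemma barycentric_support_finite: "barycentric x \<beta> \<Longrightarrow> finite {i. \<beta> i \<noteq> 0}"
  by (simp add: barycentric_def chainD(2))

text \<open>Removes the vertex \<open>i\<close> and renormalises. If \<open>i\<close> is the top of
  the support, these are the coordinates of the frontier point opposite \<open>p i\<close>. The
  quotient is meant for \<open>\<beta> i \<noteq> 1\<close>.\<close>

definition remainder :: "('i \<Rightarrow> real) \<Rightarrow> 'i \<Rightarrow> 'i \<Rightarrow> real" where
  "remainder \<beta> i = (\<lambda>j. if j = i then 0 else \<beta> j / (1 - \<beta> i))"

lemma barycentric_remainder:
  assumes \<beta>: "barycentric x \<beta>" and i: "i \<in> I" "\<beta> i \<noteq> 0" "\<beta> i \<noteq> 1"
  shows "\<beta> i < 1" "\<exists>y. barycentric y (remainder \<beta> i) \<and> x = \<beta> i *\<^sub>R p i + (1 - \<beta> i) *\<^sub>R y"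
    and "card {j. remainder \<beta> i j \<noteq> 0} < card {j. \<beta> j \<noteq> 0}"
proof -
  have pos: "\<And>j. 0 \<le> \<beta> j" and sum: "sum \<beta> I = 1" and x: "(\<Sum>j\<in>I. \<beta> j *\<^sub>R p j) = x"
    and ch: "chain {j. \<beta> j \<noteq> 0}"
    using \<beta> by (auto simp: barycentric_def)
  have sum': "\<beta> i + sum \<beta> (I - {i}) = 1"
    using sum i(1) finite_index by (simp add: sum.remove)
  then show lt: "\<beta> i < 1"
    using i(3) sum_nonneg[of "I - {i}" \<beta>] pos by fastforce
  have sub: "{j. remainder \<beta> i j \<noteq> 0} \<subset> {j. \<beta> j \<noteq> 0}"
    using i by (auto simp: remainder_def)
  then show "card {j. remainder \<beta> i j \<noteq> 0} < card {j. \<beta> j \<noteq> 0}"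
    using barycentric_support_finite[OF \<beta>] by (rule psubset_card_mono[rotated])
  define y where "y = (\<Sum>j\<in>I. remainder \<beta> i j *\<^sub>R p j)"
  have "sum (remainder \<beta> i) I = sum \<beta> (I - {i}) / (1 - \<beta> i)"
    using i(1) finite_index by (simp add: sum.remove remainder_def sum_divide_distrib)
  then have "sum (remainder \<beta> i) I = 1"
    using sum' lt by (metis add_diff_cancel_left' diff_gt_0_iff_gt divide_self less_numeral_extra(3))
  moreover have "chain {j. remainder \<beta> i j \<noteq> 0}"
    using ch sub by (blast intro: chain_subset)
  moreover have "0 \<le> remainder \<beta> i j" for j
    using pos lt by (simp add: remainder_def)
  ultimately have "barycentric y (remainder \<beta> i)"
    by (simp add: barycentric_def y_def)
  moreover have "x = \<beta> i *\<^sub>R p i + (1 - \<beta> i) *\<^sub>R y"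
  proof -
    have "(1 - \<beta> i) *\<^sub>R y = (\<Sum>j\<in>I - {i}. \<beta> j *\<^sub>R p j)"
      unfolding y_def using i(1) finite_index lt by (simp add: sum.remove remainder_def scaleR_sum_right)
    then show ?thesis
      using x i(1) finite_index by (simp add: sum.remove)
  qed
  ultimately show "\<exists>y. barycentric y (remainder \<beta> i) \<and> x = \<beta> i *\<^sub>R p i + (1 - \<beta> i) *\<^sub>R y"
    by blast
qed

lemma barycentric_one:
  assumes "barycentric x \<beta>" "\<beta> i = 1"
  shows "x = p i" "\<beta> = (\<lambda>j. if j = i then 1 else 0)"
proof -
  have i: "i \<in> I"
    using barycentric_notin[OF assms(1)] assms(2) by fastforce
  have "sum \<beta> (I - {i}) = 0"
    using assms i finite_index by (simp add: barycentric_def sum.remove)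
  then have "\<beta> j = 0" if "j \<in> I - {i}" for j
    using that assms(1) finite_index sum_nonneg_eq_0_iff[of "I - {i}" \<beta>] by (simp add: barycentric_def)
  then show \<beta>: "\<beta> = (\<lambda>j. if j = i then 1 else 0)"
    using assms barycentric_notin[OF assms(1)] by (intro ext) auto
  have "x = (\<Sum>j\<in>I. if j = i then p j else 0)"
  proof -
    have "x = (\<Sum>j\<in>I. \<beta> j *\<^sub>R p j)"
      using assms(1) by (simp add: barycentric_def)
    also have "\<dots> = (\<Sum>j\<in>I. if j = i then p j else 0)"
      by (intro sum.cong) (auto simp: \<beta>)
    finally show ?thesis .
  qed
  then show "x = p i"
    using i finite_index by simp
qed

text \<open>By induction, the point left after deleting the top vertex lies in a smaller cell, thus
  on the frontier of \<open>cell i\<close>; a positive weight on \<open>p i\<close> moves it into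
  the relative interior. So the support determines the open cell containing
  \<open>x\<close>.\<close>

lemma barycentric_top:
  assumes "barycentric x \<beta>"
  shows "\<exists>i\<in>I. \<beta> i \<noteq> 0 \<and> (\<forall>j. \<beta> j \<noteq> 0 \<longrightarrow> j = i \<or> j \<lhd> i) \<and> x \<in> rel_interior (cell i)"
  using assms
proof (induction "card {j. \<beta> j \<noteq> 0}" arbitrary: x \<beta> rule: less_induct)
  case less
  let ?s = "{j. \<beta> j \<noteq> 0}"
  have fin: "finite ?s"
    using less.prems by (rule barycentric_support_finite)
  have "?s \<noteq> {}"
  proof
    assume "?s = {}"
    then have "sum \<beta> I = 0"
      by (intro sum.neutral) auto
    then show False
      using less.prems by (simp add: barycentric_def)
  qed
  \<comment> \<open>Ranks increase strictly along the order, so maximal rank in a chain means top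
    element.\<close>
  then obtain i where i: "i \<in> ?s" "\<And>j. j \<in> ?s \<Longrightarrow> rank j \<le> rank i"
    using fin obtains_MAX[of ?s rank] by (metis Max_ge finite_imageI image_eqI)
  have iI: "i \<in> I"
    using i(1) less.prems by (auto simp: barycentric_def chain_def)
  have top: "j = i \<or> j \<lhd> i" if "\<beta> j \<noteq> 0" for j
  proof -
    have "j = i \<or> j \<lhd> i \<or> i \<lhd> j"
      using i(1) that less.prems by (auto simp: barycentric_def chain_def)
    then show ?thesis
      using rank_less[OF iI, of j] i(2)[of j] that by auto
  qed
  have "x \<in> rel_interior (cell i)"
  proof (cases "\<beta> i = 1")
    case True
    then show ?thesis
      using barycentric_one[OF less.prems] center iI by simp
  next
    case False
    have nz: "\<beta> i \<noteq> 0" using i(1) by simp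
    obtain y where y: "barycentric y (remainder \<beta> i)" "x = \<beta> i *\<^sub>R p i + (1 - \<beta> i) *\<^sub>R y"
      using barycentric_remainder(2)[OF less.prems iI nz False] by blast
    obtain j where j: "j \<in> I" "remainder \<beta> i j \<noteq> 0" "y \<in> rel_interior (cell j)"
      using less.hyps[OF barycentric_remainder(3)[OF less.prems iI nz False] y(1)] by blast
    have "j \<lhd> i"
      using j(2) top[of j] by (auto simp: remainder_def split: if_splits)
    then have "y \<in> cell i"
      using j rel_interior_subset frontier[OF iI] rel_frontier_subset[OF iI] by blast
    then have "y - \<beta> i *\<^sub>R (y - p i) \<in> rel_interior (cell i)"
      using barycentric_remainder(1)[OF less.prems iI nz False] nz less.prems center convex_cell iI
      by (intro rel_interior_convex_shrink) (auto simp: barycentric_def order_less_le)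
    also have "y - \<beta> i *\<^sub>R (y - p i) = x"
      by (simp add: y(2) algebra_simps)
    finally show ?thesis .
  qed
  then show ?case
    using iI i(1) top by blast
qed

lemma barycentric_remainder_frontier:
  assumes "barycentric x \<beta>" "i \<in> I" "\<And>j. \<beta> j \<noteq> 0 \<Longrightarrow> j = i \<or> j \<lhd> i"
    and "barycentric y (remainder \<beta> i)"
  shows "y \<in> rel_frontier (cell i)"
proof -
  obtain j where j: "j \<in> I" "remainder \<beta> i j \<noteq> 0" "y \<in> rel_interior (cell j)"
    using barycentric_top[OF assms(4)] by blast
  then have "j \<lhd> i"
    using assms(3)[of j] by (auto simp: remainder_def split: if_splits)
  then show ?thesis
    using j frontier[OF assms(2)] rel_interior_subset by blast
qed

text \<open>Both supports have the same top \<open>i\<close> because relative interiors are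
  disjoint. The two remainders represent frontier points on one ray from \<open>p i\<close>, hence
  the same point with the same weight, to which induction applies.\<close>

lemma barycentric_unique:
  assumes "barycentric x \<beta>" "barycentric x \<gamma>"
  shows "\<beta> = \<gamma>"
  using assms
proof (induction "card {j. \<beta> j \<noteq> 0}" arbitrary: x \<beta> \<gamma> rule: less_induct)
  case less
  note \<beta> = less.prems(1) and \<gamma> = less.prems(2)
  obtain i where i: "i \<in> I" "\<beta> i \<noteq> 0" "\<And>j. \<beta> j \<noteq> 0 \<Longrightarrow> j = i \<or> j \<lhd> i" "x \<in> rel_interior (cell i)"
    using barycentric_top[OF \<beta>] by blast
  obtain i' where i': "i' \<in> I" "\<gamma> i' \<noteq> 0" "\<And>j. \<gamma> j \<noteq> 0 \<Longrightarrow> j = i' \<or> j \<lhd> i'" "x \<in> rel_interior (cell i')"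
    using barycentric_top[OF \<gamma>] by blast
  have "i' = i"
    using i i' disjoint by blast
  note i' = i'[unfolded this]
  \<comment> \<open>A top weight strictly between 0 and 1 would, for \<open>x = p i\<close>, put the
    centre on the frontier. So weight 1 in one set of coordinates forces it in the other.\<close>
  have *: "p i \<noteq> x" if d: "barycentric x \<delta>" "\<delta> i \<noteq> 0" "\<delta> i \<noteq> 1" "\<And>j. \<delta> j \<noteq> 0 \<Longrightarrow> j = i \<or> j \<lhd> i" for \<delta>
  proof
    assume px: "p i = x"
    obtain y where y: "barycentric y (remainder \<delta> i)" "x = \<delta> i *\<^sub>R p i + (1 - \<delta> i) *\<^sub>R y"
      using barycentric_remainder(2)[OF d(1) i(1) d(2,3)] by blast
    have "(1 - \<delta> i) *\<^sub>R (y - p i) = (\<delta> i *\<^sub>R p i + (1 - \<delta> i) *\<^sub>R y) - p i"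
      by (simp add: algebra_simps)
    also have "\<dots> = 0"
      using y(2) px by simp
    finally have "(1 - \<delta> i) *\<^sub>R (y - p i) = 0" .
    then have "y = p i"
      using d(3) by (metis diff_eq_diff_eq diff_self right_minus_eq scaleR_eq_0_iff)
    then show False
      using barycentric_remainder_frontier[OF d(1) i(1) d(4) y(1)] center[OF i(1)]
      by (simp add: rel_frontier_def)
  qed
  show ?case
  proof (cases "\<beta> i = 1 \<or> \<gamma> i = 1")
    case True
    then have "x = p i"
      using barycentric_one \<beta> \<gamma> by blast
    then have "\<beta> i = 1" "\<gamma> i = 1"
      using * \<beta> \<gamma> i i' by blast+
    then show ?thesis
      using barycentric_one(2) \<beta> \<gamma> by blast
  next
    case False
    then have ne: "\<beta> i \<noteq> 1" "\<gamma> i \<noteq> 1" by auto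
    obtain y where y: "barycentric y (remainder \<beta> i)" "x = \<beta> i *\<^sub>R p i + (1 - \<beta> i) *\<^sub>R y"
      using barycentric_remainder(2)[OF \<beta> i(1,2) ne(1)] by blast
    obtain z where z: "barycentric z (remainder \<gamma> i)" "x = \<gamma> i *\<^sub>R p i + (1 - \<gamma> i) *\<^sub>R z"
      using barycentric_remainder(2)[OF \<gamma> i(1) i'(2) ne(2)] by blast
    have lt: "\<beta> i < 1" "\<gamma> i < 1"
      using barycentric_remainder(1) \<beta> \<gamma> i i' ne by blast+
    have fr: "y \<in> rel_frontier (cell i)" "z \<in> rel_frontier (cell i)"
      using barycentric_remainder_frontier \<beta> \<gamma> i i' y z by blast+
    have eq: "(1 - \<beta> i) *\<^sub>R (y - p i) = (1 - \<gamma> i) *\<^sub>R (z - p i)"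
      using y(2) z(2) by (simp add: algebra_simps)
    have cell: "convex (cell i)" "closed (cell i)"
      using convex_cell compact_cell compact_imp_closed i(1) by auto
    have "1 - \<beta> i \<le> 1 - \<gamma> i" "1 - \<gamma> i \<le> 1 - \<beta> i"
      using rel_frontier_ray_le[OF cell center[OF i(1)] fr _ _ eq]
        rel_frontier_ray_le[OF cell center[OF i(1)] fr(2,1) _ _ eq[symmetric]] lt by auto
    then have same: "\<beta> i = \<gamma> i"
      by simp
    then have "y = z"
      using eq lt by simp
    then have "remainder \<beta> i = remainder \<gamma> i"
      using less.hyps[OF barycentric_remainder(3)[OF \<beta> i(1,2) ne(1)] y(1)] z(1) by simp
    then have "remainder \<beta> i j = remainder \<gamma> i j" for j
      by simp
    then have "\<beta> j = \<gamma> j" if "j \<noteq> i" for j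
      using same lt that unfolding remainder_def by (metis diff_gt_0_iff_gt divide_cancel_right less_irrefl)
    then have "\<beta> j = \<gamma> j" for j
      using same by (cases "j = i") auto
    then show ?thesis
      by blast
  qed
qed

section \<open>Simplices of the barycentric subdivision and simplicial maps\<close>

lemma barycentric_simplex:
  assumes "chain s" "x \<in> convex hull (p ` s)"
  shows "\<exists>\<beta>. barycentric x \<beta> \<and> {i. \<beta> i \<noteq> 0} \<subseteq> s"
proof -
  have s: "s \<subseteq> I" "finite s" "inj_on p s"
    using chainD[OF assms(1)] .
  obtain u where u: "\<And>y. y \<in> p ` s \<Longrightarrow> 0 \<le> u y" "sum u (p ` s) = 1" "(\<Sum>y\<in>p ` s. u y *\<^sub>R y) = x"
    using assms(2) s(2) by (auto simp: convex_hull_finite)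
  let ?\<beta> = "\<lambda>i. if i \<in> s then u (p i) else 0"
  have "sum ?\<beta> I = 1"
    using u(2) s finite_index by (simp add: sum.reindex sum.If_cases Int_absorb1)
  moreover have "(\<Sum>i\<in>I. ?\<beta> i *\<^sub>R p i) = (\<Sum>i\<in>s. u (p i) *\<^sub>R p i)"
    using s finite_index by (intro sum.mono_neutral_cong_right) auto
  then have "(\<Sum>i\<in>I. ?\<beta> i *\<^sub>R p i) = x"
    using u(3) s by (simp add: sum.reindex)
  moreover have "{i. ?\<beta> i \<noteq> 0} \<subseteq> s"
    by auto
  moreover have "chain {i. ?\<beta> i \<noteq> 0}"
    using assms(1) by (rule chain_subset) auto
  ultimately show ?thesis
    using u(1) by (intro exI[of _ ?\<beta>]) (auto simp: barycentric_def)
qed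

lemma barycentric_in_simplex:
  assumes "barycentric x \<beta>"
  shows "x \<in> convex hull (p ` {i. \<beta> i \<noteq> 0})"
proof -
  let ?s = "{i. \<beta> i \<noteq> 0}"
  have s: "?s \<subseteq> I"
    using assms by (auto simp: barycentric_def chain_def)
  have "(\<Sum>i\<in>?s. \<beta> i *\<^sub>R p i) \<in> convex hull (p ` ?s)"
  proof (rule convex_sum)
    show "finite ?s" using barycentric_support_finite[OF assms] .
    show "sum \<beta> ?s = 1"
      using assms s finite_index by (subst sum.mono_neutral_left[of I]) (auto simp: barycentric_def)
  qed (use assms in \<open>auto simp: barycentric_def intro: hull_inc\<close>)
  also have "(\<Sum>i\<in>?s. \<beta> i *\<^sub>R p i) = (\<Sum>i\<in>I. \<beta> i *\<^sub>R p i)"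
    using s finite_index by (intro sum.mono_neutral_left) auto
  finally show ?thesis
    using assms by (simp add: barycentric_def)
qed

lemma ex_barycentric_iff: "(\<exists>\<beta>. barycentric x \<beta>) \<longleftrightarrow> x \<in> (\<Union>i\<in>I. cell i)"
proof
  assume "\<exists>\<beta>. barycentric x \<beta>"
  then obtain i where "i \<in> I" "x \<in> rel_interior (cell i)"
    using barycentric_top by blast
  then show "x \<in> (\<Union>i\<in>I. cell i)"
    using rel_interior_subset by blast
next
  assume "x \<in> (\<Union>i\<in>I. cell i)"
  then show "\<exists>\<beta>. barycentric x \<beta>"
    using barycentric_exists by blast
qed

lemma Union_simplices: "(\<Union>s\<in>Collect chain. convex hull (p ` s)) = (\<Union>i\<in>I. cell i)"
proof (intro subset_antisym subsetI)
  fix x assume "x \<in> (\<Union>s\<in>Collect chain. convex hull (p ` s))"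
  then obtain \<beta> where "barycentric x \<beta>"
    using barycentric_simplex by blast
  then show "x \<in> (\<Union>i\<in>I. cell i)"
    using ex_barycentric_iff by blast
next
  fix x assume "x \<in> (\<Union>i\<in>I. cell i)"
  then obtain \<beta> where \<beta>: "barycentric x \<beta>"
    using barycentric_exists by blast
  then have "chain {i. \<beta> i \<noteq> 0}"
    by (simp add: barycentric_def)
  then show "x \<in> (\<Union>s\<in>Collect chain. convex hull (p ` s))"
    using barycentric_in_simplex[OF \<beta>] by blast
qed

lemma finite_chains: "finite (Collect chain)"
  by (rule finite_subset[of _ "Pow I"]) (auto simp: chain_def finite_index)

text \<open>The positive and the negative part of an affine dependence, normalised, would be two
  different sets of barycentric coordinates for one point; so independence comes out of
  uniqueness.\<close>

lemma affine_independent_chain: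
  assumes "chain s"
  shows "\<not> affine_dependent (p ` s)"
proof
  have s: "s \<subseteq> I" "finite s" "inj_on p s"
    using chainD[OF assms] .
  assume "affine_dependent (p ` s)"
  then obtain U where U: "sum U (p ` s) = 0" "\<exists>v\<in>p ` s. U v \<noteq> 0" "(\<Sum>v\<in>p ` s. U v *\<^sub>R v) = 0"
    using affine_dependent_explicit_finite[of "p ` s"] s(2) by blast
  define c where "c i = (if i \<in> s then U (p i) else 0)" for i
  have c0: "sum c I = 0"
    using U(1) s finite_index by (simp add: c_def sum.reindex sum.If_cases Int_absorb1)
  have c1: "(\<Sum>i\<in>I. c i *\<^sub>R p i) = 0"
  proof -
    have "(\<Sum>i\<in>I. c i *\<^sub>R p i) = (\<Sum>i\<in>s. U (p i) *\<^sub>R p i)"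
      using s finite_index by (intro sum.mono_neutral_cong_right) (auto simp: c_def)
    then show ?thesis
      using U(3) s by (simp add: sum.reindex)
  qed
  \<comment> \<open>As \<open>c\<close> sums to 0, its positive and negative parts have the same
    mass, and one factor normalises both.\<close>
  define N where "N = (\<Sum>i\<in>I. max 0 (c i))"
  have N': "N = (\<Sum>i\<in>I. max 0 (- c i))"
  proof -
    have "N - (\<Sum>i\<in>I. max 0 (- c i)) = sum c I"
      unfolding N_def by (simp flip: sum_subtractf) (intro sum.cong; auto simp: max_def)
    then show ?thesis
      using c0 by simp
  qed
  obtain k where k: "k \<in> s" "c k \<noteq> 0"
    using U(2) by (auto simp: c_def)
  have "0 < N"
  proof (rule ccontr)
    assume "\<not> 0 < N"
    then have "N = 0"
      unfolding N_def by (simp add: order_antisym sum_nonneg)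
    then have "max 0 (c k) = 0" "max 0 (- c k) = 0"
      using N' N_def k(1) s(1) finite_index sum_nonneg_eq_0_iff[of I "\<lambda>i. max 0 (c i)"]
        sum_nonneg_eq_0_iff[of I "\<lambda>i. max 0 (- c i)"] by auto
    then show False
      using k(2) by linarith
  qed
  have *: "barycentric ((1 / N) *\<^sub>R (\<Sum>i\<in>I. max 0 (d i) *\<^sub>R p i)) (\<lambda>i. max 0 (d i) / N)"
    if "\<And>i. i \<notin> s \<Longrightarrow> d i = 0" "(\<Sum>i\<in>I. max 0 (d i)) = N" for d
  proof -
    have "i \<in> s" if "max 0 (d i) / N \<noteq> 0" for i
      using that \<open>\<And>i. i \<notin> s \<Longrightarrow> d i = 0\<close>[of i] by (cases "i \<in> s") auto
    then have "chain {i. max 0 (d i) / N \<noteq> 0}"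
      by (intro chain_subset[OF assms] subsetI) simp
    then show ?thesis
      unfolding barycentric_def using \<open>0 < N\<close> that
      by (simp add: scaleR_sum_right flip: sum_divide_distrib)
  qed
  have "(\<Sum>i\<in>I. max 0 (c i) *\<^sub>R p i) - (\<Sum>i\<in>I. max 0 (- c i) *\<^sub>R p i) = (\<Sum>i\<in>I. c i *\<^sub>R p i)"
    by (simp flip: sum_subtractf scaleR_diff_left) (intro sum.cong; auto simp: max_def)
  then have same: "(\<Sum>i\<in>I. max 0 (- c i) *\<^sub>R p i) = (\<Sum>i\<in>I. max 0 (c i) *\<^sub>R p i)"
    using c1 by simp
  have "(\<lambda>i. max 0 (c i) / N) = (\<lambda>i. max 0 (- c i) / N)"
    using *[of c] *[of "\<lambda>i. - c i"] unfolding same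
    by (intro barycentric_unique) (auto simp: c_def N_def N'[symmetric, unfolded c_def])
  then have "max 0 (c k) / N = max 0 (- c k) / N"
    by meson
  then show False
    using k(2) \<open>0 < N\<close> by (auto simp: max_def split: if_splits)
qed

text \<open>With one centre as origin, affine independence turns the others into linearly
  independent vectors, whose images can be prescribed.\<close>

lemma affine_extension_chain:
  fixes q :: "'i \<Rightarrow> 'b::euclidean_space"
  assumes "chain s"
  obtains g c where "linear g" "\<And>i. i \<in> s \<Longrightarrow> q i = g (p i) + c"
proof (cases "s = {}")
  case True
  then show ?thesis
    by (intro that[of "\<lambda>_. 0" 0]) (auto simp: linear_iff)
next
  case False
  then obtain i0 where i0: "i0 \<in> s"
    by blast
  have inj: "inj_on p s"
    using chainD(3)[OF assms] .
  let ?s = "s - {i0}"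
  have "p ` s = insert (p i0) (p ` ?s)" "p i0 \<notin> p ` ?s"
    using i0 inj by (auto simp: inj_on_def)
  then have "\<not> dependent ((\<lambda>x. - p i0 + x) ` p ` ?s)"
    using affine_independent_chain[OF assms] affine_dependent_iff_dependent by metis
  then obtain g where g: "linear g"
    "\<And>v. v \<in> (\<lambda>x. - p i0 + x) ` p ` ?s \<Longrightarrow> g v = q (inv_into s p (v + p i0)) - q i0"
    using linear_independent_extend[of _ "\<lambda>v. q (inv_into s p (v + p i0)) - q i0"] by blast
  have "q i = g (p i) + (q i0 - g (p i0))" if i: "i \<in> s" for i
  proof (cases "i = i0")
    case False
    then have "g (- p i0 + p i) = q (inv_into s p (p i)) - q i0"
      using g(2)[of "- p i0 + p i"] i by auto
    then show ?thesis
      using i inj linear_diff[OF g(1), of "p i" "p i0"] by (simp add: algebra_simps)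
  qed simp
  then show ?thesis
    using that g(1) by blast
qed

text \<open>The simplicial map sending each \<open>p i\<close> to \<open>q i\<close>. Going through
  coordinates avoids the choice of a simplex, so agreement on common faces is built in.\<close>

definition transfer :: "('i \<Rightarrow> 'b::euclidean_space) \<Rightarrow> 'a \<Rightarrow> 'b" where
  "transfer q x = (\<Sum>i\<in>I. (THE \<beta>. barycentric x \<beta>) i *\<^sub>R q i)"

lemma transfer_eq: "barycentric x \<beta> \<Longrightarrow> transfer q x = (\<Sum>i\<in>I. \<beta> i *\<^sub>R q i)"
  unfolding transfer_def using barycentric_unique by (metis the_equality)

lemma transfer_affine_on_simplex:
  fixes q :: "'i \<Rightarrow> 'b::euclidean_space"
  assumes "chain s"
  shows "\<exists>g c. linear g \<and> (\<forall>x\<in>convex hull (p ` s). transfer q x = g x + c)"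
proof -
  obtain g c where g: "linear g" "\<And>i. i \<in> s \<Longrightarrow> q i = g (p i) + c"
    using affine_extension_chain[OF assms] by blast
  have "transfer q x = g x + c" if x: "x \<in> convex hull (p ` s)" for x
  proof -
    obtain \<beta> where \<beta>: "barycentric x \<beta>" "{i. \<beta> i \<noteq> 0} \<subseteq> s"
      using barycentric_simplex[OF assms x] by blast
    have "transfer q x = (\<Sum>i\<in>I. \<beta> i *\<^sub>R q i)"
      using transfer_eq[OF \<beta>(1)] .
    also have "\<dots> = (\<Sum>i\<in>I. \<beta> i *\<^sub>R g (p i) + \<beta> i *\<^sub>R c)"
      using \<beta>(2) g(2) by (intro sum.cong refl) (auto simp flip: scaleR_add_right)
    also have "\<dots> = g (\<Sum>i\<in>I. \<beta> i *\<^sub>R p i) + sum \<beta> I *\<^sub>R c"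
      using g(1) by (simp add: sum.distrib linear_sum linear_scale scaleR_sum_left)
    also have "\<dots> = g x + c"
      using \<beta>(1) by (simp add: barycentric_def)
    finally show ?thesis .
  qed
  then show ?thesis
    using g(1) by blast
qed

lemma pl_map_transfer:
  fixes q :: "'i \<Rightarrow> 'b::euclidean_space"
  shows "pl_map (\<Union>i\<in>I. cell i) (transfer q)"
  unfolding pl_map_def
proof (rule exI[of _ "(\<lambda>s. convex hull (p ` s)) ` Collect chain"], intro conjI ballI)
  let ?\<P> = "(\<lambda>s. convex hull (p ` s)) ` Collect chain"
  show "finite ?\<P>"
    using finite_chains by blast
  show "\<Union>?\<P> = (\<Union>i\<in>I. cell i)"
    using Union_simplices by simp
  fix P assume "P \<in> ?\<P>"
  then obtain s where s: "chain s" "P = convex hull (p ` s)"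
    by blast
  then show "polyhedron P"
    using chainD(2) polyhedron_convex_hull by blast
  show "\<exists>g c. linear g \<and> (\<forall>x\<in>P. transfer q x = g x + c)"
    using transfer_affine_on_simplex s by blast
qed

end

lemma pl_map_continuous_on:
  assumes "pl_map S f"
  shows "continuous_on S f"
proof -
  obtain \<P> where \<P>: "finite \<P>" "\<Union>\<P> = S" "\<And>P. P \<in> \<P> \<Longrightarrow> polyhedron P"
    "\<And>P. P \<in> \<P> \<Longrightarrow> \<exists>g c. linear g \<and> (\<forall>x\<in>P. f x = g x + c)"
    using assms unfolding pl_map_def by blast
  have "continuous_on P f" if P: "P \<in> \<P>" for P
  proof -
    obtain g c where g: "linear g" "\<And>x. x \<in> P \<Longrightarrow> f x = g x + c"
      using \<P>(4)[OF P] by blast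
    have "continuous_on P (\<lambda>x. g x + c)"
      using g(1) by (intro continuous_intros linear_continuous_on linear_conv_bounded_linear[THEN iffD1])
    then show ?thesis
      using g(2) by (simp cong: continuous_on_cong)
  qed
  then have "continuous_on (\<Union>\<P>) f"
    using \<P>(1,3) polyhedron_imp_closed by (intro continuous_on_closed_Union[of \<P> id, simplified]) auto
  then show ?thesis
    using \<P>(2) by simp
qed

text \<open>Barycentric coordinates refer to the geometry only through the centres; chains depend on
  the index set and the order alone. So the same weights are coordinates of a point and of its
  image, and the two transfers are mutually inverse.\<close>

proposition cell_family_pl_homeomorphism:
  fixes prec :: "'i \<Rightarrow> 'i \<Rightarrow> bool"
  assumes S: "cell_family I prec S p" and T: "cell_family I prec T q"
  shows "pl_homeomorphism (\<Union>i\<in>I. S i) (\<Union>i\<in>I. T i) (cell_family.transfer I prec p q)"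
proof -
  interpret S: cell_family I prec S p by (rule S)
  interpret T: cell_family I prec T q by (rule T)
  have ST: "T.barycentric (S.transfer q x) \<beta>" if "S.barycentric x \<beta>" for x \<beta>
    using S.transfer_eq[OF that, of q] that by (simp add: S.barycentric_def T.barycentric_def)
  have TS: "S.barycentric (T.transfer p y) \<beta>" if "T.barycentric y \<beta>" for y \<beta>
    using T.transfer_eq[OF that, of p] that by (simp add: S.barycentric_def T.barycentric_def)
  have inv1: "T.transfer p (S.transfer q x) = x" if "S.barycentric x \<beta>" for x \<beta>
    using T.transfer_eq[OF ST[OF that], of p] that by (simp add: S.barycentric_def)
  have inv2: "S.transfer q (T.transfer p x) = x" if "T.barycentric x \<beta>" for x \<beta>
    using S.transfer_eq[OF TS[OF that], of q] that by (simp add: T.barycentric_def)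
  have "homeomorphism (\<Union>i\<in>I. S i) (\<Union>i\<in>I. T i) (S.transfer q) (T.transfer p)"
  proof (rule homeomorphismI)
    show "continuous_on (\<Union>i\<in>I. S i) (S.transfer q)" "continuous_on (\<Union>i\<in>I. T i) (T.transfer p)"
      by (intro pl_map_continuous_on S.pl_map_transfer T.pl_map_transfer)+
    show "S.transfer q ` (\<Union>i\<in>I. S i) \<subseteq> (\<Union>i\<in>I. T i)"
      using ST S.ex_barycentric_iff T.ex_barycentric_iff by (metis image_subsetI)
    show "T.transfer p ` (\<Union>i\<in>I. T i) \<subseteq> (\<Union>i\<in>I. S i)"
      using TS S.ex_barycentric_iff T.ex_barycentric_iff by (metis image_subsetI)
    show "T.transfer p (S.transfer q x) = x" if "x \<in> (\<Union>i\<in>I. S i)" for x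
      using inv1 S.ex_barycentric_iff that by metis
    show "S.transfer q (T.transfer p x) = x" if "x \<in> (\<Union>i\<in>I. T i)" for x
      using inv2 T.ex_barycentric_iff that by metis
  qed
  then show ?thesis
    unfolding pl_homeomorphism_def using S.pl_map_transfer T.pl_map_transfer by blast
qed

section \<open>Levels of a transversal cell\<close>

text \<open>Unless \<open>u\<close> is constant, every point can be pushed against a direction of
  increase until it reaches a proper face, without raising \<open>u\<close>. So the minimum is the
  least of finitely many minima over proper faces, which exist by induction on the
  dimension.\<close>

lemma polyhedron_attains_min:
  fixes P :: "'a::euclidean_space set"
  assumes "polyhedron P" "P \<noteq> {}" "\<And>x. x \<in> P \<Longrightarrow> B \<le> u \<bullet> x"
  shows "\<exists>m\<in>P. \<forall>x\<in>P. u \<bullet> m \<le> u \<bullet> x"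
  using assms
proof (induction "nat (aff_dim P + 1)" arbitrary: P rule: less_induct)
  case less
  note poly = less.prems(1)
  have cvx: "convex P" "closed P"
    using poly polyhedron_imp_convex polyhedron_imp_closed by auto
  show ?case
  proof (cases "\<forall>x\<in>P. \<forall>y\<in>P. u \<bullet> x = u \<bullet> y")
    case True
    then show ?thesis
      using less.prems(2) by (metis ex_in_conv order_refl)
  next
    case False
    then obtain y z where yz: "y \<in> P" "z \<in> P" "u \<bullet> z < u \<bullet> y"
      by (metis linorder_less_linear)
    define w where "w = y - z"
    have uw: "0 < u \<bullet> w"
      using yz by (simp add: w_def inner_diff_right)
    have nrec: "- w \<notin> recession P"
    proof
      assume "- w \<in> recession P"
      \<comment> \<open>This parameter takes \<open>u\<close> from its value at \<open>y\<close>
        down to \<open>B - 1\<close>.\<close>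
      let ?t = "(u \<bullet> y - B + 1) / (u \<bullet> w)"
      have "0 \<le> ?t"
        using uw less.prems(3)[OF yz(1)] by simp
      then have "y + ?t *\<^sub>R (- w) \<in> P"
        using recessionD[OF \<open>- w \<in> recession P\<close> yz(1)] by blast
      then have "B \<le> u \<bullet> (y + ?t *\<^sub>R (- w))"
        by (rule less.prems(3))
      also have "u \<bullet> (y + ?t *\<^sub>R (- w)) = u \<bullet> y - ?t * (u \<bullet> w)"
        by (simp add: inner_diff_right)
      also have "\<dots> = B - 1"
        using uw by simp
      finally show False
        by simp
    qed
    obtain s where s: "\<And>x t. x \<in> P \<Longrightarrow> 0 \<le> t \<Longrightarrow> x - t *\<^sub>R w \<in> P \<longleftrightarrow> t \<le> s x"
      using polyhedron_exit_time[OF poly nrec] by metis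
    define \<T> where "\<T> = {T. T face_of P \<and> T \<noteq> P \<and> T \<noteq> {}}"
    have descend: "\<exists>T\<in>\<T>. \<exists>x'\<in>T. u \<bullet> x' \<le> u \<bullet> x" if x: "x \<in> P" for x
    proof -
      have sx: "0 \<le> s x"
        using s[OF x, of 0] x by simp
      define x' where "x' = x - s x *\<^sub>R w"
      have x': "x' \<in> P"
        using s[OF x sx] by (simp add: x'_def)
      have "x' \<notin> rel_interior P"
      proof
        assume ri: "x' \<in> rel_interior P"
        have "x' + 1 *\<^sub>R (y - z) \<in> affine hull P"
          using x' yz by (intro mem_affine_3_minus) (auto intro: hull_inc)
        then obtain e where e: "e > 1" "(1 - e) *\<^sub>R (x' + 1 *\<^sub>R (y - z)) + e *\<^sub>R x' \<in> P"
          using convex_rel_interior_if[OF cvx(1) ri] by (metis order_refl)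
        have "(1 - e) *\<^sub>R (x' + 1 *\<^sub>R (y - z)) + e *\<^sub>R x' = x - (s x + (e - 1)) *\<^sub>R w"
          by (simp add: x'_def w_def algebra_simps)
        then have "s x + (e - 1) \<le> s x"
          using s[OF x, of "s x + (e - 1)"] e sx by simp
        then show False
          using e(1) by simp
      qed
      then have "x' \<in> rel_frontier P"
        using x' closure_subset by (auto simp: rel_frontier_def)
      then obtain T where T: "T face_of P" "T \<noteq> P" "x' \<in> T"
        using rel_frontier_of_polyhedron_alt[OF poly] by blast
      have "u \<bullet> x' \<le> u \<bullet> x"
        using sx uw by (simp add: x'_def inner_diff_right)
      then show ?thesis
        using T by (auto simp: \<T>_def)
    qed
    have "\<exists>m\<in>T. \<forall>x\<in>T. u \<bullet> m \<le> u \<bullet> x" if "T \<in> \<T>" for T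
    proof -
      have T: "T face_of P" "T \<noteq> P" "T \<noteq> {}"
        using that by (auto simp: \<T>_def)
      have "aff_dim T < aff_dim P"
        using T face_of_aff_dim_lt cvx by blast
      then have "nat (aff_dim T + 1) < nat (aff_dim P + 1)"
        using aff_dim_geq[of T] by linarith
      moreover have "polyhedron T" "T \<subseteq> P"
        using T face_of_polyhedron_polyhedron poly face_of_imp_subset by blast+
      ultimately show ?thesis
        using less.hyps[of T] T(3) less.prems(3) by blast
    qed
    then obtain m where m: "\<And>T. T \<in> \<T> \<Longrightarrow> m T \<in> T" "\<And>T x. T \<in> \<T> \<Longrightarrow> x \<in> T \<Longrightarrow> u \<bullet> m T \<le> u \<bullet> x"
      by metis
    have "finite \<T>"
      using finite_subset[OF _ finite_polyhedron_faces[OF poly]] by (simp add: \<T>_def Collect_mono)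
    moreover have "\<T> \<noteq> {}"
      using descend less.prems(2) by blast
    ultimately obtain T0 where T0: "T0 \<in> \<T>" "\<And>T. T \<in> \<T> \<Longrightarrow> u \<bullet> m T0 \<le> u \<bullet> m T"
      using ex_min_if_finite[of "(\<lambda>T. u \<bullet> m T) ` \<T>"]
      by (metis (no_types, lifting) arg_min_if_finite(1) arg_min_least)
    have "u \<bullet> m T0 \<le> u \<bullet> x" if x: "x \<in> P" for x
    proof -
      obtain T x' where "T \<in> \<T>" "x' \<in> T" "u \<bullet> x' \<le> u \<bullet> x"
        using descend[OF x] by blast
      then show ?thesis
        using T0(2) m(2) order_trans by meson
    qed
    moreover have "m T0 \<in> P"
      using m(1)[OF T0(1)] T0(1) face_of_imp_subset by (auto simp: \<T>_def)
    ultimately show ?thesis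
      by blast
  qed
qed

text \<open>Otherwise \<open>F\<close> attains its minimum over \<open>P\<close> on a face, where it
  is constant with a value between \<open>a\<close> and \<open>F x\<close>; this face would be a
  flat cell over \<open>{a..b}\<close>.\<close>

lemma transversal_cell_below:
  fixes \<C> :: "'a::euclidean_space set set"
  assumes \<C>: "polyhedral_complex \<C>" "cellwise_affine \<C> F" "transversal_thresholds \<C> F a b"
    and x: "P \<in> \<C>" "x \<in> P" "F x \<in> {a..b}"
  shows "\<exists>y\<in>P. F y < a"
proof (rule ccontr)
  assume "\<not> (\<exists>y\<in>P. F y < a)"
  then have ge: "\<And>y. y \<in> P \<Longrightarrow> a \<le> F y"
    by force
  have poly: "polyhedron P"
    using \<C>(1) x(1) by (simp add: polyhedral_complex_iff)
  obtain u d where ud: "\<And>x. x \<in> P \<Longrightarrow> F x = u \<bullet> x + d"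
    using \<C>(2) x(1) by (auto simp: cellwise_affine_def)
  have "a - d \<le> u \<bullet> y" if "y \<in> P" for y
    using ge[OF that] ud[OF that] by simp
  then obtain m where m: "m \<in> P" "\<And>x. x \<in> P \<Longrightarrow> u \<bullet> m \<le> u \<bullet> x"
    using polyhedron_attains_min[OF poly, of "a - d" u] x(2) by blast
  let ?T = "P \<inter> {x. u \<bullet> x = u \<bullet> m}"
  have "?T face_of P"
    using m(2) poly polyhedron_imp_convex by (intro face_of_Int_supporting_hyperplane_ge)
  then have "?T \<in> \<C>"
    using \<C>(1) x(1) by (simp add: polyhedral_complex_iff)
  moreover have eq: "F y = F m" if "y \<in> ?T" for y
    using that ud[of y] ud[OF m(1)] by simp
  then have "flat_cell F ?T"
    unfolding flat_cell_def using m(1) by blast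
  moreover have "F m \<in> {a..b}"
    using ge[OF m(1)] ud[OF m(1)] ud[OF x(2)] m(2)[OF x(2)] x(3) by simp
  then have "F ` ?T \<subseteq> {a..b}"
    using eq by auto
  ultimately show False
    using \<C>(3) unfolding transversal_thresholds_def by blast
qed

text \<open>By symmetry, replacing \<open>F\<close> by its negative and the interval by
  \<open>{- b..- a}\<close>.\<close>

lemma transversal_cell_above:
  fixes \<C> :: "'a::euclidean_space set set"
  assumes \<C>: "polyhedral_complex \<C>" "cellwise_affine \<C> F" "transversal_thresholds \<C> F a b"
    and x: "P \<in> \<C>" "x \<in> P" "F x \<in> {a..b}"
  shows "\<exists>y\<in>P. b < F y"
proof -
  have "cellwise_affine \<C> (\<lambda>x. - F x)"
    unfolding cellwise_affine_def
  proof
    fix C assume "C \<in> \<C>"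
    then obtain u d where "\<forall>x\<in>C. F x = u \<bullet> x + d"
      using \<C>(2) unfolding cellwise_affine_def by blast
    then show "\<exists>u d. \<forall>x\<in>C. - F x = u \<bullet> x + d"
      by (intro exI[of _ "- u"] exI[of _ "- d"]) simp
  qed
  moreover have "transversal_thresholds \<C> (\<lambda>x. - F x) (- b) (- a)"
  proof -
    have flat: "flat_cell F C" if "flat_cell (\<lambda>x. - F x) C" for C
      using that unfolding flat_cell_def by (metis minus_minus)
    have val: "F ` C \<subseteq> {a..b}" if "(\<lambda>x. - F x) ` C \<subseteq> {- b..- a}" for C
      using that by force
    show ?thesis
      unfolding transversal_thresholds_def
    proof
      assume "\<exists>C\<in>\<C>. flat_cell (\<lambda>x. - F x) C \<and> (\<lambda>x. - F x) ` C \<subseteq> {- b..- a}"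
      then obtain C where C: "C \<in> \<C>" "flat_cell (\<lambda>x. - F x) C" "(\<lambda>x. - F x) ` C \<subseteq> {- b..- a}"
        by blast
      show False
        using \<C>(3) C(1) flat[OF C(2)] val[OF C(3)] by (auto simp: transversal_thresholds_def)
    qed
  qed
  ultimately have "\<exists>y\<in>P. - F y < - b"
    using transversal_cell_below[OF \<C>(1), of "\<lambda>x. - F x" "- b" "- a" P x] x by simp
  then show ?thesis
    by simp
qed

text \<open>On \<open>P\<close> the function takes values below \<open>a\<close> and above
  \<open>b\<close>, so \<open>t\<close> is interior to the image interval up to the affine constant,
  and linear maps send relative interiors of convex sets onto relative interiors of their
  images.\<close>

lemma transversal_cell_level:
  fixes \<C> :: "'a::euclidean_space set set"
  assumes \<C>: "polyhedral_complex \<C>" "cellwise_affine \<C> F" "transversal_thresholds \<C> F a b"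
    and x: "P \<in> \<C>" "x \<in> P" "F x \<in> {a..b}" and t: "t \<in> {a..b}"
  shows "\<exists>z\<in>rel_interior P. F z = t"
proof -
  obtain u d where ud: "\<And>x. x \<in> P \<Longrightarrow> F x = u \<bullet> x + d"
    using \<C>(2) x(1) by (auto simp: cellwise_affine_def)
  have cvx: "convex P"
    using \<C>(1) x(1) polyhedron_imp_convex by (auto simp: polyhedral_complex_iff)
  obtain y z where yz: "y \<in> P" "F y < a" "z \<in> P" "b < F z"
    using transversal_cell_below[OF \<C> x] transversal_cell_above[OF \<C> x] by blast
  let ?f = "\<lambda>x. u \<bullet> x"
  have lin: "linear ?f"
    by (simp add: bounded_linear.linear bounded_linear_inner_right)
  have "convex (?f ` P)"
    using cvx lin convex_linear_image by blast
  then have "{?f y<..<?f z} \<subseteq> ?f ` P"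
    using yz by (auto simp: is_interval_convex_1[symmetric] is_interval_1)
  moreover have "t - d \<in> {?f y<..<?f z}"
    using t yz ud[OF yz(1)] ud[OF yz(3)] by auto
  ultimately have "t - d \<in> interior (?f ` P)"
    using interior_maximal[OF _ open_greaterThanLessThan] by blast
  then have "t - d \<in> ?f ` rel_interior P"
    using interior_subset_rel_interior rel_interior_convex_linear_image[OF lin cvx] by blast
  then obtain w where w: "w \<in> rel_interior P" "t - d = u \<bullet> w"
    by blast
  then have "F w = t"
    using ud[of w] rel_interior_subset by fastforce
  then show ?thesis
    using w(1) by blast
qed

section \<open>Slabs, their faces and relative interiors\<close>

definition slab :: "('a \<Rightarrow> real) \<Rightarrow> 'a set \<Rightarrow> real set \<Rightarrow> 'a set" where
  "slab F P J = {x\<in>P. F x \<in> J}"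

lemma in_slab_iff [simp]: "x \<in> slab F P J \<longleftrightarrow> x \<in> P \<and> F x \<in> J"
  by (simp add: slab_def)

lemma polyhedron_slab:
  fixes P :: "'a::euclidean_space set"
  assumes "polyhedron P" and ud: "\<And>x. x \<in> P \<Longrightarrow> F x = u \<bullet> x + d"
  shows "polyhedron (slab F P {..k})" "polyhedron (slab F P {k..})" "polyhedron (slab F P {k..l})"
proof -
  have "slab F P {..k} = P \<inter> {x. u \<bullet> x \<le> k - d}" for k
    using ud by (auto simp: slab_def)
  then show *: "polyhedron (slab F P {..k})" for k
    using assms(1) by (simp add: polyhedron_halfspace_le)
  have "slab F P {k..} = P \<inter> {x. u \<bullet> x \<ge> k - d}"
    using ud by (auto simp: slab_def)
  then show **: "polyhedron (slab F P {k..})"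
    using assms(1) by (simp add: polyhedron_halfspace_ge)
  have "slab F P {k..l} = slab F P {k..} \<inter> slab F P {..l}"
    by (auto simp: slab_def)
  then show "polyhedron (slab F P {k..l})"
    using *[of l] ** by simp
qed

text \<open>On \<open>P\<close> the function maps open segments to open segments or to points, so
  the face conditions for cells and for value sets combine.\<close>

lemma slab_face:
  fixes P :: "'a::euclidean_space set"
  assumes P: "convex P" and ud: "\<And>x. x \<in> P \<Longrightarrow> F x = u \<bullet> x + d" and G: "G face_of P" and J: "J' face_of J"
  shows "slab F G J' face_of slab F P J"
  unfolding face_of_def
proof (intro conjI ballI impI)
  have GP: "G \<subseteq> P"
    using G face_of_imp_subset by blast
  have JJ: "J' \<subseteq> J"
    using J face_of_imp_subset by blast
  have aff: "F ((1 - e) *\<^sub>R y + e *\<^sub>R z) = (1 - e) *\<^sub>R F y + e *\<^sub>R F z"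
    if "y \<in> P" "z \<in> P" "0 \<le> e" "e \<le> 1" for y z e
  proof -
    have "(1 - e) *\<^sub>R y + e *\<^sub>R z \<in> P"
      using that P by (simp add: convexD_alt)
    then show ?thesis
      using ud that by (simp add: inner_add_right algebra_simps)
  qed
  show "slab F G J' \<subseteq> slab F P J"
    using GP JJ by auto
  show "convex (slab F G J')"
    unfolding convex_alt
  proof (intro ballI allI impI)
    fix y z and e :: real assume "y \<in> slab F G J'" "z \<in> slab F G J'" "0 \<le> e \<and> e \<le> 1"
    then show "(1 - e) *\<^sub>R y + e *\<^sub>R z \<in> slab F G J'"
      using aff[of y z e] GP face_of_imp_convex[OF G] face_of_imp_convex[OF J]
      by (auto simp: convex_alt subset_iff simp del: real_scaleR_def)
  qed
  fix y z x assume y: "y \<in> slab F P J" and z: "z \<in> slab F P J" and x: "x \<in> slab F G J'" "x \<in> open_segment y z"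
  obtain e where e: "0 < e" "e < 1" "x = (1 - e) *\<^sub>R y + e *\<^sub>R z"
    using x(2) by (auto simp: in_segment)
  have Fx: "F x = (1 - e) *\<^sub>R F y + e *\<^sub>R F z"
    using aff[of y z e] y z e by simp
  have "F y \<in> J' \<and> F z \<in> J'"
  proof (cases "F y = F z")
    case True
    then have "F x = F y"
      using Fx by (simp add: algebra_simps)
    then show ?thesis
      using True x(1) by simp
  next
    case False
    then have "F x \<in> open_segment (F y) (F z)"
      using e Fx by (auto simp: in_segment)
    then show ?thesis
      using face_ofD[OF J] y z x(1) by simp
  qed
  moreover have "y \<in> G \<and> z \<in> G"
    using face_ofD[OF G x(2)] y z x(1) by simp
  ultimately show "y \<in> slab F G J'" "z \<in> slab F G J'"
    by auto
qed

text \<open>The point \<open>z\<close> witnesses that the relative interiors of \<open>P\<close> and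
  of the preimage of \<open>J\<close> meet; taking relative interiors then commutes with
  intersection and preimage. Transversality will supply such points at every level.\<close>

lemma rel_interior_slab:
  fixes P :: "'a::euclidean_space set"
  assumes P: "convex P" and ud: "\<And>x. x \<in> P \<Longrightarrow> F x = u \<bullet> x + d" and J: "convex J"
    and z: "z \<in> rel_interior P" "F z \<in> rel_interior J"
  shows "rel_interior (slab F P J) = slab F (rel_interior P) (rel_interior J)"
proof -
  let ?f = "\<lambda>x. u \<bullet> x" and ?J = "(+) (- d) ` J"
  have lin: "linear ?f"
    by (simp add: bounded_linear.linear bounded_linear_inner_right)
  have riJ: "rel_interior ?J = (+) (- d) ` rel_interior J"
    by (rule rel_interior_translation)
  have mem: "u \<bullet> x \<in> (+) (- d) ` K \<longleftrightarrow> F x \<in> K" if "x \<in> P" for x K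
    using ud[OF that] by (force simp: image_iff)
  have zP: "z \<in> P"
    using z(1) rel_interior_subset by blast
  have zf: "z \<in> ?f -` rel_interior ?J"
    unfolding vimage_eq riJ mem[OF zP] by (rule z(2))
  have J': "convex ?J"
    using J convex_translation_eq by blast
  have vim: "rel_interior (?f -` ?J) = ?f -` rel_interior ?J"
    using rel_interior_convex_linear_preimage[OF lin J'] zf by blast
  have "slab F P J = P \<inter> ?f -` ?J"
    unfolding set_eq_iff in_slab_iff Int_iff vimage_eq using mem by blast
  moreover have "rel_interior (P \<inter> ?f -` ?J) = rel_interior P \<inter> rel_interior (?f -` ?J)"
    using z(1) zf vim J' lin by (intro convex_rel_interior_inter_two P convex_linear_vimage) auto
  moreover have "rel_interior P \<inter> ?f -` rel_interior ?J = slab F (rel_interior P) (rel_interior J)"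
    unfolding set_eq_iff in_slab_iff Int_iff vimage_eq riJ using mem rel_interior_subset[of P] by blast
  ultimately show ?thesis
    using vim by simp
qed

section \<open>Product structure over an interval of transversal thresholds\<close>

text \<open>The nonempty faces of the interval. They coincide if \<open>a = b\<close>, and this case
  is treated apart.\<close>

definition thresholds :: "real \<Rightarrow> real \<Rightarrow> real set set" where
  "thresholds a b = {{a}, {b}, {a..b}}"

text \<open>Inclusion stands for the face relation: a cell of a complex that is contained in another
  cell is a face of it.\<close>

definition slab_less :: "'a set \<times> real set \<Rightarrow> 'a set \<times> real set \<Rightarrow> bool" where
  "slab_less i j \<longleftrightarrow> i \<noteq> j \<and> fst i \<subseteq> fst j \<and> snd i \<subseteq> snd j"

text \<open>A set of cells \<open>G\<close>, not of slabs: the same \<open>G\<close> indexes its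
  slab, its levels and the products with a level.\<close>

definition compact_slabs :: "'a::euclidean_space set set \<Rightarrow> ('a \<Rightarrow> real) \<Rightarrow> real \<Rightarrow> real \<Rightarrow> 'a set set" where
  "compact_slabs \<C> F a b = {G\<in>\<C>. slab F G {a..b} \<noteq> {} \<and> bounded (slab F G {a..b})}"

lemma thresholds_facts:
  assumes "a < b" "J \<in> thresholds a b"
  shows "J \<subseteq> {a..b}" "convex J" "compact J" "J \<noteq> {a..b} \<Longrightarrow> rel_interior J = J"
    and "rel_interior {a..b} = {a<..<b}"
  using assms by (auto simp: thresholds_def rel_interior_real_box)

lemma thresholds_disjoint:
  assumes "a < b" "J \<in> thresholds a b" "J' \<in> thresholds a b" "J \<noteq> J'"
  shows "rel_interior J \<inter> rel_interior J' = {}" "J' \<subseteq> J \<Longrightarrow> J' \<inter> rel_interior J = {}"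
  using assms by (auto simp: thresholds_def rel_interior_real_box)

text \<open>Here \<open>\<alpha>\<close> and \<open>\<beta>\<close> read off the position in the
  complex and the height of a point. For the product they are the projections on the set
  \<open>F (fst y) = c\<close>, for the slabs the identity and \<open>F\<close>; one verification
  covers both families.\<close>

lemma slab_cell_family:
  fixes \<C> :: "'a::euclidean_space set set" and \<alpha> :: "'b::euclidean_space \<Rightarrow> 'a" and \<beta> :: "'b \<Rightarrow> real"
  assumes I_def: "I = compact_slabs \<C> F a b \<times> thresholds a b"
    and \<C>: "polyhedral_complex \<C>" and ab: "a < b"
    and cell: "\<And>G J. (G, J) \<in> I \<Longrightarrow> cell (G, J) = {y\<in>Y. \<alpha> y \<in> G \<and> \<beta> y \<in> J}"
    and ri: "\<And>G J. (G, J) \<in> I \<Longrightarrow>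
      rel_interior (cell (G, J)) = {y\<in>Y. \<alpha> y \<in> rel_interior G \<and> \<beta> y \<in> rel_interior J}"
    and cpt: "\<And>i. i \<in> I \<Longrightarrow> compact (cell i)" and cvx: "\<And>i. i \<in> I \<Longrightarrow> convex (cell i)"
    and ctr: "\<And>i. i \<in> I \<Longrightarrow> p i \<in> rel_interior (cell i)"
    and lev: "\<And>y. y \<in> Y \<Longrightarrow> \<beta> y \<in> {a..b} \<Longrightarrow> F (\<alpha> y) \<in> {a..b}"
  shows "cell_family I slab_less cell p"
proof
  have fin: "finite \<C>" and poly: "\<And>P. P \<in> \<C> \<Longrightarrow> polyhedron P"
    and face: "\<And>P T. P \<in> \<C> \<Longrightarrow> T face_of P \<Longrightarrow> T \<in> \<C>"
    and int: "\<And>P Q. P \<in> \<C> \<Longrightarrow> Q \<in> \<C> \<Longrightarrow> P \<inter> Q face_of P"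
    using \<C> by (auto simp: polyhedral_complex_iff)
  have ICD: "G \<in> \<C>" "J \<in> thresholds a b" "G \<in> compact_slabs \<C> F a b" if "(G, J) \<in> I" for G J
    using that by (auto simp: I_def compact_slabs_def)
  show "finite I"
    using fin by (simp add: I_def compact_slabs_def thresholds_def)
  show "slab_less i k" if "slab_less i j" "slab_less j k" for i j k :: "'a set \<times> real set"
    using that unfolding slab_less_def by (metis prod.expand subset_antisym subset_trans)
  show "compact (cell i)" "convex (cell i)" "p i \<in> rel_interior (cell i)" if "i \<in> I" for i
    using that cpt cvx ctr by auto
  show "rel_interior (cell i) \<inter> rel_interior (cell j) = {}" if ij: "i \<in> I" "j \<in> I" "i \<noteq> j" for i j
  proof -
    obtain G J G' J' where i: "i = (G, J)" and j: "j = (G', J')"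
      by (metis surj_pair)
    have GJ: "(G, J) \<in> I" "(G', J') \<in> I"
      using ij i j by auto
    show ?thesis
    proof (cases "G = G'")
      case True
      then have "J \<noteq> J'"
        using ij i j by blast
      then have "rel_interior J \<inter> rel_interior J' = {}"
        using thresholds_disjoint(1)[OF ab] ICD GJ by blast
      then show ?thesis
        unfolding i j ri[OF GJ(1)] ri[OF GJ(2)] by blast
    next
      case False
      have "rel_interior G \<inter> rel_interior G' = {}"
      proof (rule ccontr)
        assume "rel_interior G \<inter> rel_interior G' \<noteq> {}"
        then obtain x where x: "x \<in> rel_interior G" "x \<in> rel_interior G'"
          by blast
        then have "x \<in> G \<inter> G'"
          using rel_interior_subset by blast
        \<comment> \<open>Cells meeting in their relative interiors both coincide with their common
          face.\<close>
        then have "G \<inter> G' = G" "G' \<inter> G = G'"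
          using x face_of_disjoint_rel_interior[OF int[OF ICD(1)[OF GJ(1)] ICD(1)[OF GJ(2)]]]
            face_of_disjoint_rel_interior[OF int[OF ICD(1)[OF GJ(2)] ICD(1)[OF GJ(1)]]] by blast+
        then show False
          using False by blast
      qed
      then show ?thesis
        unfolding i j ri[OF GJ(1)] ri[OF GJ(2)] by blast
    qed
  qed
  show "rel_frontier (cell i) = (\<Union>j\<in>{j\<in>I. slab_less j i}. cell j)" if iI: "i \<in> I" for i
  proof -
    obtain G J where i: "i = (G, J)"
      by (metis surj_pair)
    have GJ: "(G, J) \<in> I"
      using iI i by simp
    note C = ICD[OF GJ]
    have "rel_frontier (cell i) = cell (G, J) - rel_interior (cell (G, J))"
      using compact_imp_closed[OF cpt[OF iI]] by (simp add: rel_frontier_def i)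
    also have "\<dots> = {y\<in>Y. \<alpha> y \<in> G \<and> \<beta> y \<in> J} - {y\<in>Y. \<alpha> y \<in> rel_interior G \<and> \<beta> y \<in> rel_interior J}"
      by (subst ri[OF GJ], subst cell[OF GJ]) (rule refl)
    finally have fr: "rel_frontier (cell i) = \<dots>" .
    show ?thesis
    proof (intro subset_antisym subsetI)
      fix y assume "y \<in> rel_frontier (cell i)"
      then have y: "y \<in> Y" "\<alpha> y \<in> G" "\<beta> y \<in> J" and nri: "\<alpha> y \<notin> rel_interior G \<or> \<beta> y \<notin> rel_interior J"
        unfolding fr by blast+
      have \<beta>y: "\<beta> y \<in> {a..b}"
        using y(3) thresholds_facts(1)[OF ab C(2)] by blast
      have "\<exists>j\<in>I. slab_less j i \<and> y \<in> cell j"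
      proof (cases "\<alpha> y \<in> rel_interior G")
        case False
        then have "\<alpha> y \<in> rel_frontier G"
          using y(2) closure_subset by (auto simp: rel_frontier_def)
        then obtain T where T: "T face_of G" "T \<noteq> G" "\<alpha> y \<in> T"
          using rel_frontier_of_polyhedron_alt[OF poly[OF C(1)]] by blast
        have TG: "T \<subseteq> G"
          using T(1) face_of_imp_subset by blast
        \<comment> \<open>The face inherits boundedness of the slab, and \<open>y\<close> shows that
          its slab is nonempty; this is what \<open>lev\<close> is for.\<close>
        have "bounded (slab F T {a..b})"
          using C(3) TG by (auto simp: compact_slabs_def slab_def intro: bounded_subset)
        moreover have "\<alpha> y \<in> slab F T {a..b}"
          using T(3) lev[OF y(1) \<beta>y] by simp
        ultimately have "(T, J) \<in> I"
          using face[OF C(1) T(1)] C(2) by (auto simp: I_def compact_slabs_def)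
        then show ?thesis
          using cell[of T J] y T TG by (intro bexI[of _ "(T, J)"]) (auto simp: slab_less_def i)
      next
        case True
        then have nJ: "\<beta> y \<notin> rel_interior J"
          using nri by blast
        then have J: "J = {a..b}"
          using thresholds_facts(4)[OF ab C(2)] y(3) by blast
        then have "\<beta> y = a \<or> \<beta> y = b"
          using nJ thresholds_facts(5)[OF ab C(2)] \<beta>y by auto
        then have "{\<beta> y} \<in> thresholds a b"
          by (auto simp: thresholds_def)
        moreover have "a \<in> J" "b \<in> J"
          using ab J by auto
        then have "{\<beta> y} \<noteq> J"
          using ab by blast
        ultimately have "(G, {\<beta> y}) \<in> I" "slab_less (G, {\<beta> y}) i"
          using C(3) y(3) by (auto simp: I_def slab_less_def i)
        then show ?thesis
          using cell[of G "{\<beta> y}"] y by (intro bexI[of _ "(G, {\<beta> y})"]) auto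
      qed
      then show "y \<in> (\<Union>j\<in>{j\<in>I. slab_less j i}. cell j)"
        by blast
    next
      fix y assume "y \<in> (\<Union>j\<in>{j\<in>I. slab_less j i}. cell j)"
      then obtain T J' where TJ: "(T, J') \<in> I" "slab_less (T, J') (G, J)" "y \<in> cell (T, J')"
        unfolding i by auto
      have sub: "T \<subseteq> G" "J' \<subseteq> J" and ne: "T \<noteq> G \<or> J' \<noteq> J"
        using TJ(2) by (auto simp: slab_less_def)
      have y: "y \<in> Y" "\<alpha> y \<in> T" "\<beta> y \<in> J'"
        using TJ(3) cell[OF TJ(1)] by auto
      have "\<alpha> y \<notin> rel_interior G \<or> \<beta> y \<notin> rel_interior J"
      proof (cases "T = G")
        case True
        then show ?thesis
          using ne y(3) sub(2) thresholds_disjoint(2)[OF ab C(2) ICD(2)[OF TJ(1)]] by blast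
      next
        case False
        have "T face_of G"
          using int[OF C(1) ICD(1)[OF TJ(1)]] sub(1) by (simp add: Int_absorb1)
        then show ?thesis
          using False y(2) face_of_disjoint_rel_interior by blast
      qed
      then show "y \<in> rel_frontier (cell i)"
        using y sub unfolding fr by blast
    qed
  qed
qed

proposition slab_product_structure:
  fixes \<C> :: "'a::euclidean_space set set"
  assumes M_def: "M = compact_slabs \<C> F a b"
    and \<C>: "polyhedral_complex \<C>" "cellwise_affine \<C> F" "transversal_thresholds \<C> F a b"
    and ab: "a < b" and c: "c \<in> {a..b}"
  obtains \<phi> where "pl_homeomorphism ((\<Union>G\<in>M. slab F G {c}) \<times> {a..b}) (\<Union>G\<in>M. slab F G {a..b}) \<phi>"
    "\<And>x. x \<in> (\<Union>G\<in>M. slab F G {c}) \<times> {a..b} \<Longrightarrow> F (\<phi> x) = snd x"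
proof -
  define I where "I = M \<times> thresholds a b"
  have MC: "G \<in> \<C>" "bounded (slab F G {a..b})" "slab F G {a..b} \<noteq> {}" if "G \<in> M" for G
    using that by (auto simp: M_def compact_slabs_def)
  have poly: "polyhedron G" "convex G" if "G \<in> M" for G
    using MC(1)[OF that] \<C>(1) polyhedron_imp_convex by (auto simp: polyhedral_complex_iff)
  have aff: "\<exists>u d. \<forall>x\<in>G. F x = u \<bullet> x + d" if "G \<in> M" for G
    using MC(1)[OF that] \<C>(2) unfolding cellwise_affine_def by blast
  have level: "\<exists>z\<in>rel_interior G. F z = t" if G: "G \<in> M" and t: "t \<in> {a..b}" for G t
  proof -
    obtain x where "x \<in> G" "F x \<in> {a..b}"
      using MC(3)[OF G] by (auto simp: slab_def)
    then show ?thesis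
      using transversal_cell_level[OF \<C> MC(1)[OF G] _ _ t] by blast
  qed
  \<comment> \<open>Heights of the centres: the midpoint for the whole interval, while
    \<open>Inf\<close> picks the element of a singleton.\<close>
  define lv where "lv J = (if J = {a..b} then (a + b) / 2 else Inf J)" for J
  have lv: "lv J \<in> rel_interior J" "lv J \<in> {a..b}" if "J \<in> thresholds a b" for J
    using that ab by (auto simp: thresholds_def lv_def rel_interior_real_box)
  define z where "z G t = (SOME z. z \<in> rel_interior G \<and> F z = t)" for G t
  have z: "z G t \<in> rel_interior G" "F (z G t) = t" if "G \<in> M" "t \<in> {a..b}" for G t
    using someI_ex[of "\<lambda>z. z \<in> rel_interior G \<and> F z = t"] level[OF that] unfolding z_def by blast+
  have cpt_slab: "compact (slab F G {k..l})" "convex (slab F G {k..l})" if G: "G \<in> M" and kl: "{k..l} \<subseteq> {a..b}" for G k l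
  proof -
    obtain u d where ud: "\<And>x. x \<in> G \<Longrightarrow> F x = u \<bullet> x + d"
      using aff[OF G] by blast
    have p: "polyhedron (slab F G {k..l})"
      using polyhedron_slab(3)[OF poly(1)[OF G] ud] .
    have "bounded (slab F G {k..l})"
      using kl by (intro bounded_subset[OF MC(2)[OF G]]) auto
    then show "compact (slab F G {k..l})" "convex (slab F G {k..l})"
      using p polyhedron_imp_closed polyhedron_imp_convex compact_eq_bounded_closed by auto
  qed
  have th: "\<exists>k l. J = {k..l} \<and> {k..l} \<subseteq> {a..b}" if "J \<in> thresholds a b" for J
    using that ab unfolding thresholds_def by (metis atLeastAtMost_singleton c
        atLeastAtMost_iff empty_subsetI insert_iff insert_subset less_imp_le order_refl singletonD)
  have ri_slab: "rel_interior (slab F G J) = slab F (rel_interior G) (rel_interior J)"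
    if G: "G \<in> M" and t: "t \<in> {a..b}" "t \<in> rel_interior J" and J: "convex J" for G J t
  proof -
    obtain u d where ud: "\<And>x. x \<in> G \<Longrightarrow> F x = u \<bullet> x + d"
      using aff[OF G] by blast
    show ?thesis
      using rel_interior_slab[OF poly(2)[OF G] ud J z(1)[OF G t(1)]] z(2)[OF G t(1)] t(2) by simp
  qed
  let ?S = "\<lambda>i. slab F (fst i) {c} \<times> snd i" and ?T = "\<lambda>i. slab F (fst i) (snd i)"
  \<comment> \<open>Corresponding centres: a point of \<open>G\<close> at level \<open>c\<close>
    paired with the height \<open>lv J\<close>, and a point of \<open>G\<close> at level
    \<open>lv J\<close>. They are relatively interior because \<open>G\<close> has relatively
    interior points at every level.\<close>
  let ?p = "\<lambda>i. (z (fst i) c, lv (snd i))" and ?q = "\<lambda>i. z (fst i) (lv (snd i))"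
  have ID: "G \<in> M" "J \<in> thresholds a b" "convex J" "compact J" if "(G, J) \<in> I" for G J
    using that thresholds_facts(2,3)[OF ab] by (auto simp: I_def)
  have c': "c \<in> rel_interior {c}" "convex {c}" "{c} = {c..c}" "{c..c} \<subseteq> {a..b}"
    using c by auto
  have ri_S: "rel_interior (?S (G, J)) = slab F (rel_interior G) {c} \<times> rel_interior J" if "(G, J) \<in> I" for G J
    using ri_slab[OF ID(1)[OF that] c c'(1,2)] cpt_slab(2)[OF ID(1)[OF that] c'(4)] ID(3)[OF that]
    by (simp add: rel_interior_Times)
  have ri_T: "rel_interior (?T (G, J)) = slab F (rel_interior G) (rel_interior J)" if "(G, J) \<in> I" for G J
    using ri_slab[OF ID(1)[OF that] lv(2,1)[OF ID(2)[OF that]] ID(3)[OF that]] by simp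
  have S: "cell_family I slab_less ?S ?p"
  proof (rule slab_cell_family[OF I_def[unfolded M_def] \<C>(1) ab,
        where Y = "{y. F (fst y) = c}" and \<alpha> = fst and \<beta> = snd])
    show "?S (G, J) = {y \<in> {y. F (fst y) = c}. fst y \<in> G \<and> snd y \<in> J}" for G J
      by auto
    show "rel_interior (?S (G, J)) = {y \<in> {y. F (fst y) = c}. fst y \<in> rel_interior G \<and> snd y \<in> rel_interior J}"
      if "(G, J) \<in> I" for G J
      unfolding ri_S[OF that] by auto
    fix i assume i: "i \<in> I"
    then have i': "(fst i, snd i) \<in> I"
      by simp
    show "compact (?S i)" "convex (?S i)"
      using cpt_slab[OF ID(1)[OF i'] c'(4)] ID(3,4)[OF i'] by (auto simp: compact_Times convex_Times)
    show "?p i \<in> rel_interior (?S i)"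
      using ri_S[OF i'] z[OF ID(1)[OF i'] c] lv(1)[OF ID(2)[OF i']] by simp
  next
    show "F (fst y) \<in> {a..b}" if "y \<in> {y. F (fst y) = c}" for y :: "'a \<times> real"
      using that c by simp
  qed
  have T: "cell_family I slab_less ?T ?q"
  proof (rule slab_cell_family[OF I_def[unfolded M_def] \<C>(1) ab,
        where Y = UNIV and \<alpha> = "\<lambda>x. x" and \<beta> = F])
    show "?T (G, J) = {y \<in> UNIV. y \<in> G \<and> F y \<in> J}" for G J
      by auto
    show "rel_interior (?T (G, J)) = {y \<in> UNIV. y \<in> rel_interior G \<and> F y \<in> rel_interior J}"
      if "(G, J) \<in> I" for G J
      unfolding ri_T[OF that] by auto
    fix i assume i: "i \<in> I"
    then have i': "(fst i, snd i) \<in> I"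
      by simp
    obtain k l where "snd i = {k..l}" "{k..l} \<subseteq> {a..b}"
      using th[OF ID(2)[OF i']] by blast
    then show "compact (?T i)" "convex (?T i)"
      using cpt_slab[OF ID(1)[OF i']] by auto
    show "?q i \<in> rel_interior (?T i)"
      using ri_T[OF i'] z[OF ID(1)[OF i'] lv(2)[OF ID(2)[OF i']]] lv(1)[OF ID(2)[OF i']] by simp
  qed auto
  interpret S: cell_family I slab_less ?S ?p by (rule S)
  interpret T: cell_family I slab_less ?T ?q by (rule T)
  have Un_thr: "\<Union>(thresholds a b) = {a..b}"
    using ab by (auto simp: thresholds_def)
  have US: "(\<Union>i\<in>I. ?S i) = (\<Union>G\<in>M. slab F G {c}) \<times> {a..b}"
    unfolding I_def Un_thr[symmetric] by auto
  have UT: "(\<Union>i\<in>I. ?T i) = (\<Union>G\<in>M. slab F G {a..b})"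
    unfolding I_def Un_thr[symmetric] by auto
  have lin: "F (S.transfer ?q x) = snd x" if x: "x \<in> (\<Union>i\<in>I. ?S i)" for x
  proof -
    obtain \<beta> where \<beta>: "S.barycentric x \<beta>"
      using x S.ex_barycentric_iff by blast
    have tr: "S.transfer ?q x = (\<Sum>i\<in>I. \<beta> i *\<^sub>R ?q i)"
      using S.transfer_eq[OF \<beta>] .
    then have "T.barycentric (S.transfer ?q x) \<beta>"
      using \<beta> by (simp add: S.barycentric_def T.barycentric_def)
    then obtain k where k: "k \<in> I" "\<And>j. \<beta> j \<noteq> 0 \<Longrightarrow> j = k \<or> slab_less j k"
      "S.transfer ?q x \<in> rel_interior (?T k)"
      using T.barycentric_top by blast
    have kM: "fst k \<in> M"
      using k(1) by (auto simp: I_def)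
    obtain u d where ud: "\<And>x. x \<in> fst k \<Longrightarrow> F x = u \<bullet> x + d"
      using aff[OF kM] by blast
    \<comment> \<open>All centres in the support lie in the cell \<open>fst k\<close> of the top
      index, so one affine formula for \<open>F\<close> applies to all of them, and their heights
      are averaged with the weights \<open>\<beta>\<close>.\<close>
    have q_level: "u \<bullet> ?q i + d = lv (snd i)" if "i \<in> I" "\<beta> i \<noteq> 0" for i
    proof -
      have i: "fst i \<in> M" "snd i \<in> thresholds a b"
        using that(1) by (auto simp: I_def)
      have "fst i \<subseteq> fst k"
        using k(2)[OF that(2)] by (auto simp: slab_less_def)
      then have "?q i \<in> fst k"
        using z(1)[OF i(1) lv(2)[OF i(2)]] rel_interior_subset by blast
      then show ?thesis
        using ud z(2)[OF i(1) lv(2)[OF i(2)]] by metis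
    qed
    have "S.transfer ?q x \<in> fst k"
      using k(3) rel_interior_subset[of "?T k"] by auto
    then have "F (S.transfer ?q x) = u \<bullet> (\<Sum>i\<in>I. \<beta> i *\<^sub>R ?q i) + d"
      using ud tr by simp
    also have "\<dots> = (\<Sum>i\<in>I. \<beta> i * (u \<bullet> ?q i)) + sum \<beta> I * d"
      using \<beta> by (simp add: inner_sum_right S.barycentric_def)
    also have "\<dots> = (\<Sum>i\<in>I. \<beta> i * (u \<bullet> ?q i + d))"
      by (simp add: sum_distrib_left sum.distrib algebra_simps)
    also have "\<dots> = (\<Sum>i\<in>I. \<beta> i * lv (snd i))"
      using q_level by (intro sum.cong refl) (metis mult_eq_0_iff)
    also have "\<dots> = snd (\<Sum>i\<in>I. \<beta> i *\<^sub>R ?p i)"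
      by (simp add: snd_sum)
    also have "\<dots> = snd x"
      using \<beta> by (simp add: S.barycentric_def)
    finally show ?thesis .
  qed
  show ?thesis
  proof
    show "pl_homeomorphism ((\<Union>G\<in>M. slab F G {c}) \<times> {a..b}) (\<Union>G\<in>M. slab F G {a..b}) (S.transfer ?q)"
      using cell_family_pl_homeomorphism[OF S T] unfolding US UT .
    show "F (S.transfer ?q x) = snd x" if "x \<in> (\<Union>G\<in>M. slab F G {c}) \<times> {a..b}" for x
      using lin that unfolding US by blast
  qed
qed

section \<open>Restriction of the product structure to single levels\<close>

lemma pl_map_restrict:
  assumes "pl_map S f" "\<Union>\<Q> \<subseteq> S" "finite \<Q>" "\<And>Q. Q \<in> \<Q> \<Longrightarrow> polyhedron Q"
  shows "pl_map (\<Union>\<Q>) f"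
proof -
  obtain \<P> where \<P>: "finite \<P>" "\<Union>\<P> = S" "\<And>P. P \<in> \<P> \<Longrightarrow> polyhedron P"
    "\<And>P. P \<in> \<P> \<Longrightarrow> \<exists>g c. linear g \<and> (\<forall>x\<in>P. f x = g x + c)"
    using assms(1) unfolding pl_map_def by blast
  let ?\<R> = "(\<lambda>(P, Q). P \<inter> Q) ` (\<P> \<times> \<Q>)"
  have "\<Union>?\<R> = \<Union>\<Q>"
    using assms(2) \<P>(2) by auto
  moreover have "polyhedron R \<and> (\<exists>g c. linear g \<and> (\<forall>x\<in>R. f x = g x + c))" if R: "R \<in> ?\<R>" for R
  proof -
    obtain P Q where PQ: "P \<in> \<P>" "Q \<in> \<Q>" "R = P \<inter> Q"
      using R by auto
    obtain g c where "linear g" "\<forall>x\<in>P. f x = g x + c"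
      using \<P>(4)[OF PQ(1)] by blast
    then have "\<exists>g c. linear g \<and> (\<forall>x\<in>R. f x = g x + c)"
      using PQ(3) by (intro exI[of _ g] exI[of _ c]) auto
    then show ?thesis
      using PQ \<P>(3) assms(4) by auto
  qed
  moreover have "finite ?\<R>"
    using \<P>(1) assms(3) by simp
  ultimately show ?thesis
    unfolding pl_map_def by (intro exI[of _ ?\<R>]) auto
qed

lemma pl_homeomorphism_restrict:
  assumes "pl_homeomorphism S T f" "\<Union>\<P> \<subseteq> S" "f ` \<Union>\<P> = \<Union>\<Q>" "finite \<P>" "finite \<Q>"
    and "\<And>P. P \<in> \<P> \<Longrightarrow> polyhedron P" "\<And>Q. Q \<in> \<Q> \<Longrightarrow> polyhedron Q"
  shows "pl_homeomorphism (\<Union>\<P>) (\<Union>\<Q>) f"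
proof -
  obtain g where g: "homeomorphism S T f g" "pl_map S f" "pl_map T g"
    using assms(1) by (auto simp: pl_homeomorphism_def)
  have "f ` S = T"
    using g(1) by (simp add: homeomorphism_def)
  then have T: "\<Union>\<Q> \<subseteq> T"
    using assms(2,3) by blast
  have "homeomorphism (\<Union>\<P>) (\<Union>\<Q>) f g"
    using homeomorphism_of_subsets[OF g(1) assms(2) T assms(3)] .
  moreover have "pl_map (\<Union>\<P>) f" "pl_map (\<Union>\<Q>) g"
    using pl_map_restrict[OF g(2) assms(2,4,6)] pl_map_restrict[OF g(3) T assms(5,7)] by auto
  ultimately show ?thesis
    unfolding pl_homeomorphism_def by blast
qed

text \<open>Serves the degenerate interval \<open>a = b\<close>, where the product structure is a
  projection.\<close>

lemma pl_homeomorphism_fst: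
  fixes \<P> :: "'a::euclidean_space set set" and t :: real
  assumes "finite \<P>" "\<And>P. P \<in> \<P> \<Longrightarrow> polytope P"
  shows "pl_homeomorphism (\<Union>\<P> \<times> {t}) (\<Union>\<P>) fst"
  unfolding pl_homeomorphism_def
proof (rule exI[of _ "\<lambda>x. (x, t)"], intro conjI)
  show "homeomorphism (\<Union>\<P> \<times> {t}) (\<Union>\<P>) fst (\<lambda>x. (x, t))"
    by (rule homeomorphismI) (auto intro!: continuous_intros)
  show "pl_map (\<Union>\<P> \<times> {t}) fst"
    unfolding pl_map_def
  proof (rule exI[of _ "(\<lambda>P. P \<times> {t}) ` \<P>"], intro conjI ballI)
    fix Q assume "Q \<in> (\<lambda>P. P \<times> {t}) ` \<P>"
    then show "polyhedron Q"
      using assms(2) polytope_Times[OF _ polytope_sing] polytope_imp_polyhedron by auto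
    show "\<exists>g c. linear g \<and> (\<forall>x\<in>Q. fst x = g x + c)"
      using linear_fst by (intro exI[of _ fst] exI[of _ 0]) auto
  qed (use assms(1) in auto)
  show "pl_map (\<Union>\<P>) (\<lambda>x. (x, t))"
    unfolding pl_map_def
  proof (rule exI[of _ \<P>], intro conjI ballI)
    fix Q assume "Q \<in> \<P>"
    then show "polyhedron Q"
      using assms(2) polytope_imp_polyhedron by auto
    have "linear (\<lambda>x::'a. (x, 0::real))"
      by (rule linearI) auto
    then show "\<exists>g c. linear g \<and> (\<forall>x\<in>Q. (x, t) = g x + c)"
      by (intro exI[of _ "\<lambda>x. (x, 0)"] exI[of _ "(0, t)"]) auto
  qed (use assms(1) in auto)
qed

text \<open>For \<open>a < b\<close> the height of \<open>\<phi> x\<close> is the second coordinate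
  of \<open>x\<close>, so the slice at \<open>t\<close> goes onto the level \<open>t\<close>. Both
  are finite unions of polytopes, and to such subsets PL homeomorphisms restrict.\<close>

proposition slab_product_levels:
  fixes \<C> :: "'a::euclidean_space set set"
  assumes M_def: "M = compact_slabs \<C> F a b"
    and \<C>: "polyhedral_complex \<C>" "cellwise_affine \<C> F" "transversal_thresholds \<C> F a b"
    and ab: "a \<le> b" and c: "c \<in> {a..b}"
  shows "\<exists>\<phi>. pl_homeomorphism ((\<Union>G\<in>M. slab F G {c}) \<times> {a..b}) (\<Union>G\<in>M. slab F G {a..b}) \<phi> \<and>
    (\<forall>t\<in>{a..b}. pl_homeomorphism ((\<Union>G\<in>M. slab F G {c}) \<times> {t}) (\<Union>G\<in>M. slab F G {t}) \<phi>)"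
proof -
  have finM: "finite M"
    using \<C>(1) by (simp add: M_def compact_slabs_def polyhedral_complex_iff)
  have polytope_slab: "polytope (slab F G {t})" if G: "G \<in> M" and t: "t \<in> {a..b}" for G t
  proof -
    have GC: "G \<in> \<C>" "bounded (slab F G {a..b})"
      using G by (auto simp: M_def compact_slabs_def)
    obtain u d where ud: "\<And>x. x \<in> G \<Longrightarrow> F x = u \<bullet> x + d"
      using GC(1) \<C>(2) unfolding cellwise_affine_def by blast
    have "polyhedron G"
      using GC(1) \<C>(1) by (simp add: polyhedral_complex_iff)
    then have "polyhedron (slab F G {t..t})"
      using polyhedron_slab(3) ud by blast
    moreover have "bounded (slab F G {t})"
      using t by (intro bounded_subset[OF GC(2)]) auto
    ultimately show ?thesis
      by (simp add: polytope_eq_bounded_polyhedron)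
  qed
  show ?thesis
  proof (cases "a = b")
    case True
    then have ca: "c = a" "{a..b} = {a}"
      using c by auto
    have "pl_homeomorphism (\<Union>((\<lambda>G. slab F G {a}) ` M) \<times> {a}) (\<Union>((\<lambda>G. slab F G {a}) ` M)) fst"
    proof (rule pl_homeomorphism_fst)
      show "finite ((\<lambda>G. slab F G {a}) ` M)"
        using finM by simp
      show "polytope P" if "P \<in> (\<lambda>G. slab F G {a}) ` M" for P
        using that polytope_slab ab by (elim imageE) simp
    qed
    then show ?thesis
      unfolding ca by (intro exI[of _ fst]) simp
  next
    case False
    then have "a < b"
      using ab by simp
    then obtain \<phi> where \<phi>: "pl_homeomorphism ((\<Union>G\<in>M. slab F G {c}) \<times> {a..b}) (\<Union>G\<in>M. slab F G {a..b}) \<phi>"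
      and lev: "\<And>x. x \<in> (\<Union>G\<in>M. slab F G {c}) \<times> {a..b} \<Longrightarrow> F (\<phi> x) = snd x"
      using slab_product_structure[OF M_def \<C> _ c] by blast
    let ?S = "(\<Union>G\<in>M. slab F G {c}) \<times> {a..b}" and ?T = "\<Union>G\<in>M. slab F G {a..b}"
    have surj: "\<phi> ` ?S = ?T"
      using \<phi> by (auto simp: pl_homeomorphism_def homeomorphism_def)
    have "pl_homeomorphism ((\<Union>G\<in>M. slab F G {c}) \<times> {t}) (\<Union>G\<in>M. slab F G {t}) \<phi>" if t: "t \<in> {a..b}" for t
    proof -
      let ?\<P> = "(\<lambda>G. slab F G {c} \<times> {t}) ` M" and ?\<Q> = "(\<lambda>G. slab F G {t}) ` M"
      have P: "\<Union>?\<P> = (\<Union>G\<in>M. slab F G {c}) \<times> {t}"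
        by auto
      have sub: "\<Union>?\<P> \<subseteq> ?S"
        unfolding P using t by auto
      have "\<phi> ` \<Union>?\<P> = \<Union>?\<Q>"
      proof (intro subset_antisym subsetI)
        fix y assume "y \<in> \<phi> ` \<Union>?\<P>"
        then obtain x where x: "x \<in> (\<Union>G\<in>M. slab F G {c}) \<times> {t}" "y = \<phi> x"
          unfolding P by blast
        have xS: "x \<in> ?S"
          using x(1) sub unfolding P by blast
        have "F y = t"
          using lev[OF xS] x by auto
        moreover have "y \<in> ?T"
          using surj xS x(2) by blast
        ultimately show "y \<in> \<Union>?\<Q>"
          by auto
      next
        fix y assume "y \<in> \<Union>?\<Q>"
        then have y: "y \<in> ?T" "F y = t"
          using t by auto
        then obtain x where x: "x \<in> ?S" "y = \<phi> x"
          using surj by blast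
        then have "snd x = t"
          using lev y(2) by simp
        then have "x \<in> (\<Union>G\<in>M. slab F G {c}) \<times> {t}"
          using x(1) by auto
        then show "y \<in> \<phi> ` \<Union>?\<P>"
          unfolding P using x(2) by blast
      qed
      then have "pl_homeomorphism (\<Union>?\<P>) (\<Union>?\<Q>) \<phi>"
      proof (rule pl_homeomorphism_restrict[OF \<phi> sub])
        show "finite ?\<P>" "finite ?\<Q>"
          using finM by auto
        show "polyhedron P" if "P \<in> ?\<P>" for P
          using that polytope_imp_polyhedron[OF polytope_Times[OF polytope_slab[OF _ c] polytope_sing]]
          by (elim imageE) simp
        show "polyhedron Q" if "Q \<in> ?\<Q>" for Q
          using that polytope_imp_polyhedron[OF polytope_slab[OF _ t]] by (elim imageE) simp
      qed
      then show ?thesis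
        unfolding P .
    qed
    then show ?thesis
      using \<phi> by blast
  qed
qed

section \<open>Cutting along the extreme thresholds\<close>

definition cut_intervals :: "real \<Rightarrow> real \<Rightarrow> real set set" where
  "cut_intervals a b = {{..a}, {a..b}, {b..}}"

lemma cut_intervals_cover: "\<exists>J\<in>cut_intervals a b. s \<in> J"
  by (auto simp: cut_intervals_def)

lemma cut_intervals_Int_face:
  assumes "a \<le> b" "J \<in> cut_intervals a b" "J' \<in> cut_intervals a b"
  shows "J \<inter> J' face_of J"
proof -
  have le: "{k} face_of {..k}" and ge: "{k} face_of {k..}" for k :: real
  proof -
    have "{x::real. 1 \<bullet> x = k} = {k}" "{x::real. 1 \<bullet> x \<le> k} = {..k}" "{x::real. 1 \<bullet> x \<ge> k} = {k..}"
      by auto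
    then show "{k} face_of {..k}" "{k} face_of {k..}"
      using hyperplane_face_of_halfspace_le[of "1::real" k] hyperplane_face_of_halfspace_ge[of "1::real" k]
      by metis+
  qed
  have Ia: "{a} face_of {a..b}" and Ib: "{b} face_of {a..b}"
    using assms(1) by (auto intro: face_of_subset[OF ge[of a]] face_of_subset[OF le[of b]])
  \<comment> \<open>The two half-lines meet only in the degenerate case
    \<open>a = b\<close>.\<close>
  have ends: "{..a} \<inter> {b..} = (if a = b then {a} else {})" "{b..} \<inter> {..a} = (if a = b then {b} else {})"
    using assms(1) by auto
  show ?thesis
    using assms(2,3) unfolding cut_intervals_def
    by (elim insertE emptyE) (simp_all add: ends le ge Ia Ib face_of_refl assms(1) min_absorb1 min_absorb2 max_absorb1 max_absorb2)
qed

text \<open>Faces are adjoined explicitly since a face of a slab need not be a slab over a cut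
  interval: for \<open>a < b\<close> the level \<open>a\<close> in \<open>P\<close> is a face of the
  slab over \<open>{..a}\<close>, but \<open>{a}\<close> is not a cut interval.\<close>

definition cut_complex :: "'a::euclidean_space set set \<Rightarrow> ('a \<Rightarrow> real) \<Rightarrow> real \<Rightarrow> real \<Rightarrow> 'a set set" where
  "cut_complex \<C> F a b = {T. \<exists>P\<in>\<C>. \<exists>J\<in>cut_intervals a b. T face_of slab F P J}"

context
  fixes \<C> :: "'a::euclidean_space set set" and F :: "'a \<Rightarrow> real" and a b :: real
  assumes \<C>: "polyhedral_complex \<C>" and aff: "cellwise_affine \<C> F" and ab: "a \<le> b"
begin

lemma polyhedron_cut_cell:
  assumes "P \<in> \<C>" "J \<in> cut_intervals a b"
  shows "polyhedron (slab F P J)"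
proof -
  obtain u d where ud: "\<And>x. x \<in> P \<Longrightarrow> F x = u \<bullet> x + d"
    using assms(1) aff unfolding cellwise_affine_def by blast
  have P: "polyhedron P"
    using assms(1) \<C> by (simp add: polyhedral_complex_iff)
  show ?thesis
    using assms(2) polyhedron_slab[OF P ud] unfolding cut_intervals_def by (elim insertE emptyE) simp_all
qed

lemma slab_in_cut_complex:
  assumes "P \<in> \<C>" "J \<in> cut_intervals a b"
  shows "slab F P J \<in> cut_complex \<C> F a b"
  using assms polyhedron_cut_cell polyhedron_imp_convex face_of_refl unfolding cut_complex_def by blast

lemma polyhedral_complex_cut_complex: "polyhedral_complex (cut_complex \<C> F a b)"
  unfolding polyhedral_complex_iff
proof (intro conjI ballI allI impI)
  have "cut_complex \<C> F a b = (\<Union>P\<in>\<C>. \<Union>J\<in>cut_intervals a b. {T. T face_of slab F P J})"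
    by (auto simp: cut_complex_def)
  then show "finite (cut_complex \<C> F a b)"
    using \<C> finite_polyhedron_faces[OF polyhedron_cut_cell]
    by (simp add: polyhedral_complex_iff cut_intervals_def)
  fix T assume "T \<in> cut_complex \<C> F a b"
  then obtain P J where T: "P \<in> \<C>" "J \<in> cut_intervals a b" "T face_of slab F P J"
    by (auto simp: cut_complex_def)
  show "polyhedron T"
    using polyhedron_cut_cell[OF T(1,2)] T(3) face_of_polyhedron_polyhedron by blast
  show "T' \<in> cut_complex \<C> F a b" if "T' face_of T" for T'
    using T face_of_trans[OF that T(3)] by (auto simp: cut_complex_def)
  fix T' assume "T' \<in> cut_complex \<C> F a b"
  then obtain P' J' where T': "P' \<in> \<C>" "J' \<in> cut_intervals a b" "T' face_of slab F P' J'"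
    by (auto simp: cut_complex_def)
  \<comment> \<open>Cutting the common face \<open>P \<inter> P'\<close> along the common face
    \<open>J \<inter> J'\<close> yields the intersection of the slabs.\<close>
  have *: "slab F P J \<inter> slab F P' J' face_of slab F P J"
    if P: "P \<in> \<C>" "P' \<in> \<C>" and J: "J \<in> cut_intervals a b" "J' \<in> cut_intervals a b" for P P' J J'
  proof -
    obtain u d where ud: "\<And>x. x \<in> P \<Longrightarrow> F x = u \<bullet> x + d"
      using P(1) aff unfolding cellwise_affine_def by blast
    have "convex P" "P \<inter> P' face_of P"
      using P \<C> polyhedron_imp_convex by (auto simp: polyhedral_complex_iff)
    then have "slab F (P \<inter> P') (J \<inter> J') face_of slab F P J"
      using slab_face[OF _ ud _ cut_intervals_Int_face[OF ab J]] by blast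
    also have "slab F (P \<inter> P') (J \<inter> J') = slab F P J \<inter> slab F P' J'"
      by auto
    finally show ?thesis .
  qed
  have "slab F P J \<inter> slab F P' J' face_of slab F P' J'"
    using *[OF T'(1) T(1) T'(2) T(2)] by (simp add: Int_commute)
  then show "T \<inter> T' face_of T"
    using face_of_Int_subface[OF *[OF T(1) T'(1) T(2) T'(2)] _ T(3) T'(3)] by blast
qed

lemma Union_cut_complex: "\<Union>(cut_complex \<C> F a b) = \<Union>\<C>"
proof (intro subset_antisym subsetI)
  fix x assume "x \<in> \<Union>(cut_complex \<C> F a b)"
  then obtain T P J where "x \<in> T" "P \<in> \<C>" "T face_of slab F P J"
    by (auto simp: cut_complex_def)
  then show "x \<in> \<Union>\<C>"
    using face_of_imp_subset by fastforce
next
  fix x assume "x \<in> \<Union>\<C>"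
  then obtain P where P: "P \<in> \<C>" "x \<in> P"
    by blast
  obtain J where J: "J \<in> cut_intervals a b" "F x \<in> J"
    using cut_intervals_cover by blast
  then have "x \<in> slab F P J"
    using P by simp
  then show "x \<in> \<Union>(cut_complex \<C> F a b)"
    using slab_in_cut_complex[OF P(1) J(1)] by blast
qed

text \<open>A line in \<open>T\<close> stays over one cut interval. If \<open>F\<close> varied along
  it, \<open>F\<close> would take all real values there, so the interval would be the whole line.
  Hence the line is flat, and its direction lies in the trivial flat lineality space.\<close>

lemma pointed_cut_complex:
  assumes lin: "\<And>P. P \<in> \<C> \<Longrightarrow> P \<noteq> {} \<Longrightarrow> flat_lineality F P = {0}"
    and T: "T \<in> cut_complex \<C> F a b" "T \<noteq> {}"
  shows "pointed T"
  unfolding pointed_def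
proof (intro allI impI)
  fix v assume v: "v \<in> recession T" "- v \<in> recession T"
  obtain P J where P: "P \<in> \<C>" "J \<in> cut_intervals a b" "T face_of slab F P J"
    using T(1) by (auto simp: cut_complex_def)
  obtain u d where ud: "\<And>x. x \<in> P \<Longrightarrow> F x = u \<bullet> x + d"
    using P(1) aff unfolding cellwise_affine_def by blast
  obtain x where x: "x \<in> T"
    using T(2) by blast
  have line: "x + t *\<^sub>R v \<in> slab F P J" for t
  proof -
    have "x + t *\<^sub>R v \<in> T"
      using recessionD[OF v(1) x, of t] recessionD[OF v(2) x, of "- t"] by (cases "0 \<le> t") auto
    then show ?thesis
      using P(3) face_of_imp_subset by blast
  qed
  have xP: "x \<in> P"
    using line[of 0] by simp
  have Fv: "F (x + t *\<^sub>R v) = F x + t * (u \<bullet> v)" for t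
    using line[of t] ud xP by (simp add: inner_add_right)
  have "u \<bullet> v = 0"
  proof (rule ccontr)
    assume nz: "u \<bullet> v \<noteq> 0"
    have all: "s \<in> J" for s
      using line[of "(s - F x) / (u \<bullet> v)"] Fv[of "(s - F x) / (u \<bullet> v)"] nz by simp
    have "a + 1 \<notin> {..a}" "b + 1 \<notin> {a..b}" "b - 1 \<notin> {b..}"
      by auto
    then show False
      using P(2) all unfolding cut_intervals_def by blast
  qed
  moreover have poly: "polyhedron P"
    using P(1) \<C> by (simp add: polyhedral_complex_iff)
  ultimately have "v \<in> flat_lineality F P"
    using line Fv
    by (intro flat_linealityI_line[OF polyhedron_imp_closed[OF poly] polyhedron_imp_convex[OF poly] ud xP]) auto
  then show "v = 0"
    using lin[OF P(1)] xP by blast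
qed

text \<open>A bounded cut cell at a threshold value lies in a compact slab: a recession direction of the
  slab of the smallest face through a point would be a recession direction of the cut cell.\<close>
lemma bounded_cut_complex_slab:
  "{x \<in> \<Union>{T\<in>cut_complex \<C> F a b. bounded T}. F x \<in> {a..b}} = (\<Union>G\<in>compact_slabs \<C> F a b. slab F G {a..b})"
proof (intro subset_antisym subsetI)
  fix x assume "x \<in> (\<Union>G\<in>compact_slabs \<C> F a b. slab F G {a..b})"
  then obtain G where G: "G \<in> \<C>" "bounded (slab F G {a..b})" "x \<in> slab F G {a..b}"
    by (auto simp: compact_slabs_def)
  have "slab F G {a..b} \<in> cut_complex \<C> F a b"
    using slab_in_cut_complex[OF G(1)] by (simp add: cut_intervals_def)
  then show "x \<in> {x \<in> \<Union>{T\<in>cut_complex \<C> F a b. bounded T}. F x \<in> {a..b}}"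
    using G by auto
next
  fix x assume "x \<in> {x \<in> \<Union>{T\<in>cut_complex \<C> F a b. bounded T}. F x \<in> {a..b}}"
  then obtain T where T: "T \<in> cut_complex \<C> F a b" "bounded T" "x \<in> T" and Fx: "F x \<in> {a..b}"
    by blast
  obtain P J where P: "P \<in> \<C>" "J \<in> cut_intervals a b" "T face_of slab F P J"
    using T(1) by (auto simp: cut_complex_def)
  have xPJ: "x \<in> slab F P J"
    using P(3) T(3) face_of_imp_subset by blast
  obtain u d where ud: "\<And>x. x \<in> P \<Longrightarrow> F x = u \<bullet> x + d"
    using P(1) aff unfolding cellwise_affine_def by blast
  have polyP: "polyhedron P"
    using P(1) \<C> by (simp add: polyhedral_complex_iff)
  \<comment> \<open>The smallest face of \<open>P\<close> through \<open>x\<close>: relative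
    interiority permits a small step back against any recession direction of its slab.\<close>
  obtain G where G: "G face_of P" "x \<in> rel_interior G"
    using polyhedron_point_in_rel_interior_face[OF polyP] xPJ by auto
  have GP: "G \<subseteq> P" and xG: "x \<in> G"
    using G face_of_imp_subset rel_interior_subset by blast+
  have polyG: "polyhedron G"
    using polyP G(1) face_of_polyhedron_polyhedron by blast
  have udG: "\<And>x. x \<in> G \<Longrightarrow> F x = u \<bullet> x + d"
    using ud GP by blast
  have polyS: "polyhedron (slab F G {a..b})" and polyJ: "polyhedron (slab F P J)"
    using polyhedron_slab(3)[OF polyG udG] polyhedron_cut_cell[OF P(1,2)] by auto
  have "bounded (slab F G {a..b})"
  proof (rule ccontr)
    assume "\<not> bounded (slab F G {a..b})"
    then obtain w where w: "w \<in> recession (slab F G {a..b})" "w \<noteq> 0"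
      using unbounded_imp_recession_nonzero polyhedron_imp_closed[OF polyS] polyhedron_imp_convex[OF polyS]
      by blast
    have xS: "x \<in> slab F G {a..b}"
      using xG Fx by simp
    have uw: "u \<bullet> w = 0"
    proof (rule recession_inner_eq_0[OF _ w(1), of u "a - d" "b - d"])
      show "slab F G {a..b} \<noteq> {}"
        using xS by blast
      show "u \<bullet> y \<in> {a - d..b - d}" if "y \<in> slab F G {a..b}" for y
        using that udG[of y] by auto
    qed
    have ray: "x + t *\<^sub>R w \<in> G" if "0 \<le> t" for t
      using recessionD[OF w(1) xS that] by simp
    have level: "x + t *\<^sub>R w \<in> slab F P J" if "x + t *\<^sub>R w \<in> G" for t
    proof -
      have "F (x + t *\<^sub>R w) = F x"
        using udG[OF that] udG[OF xG] uw by (simp add: inner_add_right)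
      then show ?thesis
        using that GP xPJ by auto
    qed
    have wJ: "w \<in> recession (slab F P J)"
      using recessionI_ray[OF polyhedron_imp_closed[OF polyJ] polyhedron_imp_convex[OF polyJ] xPJ] level ray
      by blast
    obtain e where e: "e > 1" "(1 - e) *\<^sub>R (x + 1 *\<^sub>R w) + e *\<^sub>R x \<in> G"
      using G(2) ray[of 1] convex_rel_interior_iff[OF polyhedron_imp_convex[OF polyG], of x] by fastforce
    have eq: "(1 - e) *\<^sub>R (x + 1 *\<^sub>R w) + e *\<^sub>R x = x + (1 - e) *\<^sub>R w"
      by (simp add: algebra_simps)
    have "x - (e - 1) *\<^sub>R w \<in> slab F P J"
      using level[of "1 - e"] e(2) unfolding eq by (simp add: algebra_simps)
    \<comment> \<open>From \<open>x\<close> one can move both ways along \<open>w\<close> inside the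
      slab, so the face \<open>T\<close> contains the whole forward ray, contrary to its
      boundedness.\<close>
    then have "x + t *\<^sub>R w \<in> T" if "0 \<le> t" for t
      using face_of_back_along_ray(2)[OF P(3) T(3) _ _ wJ that] e(1) by simp
    moreover have "polyhedron T"
      using polyJ P(3) face_of_polyhedron_polyhedron by blast
    ultimately have "w \<in> recession T"
      using recessionI_ray[of T x w] T(3) polyhedron_imp_closed polyhedron_imp_convex by blast
    then show False
      using bounded_imp_recession_zero[OF T(2)] T(3) w(2) by blast
  qed
  moreover have "G \<in> \<C>"
    using \<C> P(1) G(1) by (simp add: polyhedral_complex_iff)
  moreover have "x \<in> slab F G {a..b}"
    using xG Fx by simp
  ultimately show "x \<in> (\<Union>G\<in>compact_slabs \<C> F a b. slab F G {a..b})"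
    unfolding compact_slabs_def by blast
qed

end

section \<open>The retraction theorem\<close>

theorem theorem1p3:
  fixes \<C> :: "(real ^ 'n) set set" and F :: "real ^ 'n \<Rightarrow> real" and a b :: real
  assumes "polyhedral_complex \<C>"
    and "cellwise_affine \<C> F"
    and "a \<le> b"
    and "transversal_thresholds \<C> F a b"
  shows "\<exists>\<D> H. polytopal_complex \<D> \<and> \<Union>\<D> \<subseteq> \<Union>\<C> \<and>
           strong_deformation_retraction (\<Union>\<C>) (\<Union>\<D>) H \<and>
           (\<forall>x\<in>\<Union>\<C>. F x \<in> {a..b} \<longrightarrow> F (H (x, 1)) = F x) \<and>
           (\<forall>c\<in>{a..b}.
              (\<lambda>x. H (x, 1)) ` {x\<in>\<Union>\<C>. F x \<le> c} = {y\<in>\<Union>\<D>. F y \<le> c} \<and>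
              (\<lambda>x. H (x, 1)) ` {x\<in>\<Union>\<C>. F x \<ge> c} = {y\<in>\<Union>\<D>. F y \<ge> c}) \<and>
           (\<forall>c\<in>{a..b}. \<exists>\<phi> :: (real ^ 'n) \<times> real \<Rightarrow> real ^ 'n.
              pl_homeomorphism ({y\<in>\<Union>\<D>. F y = c} \<times> {a..b}) {y\<in>\<Union>\<D>. F y \<in> {a..b}} \<phi> \<and>
              (\<forall>t\<in>{a..b}. pl_homeomorphism ({y\<in>\<Union>\<D>. F y = c} \<times> {t})
                                             {y\<in>\<Union>\<D>. F y = t} \<phi>))"
proof -
  note ab = assms(3)
  obtain \<E> q where \<E>: "polyhedral_complex \<E>" "cellwise_affine \<E> F" "transversal_thresholds \<E> F a b"
    and lin: "\<And>P. P \<in> \<E> \<Longrightarrow> P \<noteq> {} \<Longrightarrow> flat_lineality F P = {0}" and EC: "\<Union>\<E> \<subseteq> \<Union>\<C>"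
    and q: "continuous_on (\<Union>\<C>) q" "\<And>x. x \<in> \<Union>\<C> \<Longrightarrow> F (q x) = F x" "\<And>x. x \<in> \<Union>\<E> \<Longrightarrow> q x = x"
    and q_cell: "\<And>P x. P \<in> \<C> \<Longrightarrow> x \<in> P \<Longrightarrow> \<exists>Q\<in>\<E>. Q \<subseteq> P \<and> q x \<in> Q"
    using lineality_reduction[OF assms(1,2,4)] by metis
  define \<K> where "\<K> = cut_complex \<E> F a b"
  define \<D> where "\<D> = {T\<in>\<K>. bounded T}"
  have \<K>: "polyhedral_complex \<K>" "\<Union>\<K> = \<Union>\<E>" "\<And>T. T \<in> \<K> \<Longrightarrow> T \<noteq> {} \<Longrightarrow> pointed T"
    unfolding \<K>_def using polyhedral_complex_cut_complex[OF \<E>(1,2) ab] Union_cut_complex[OF \<E>(1,2) ab]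
      pointed_cut_complex[OF \<E>(1,2) ab lin] by blast+
  obtain r where r: "continuous_on (\<Union>\<K>) r" "moves_along_recession \<K> r"
    "\<And>x. x \<in> \<Union>\<K> \<Longrightarrow> r x \<in> \<Union>\<D>" "\<And>x. x \<in> \<Union>\<D> \<Longrightarrow> r x = x"
  proof (rule pointed_complex_retract_bounded[OF \<K>(1)])
    show "\<And>P. P \<in> \<K> \<Longrightarrow> P \<noteq> {} \<Longrightarrow> pointed P"
      by (rule \<K>(3))
  qed (rule that, unfold \<D>_def, (assumption | blast)+)
  \<comment> \<open>Every cut slab through \<open>x\<close> is a cell of \<open>\<K>\<close> and is
    respected separately. This gives both the invariance of cells and the control of
    \<open>F\<close>.\<close>
  have r_slab: "r x \<in> slab F P J" "x - r x \<in> recession (slab F P J)"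
    if P: "P \<in> \<E>" "x \<in> P" and J: "J \<in> cut_intervals a b" "F x \<in> J" for P x J
    using r(2) slab_in_cut_complex[OF \<E>(1,2) ab P(1) J(1)] P(2) J(2)
    unfolding moves_along_recession_def \<K>_def by auto
  have DE: "\<Union>\<D> \<subseteq> \<Union>\<E>"
    using \<K>(2) by (auto simp: \<D>_def)
  have poly_D: "polytopal_complex \<D>"
  proof -
    have "polyhedral_complex \<D>"
      unfolding \<D>_def
    proof (rule polyhedral_complex_subcomplex[OF \<K>(1)])
      fix P T assume P: "P \<in> {T\<in>\<K>. bounded T}" and T: "T face_of P"
      have "T \<in> \<K>"
        using P T \<K>(1) by (auto simp: polyhedral_complex_iff)
      moreover have "bounded T"
        using P bounded_subset[OF _ face_of_imp_subset[OF T]] by blast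
      ultimately show "T \<in> {T\<in>\<K>. bounded T}"
        by blast
    qed blast
    moreover have "polytope T" if "T \<in> \<D>" for T
      using that \<K>(1) unfolding polytope_eq_bounded_polyhedron polyhedral_complex_def \<D>_def by blast
    ultimately show ?thesis
      by (simp add: polytopal_complex_def)
  qed
  have qE: "q x \<in> \<Union>\<E>" if "x \<in> \<Union>\<C>" for x
    using q_cell that by blast
  define \<Phi> where "\<Phi> x = r (q x)" for x
  have \<Phi>D: "\<Phi> x \<in> \<Union>\<D>" if "x \<in> \<Union>\<C>" for x
    unfolding \<Phi>_def using r(3) qE[OF that] \<K>(2) by blast
  have \<Phi>_id: "\<Phi> x = x" if "x \<in> \<Union>\<D>" for x
  proof -
    have "q x = x"
      using that DE by (intro q(3)) blast
    then show ?thesis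
      unfolding \<Phi>_def using r(4)[OF that] by simp
  qed
  have \<Phi>_cont: "continuous_on (\<Union>\<C>) \<Phi>"
  proof -
    have "q ` \<Union>\<C> \<subseteq> \<Union>\<K>"
      using qE \<K>(2) by blast
    then show ?thesis
      unfolding \<Phi>_def by (rule continuous_on_compose2[OF r(1) q(1)])
  qed
  \<comment> \<open>Invariance of the original cells, needed for the homotopy: \<open>q x\<close>
    lies in a cell of \<open>\<E>\<close> inside \<open>P\<close>, and \<open>r\<close> does not
    leave that cell.\<close>
  have \<Phi>_cell: "\<Phi> x \<in> P" if P: "P \<in> \<C>" "x \<in> P" for P x
  proof -
    obtain Q where Q: "Q \<in> \<E>" "Q \<subseteq> P" "q x \<in> Q"
      using q_cell[OF P] by blast
    obtain J where "J \<in> cut_intervals a b" "F (q x) \<in> J"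
      using cut_intervals_cover by blast
    then have "\<Phi> x \<in> Q"
      unfolding \<Phi>_def using r_slab(1)[OF Q(1,3)] by simp
    then show ?thesis
      using Q(2) by blast
  qed
  have F_interval: "F (\<Phi> x) \<in> J" if x: "x \<in> \<Union>\<C>" and J: "J \<in> cut_intervals a b" "F x \<in> J" for x J
  proof -
    obtain Q where Q: "Q \<in> \<E>" "q x \<in> Q"
      using qE[OF x] by blast
    then show ?thesis
      unfolding \<Phi>_def using r_slab(1)[OF Q J(1)] q(2)[OF x] J(2) by simp
  qed
  have F_level: "F (\<Phi> x) = F x" if x: "x \<in> \<Union>\<C>" and Fx: "F x \<in> {a..b}" for x
  proof -
    obtain Q where Q: "Q \<in> \<E>" "q x \<in> Q"
      using qE[OF x] by blast
    obtain u d where ud: "\<And>x. x \<in> Q \<Longrightarrow> F x = u \<bullet> x + d"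
      using Q(1) \<E>(2) unfolding cellwise_affine_def by blast
    have J: "{a..b} \<in> cut_intervals a b"
      by (simp add: cut_intervals_def)
    have Fq: "F (q x) \<in> {a..b}"
      using q(2)[OF x] Fx by simp
    note rs = r_slab[OF Q J Fq]
    have "u \<bullet> (q x - r (q x)) = 0"
    proof (rule recession_inner_eq_0[OF _ rs(2), of u "a - d" "b - d"])
      show "slab F Q {a..b} \<noteq> {}"
        using rs(1) by blast
      show "u \<bullet> y \<in> {a - d..b - d}" if "y \<in> slab F Q {a..b}" for y
        using that ud[of y] by auto
    qed
    then have "F (r (q x)) = F (q x)"
      using ud[of "r (q x)"] ud[OF Q(2)] rs(1) by (simp add: inner_diff_right)
    then show ?thesis
      using q(2)[OF x] by (simp add: \<Phi>_def)
  qed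
  have sublevel: "\<Phi> ` {x\<in>\<Union>\<C>. F x \<le> c} = {y\<in>\<Union>\<D>. F y \<le> c}" if c: "c \<in> {a..b}" for c
  proof (intro subset_antisym subsetI)
    fix y assume "y \<in> \<Phi> ` {x\<in>\<Union>\<C>. F x \<le> c}"
    then obtain x where x: "x \<in> \<Union>\<C>" "F x \<le> c" "y = \<Phi> x"
      by blast
    have "F y \<le> c"
    \<comment> \<open>Below \<open>a\<close> only membership in \<open>{..a}\<close> is known to
      persist, which suffices as \<open>a \<le> c\<close>; between \<open>a\<close> and
      \<open>c\<close> the level itself is preserved.\<close>
    proof (cases "F x \<le> a")
      case True
      then show ?thesis
        using F_interval[OF x(1), of "{..a}"] c x(3) by (auto simp: cut_intervals_def)
    next
      case False
      then show ?thesis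
        using F_level[OF x(1)] c x by simp
    qed
    then show "y \<in> {y\<in>\<Union>\<D>. F y \<le> c}"
      using \<Phi>D[OF x(1)] x(3) by blast
  next
    \<comment> \<open>Points of \<open>\<D>\<close> are fixed, so each is its own preimage.\<close>
    fix y assume y: "y \<in> {y\<in>\<Union>\<D>. F y \<le> c}"
    then have "y \<in> \<Union>\<C>" "\<Phi> y = y"
      using DE EC \<Phi>_id by blast+
    then show "y \<in> \<Phi> ` {x\<in>\<Union>\<C>. F x \<le> c}"
      using y by (intro image_eqI[of _ _ y]) auto
  qed
  have superlevel: "\<Phi> ` {x\<in>\<Union>\<C>. F x \<ge> c} = {y\<in>\<Union>\<D>. F y \<ge> c}" if c: "c \<in> {a..b}" for c
  proof (intro subset_antisym subsetI)
    fix y assume "y \<in> \<Phi> ` {x\<in>\<Union>\<C>. F x \<ge> c}"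
    then obtain x where x: "x \<in> \<Union>\<C>" "F x \<ge> c" "y = \<Phi> x"
      by blast
    have "F y \<ge> c"
    proof (cases "F x \<ge> b")
      case True
      then show ?thesis
        using F_interval[OF x(1), of "{b..}"] c x(3) by (auto simp: cut_intervals_def)
    next
      case False
      then show ?thesis
        using F_level[OF x(1)] c x by simp
    qed
    then show "y \<in> {y\<in>\<Union>\<D>. F y \<ge> c}"
      using \<Phi>D[OF x(1)] x(3) by blast
  next
    fix y assume y: "y \<in> {y\<in>\<Union>\<D>. F y \<ge> c}"
    then have "y \<in> \<Union>\<C>" "\<Phi> y = y"
      using DE EC \<Phi>_id by blast+
    then show "y \<in> \<Phi> ` {x\<in>\<Union>\<C>. F x \<ge> c}"
      using y by (intro image_eqI[of _ _ y]) auto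
  qed
  define H where "H = (\<lambda>(x, t). (1 - t) *\<^sub>R x + t *\<^sub>R \<Phi> x)"
  have H1: "H (x, 1) = \<Phi> x" for x
    by (simp add: H_def)
  have "continuous_on (\<Union>\<C> \<times> {0..1}) H"
  proof -
    have "continuous_on (\<Union>\<C> \<times> {0..1}) (\<lambda>y. \<Phi> (fst y))"
      by (intro continuous_on_compose2[OF \<Phi>_cont]) (auto intro!: continuous_intros)
    then show ?thesis
      unfolding H_def case_prod_unfold by (intro continuous_intros)
  qed
  moreover have "H y \<in> \<Union>\<C>" if y: "y \<in> \<Union>\<C> \<times> {0..1}" for y
  proof -
    obtain x t P where xt: "y = (x, t)" "P \<in> \<C>" "x \<in> P" "0 \<le> t" "t \<le> 1"
      using y by auto
    have "convex P"
      using xt(2) assms(1) polyhedron_imp_convex by (auto simp: polyhedral_complex_iff)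
    then have "H y \<in> P"
      using xt \<Phi>_cell[OF xt(2,3)] by (simp add: H_def convexD_alt)
    then show ?thesis
      using xt(2) by blast
  qed
  moreover have "H (y, t) = y" if "y \<in> \<Union>\<D>" for y t
    using \<Phi>_id[OF that] by (simp add: H_def flip: scaleR_add_left)
  ultimately have sdr: "strong_deformation_retraction (\<Union>\<C>) (\<Union>\<D>) H"
    unfolding strong_deformation_retraction_def
  proof (intro conjI)
    show "\<forall>x\<in>\<Union>\<C>. H (x, 0) = x \<and> H (x, 1) \<in> \<Union>\<D>"
    proof
      fix x assume "x \<in> \<Union>\<C>"
      then show "H (x, 0) = x \<and> H (x, 1) \<in> \<Union>\<D>"
        using \<Phi>D[of x] H1[of x] by (simp add: H_def)
    qed
    show "\<Union>\<D> \<subseteq> \<Union>\<C>"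
      using DE EC by (rule subset_trans)
  qed blast+
  define M where "M = compact_slabs \<E> F a b"
  have slab_D: "{y\<in>\<Union>\<D>. F y \<in> {a..b}} = (\<Union>G\<in>M. slab F G {a..b})"
    using bounded_cut_complex_slab[OF \<E>(1,2) ab] unfolding \<D>_def \<K>_def M_def .
  have level_D: "{y\<in>\<Union>\<D>. F y = t} = (\<Union>G\<in>M. slab F G {t})" if t: "t \<in> {a..b}" for t
  proof -
    have "{y\<in>\<Union>\<D>. F y = t} = {y \<in> {y\<in>\<Union>\<D>. F y \<in> {a..b}}. F y = t}"
      using t by blast
    also have "\<dots> = (\<Union>G\<in>M. slab F G {t})"
      unfolding slab_D using t by auto
    finally show ?thesis .
  qed
  have product: "\<exists>\<phi>. pl_homeomorphism ({y\<in>\<Union>\<D>. F y = c} \<times> {a..b}) {y\<in>\<Union>\<D>. F y \<in> {a..b}} \<phi> \<and>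
      (\<forall>t\<in>{a..b}. pl_homeomorphism ({y\<in>\<Union>\<D>. F y = c} \<times> {t}) {y\<in>\<Union>\<D>. F y = t} \<phi>)"
    if c: "c \<in> {a..b}" for c
  proof -
    obtain \<phi> where \<phi>: "pl_homeomorphism ((\<Union>G\<in>M. slab F G {c}) \<times> {a..b}) (\<Union>G\<in>M. slab F G {a..b}) \<phi>"
      "\<And>t. t \<in> {a..b} \<Longrightarrow> pl_homeomorphism ((\<Union>G\<in>M. slab F G {c}) \<times> {t}) (\<Union>G\<in>M. slab F G {t}) \<phi>"
      using slab_product_levels[OF M_def \<E> ab c] by blast
    show ?thesis
    proof (intro exI conjI ballI)
      show "pl_homeomorphism ({y\<in>\<Union>\<D>. F y = c} \<times> {a..b}) {y\<in>\<Union>\<D>. F y \<in> {a..b}} \<phi>"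
        unfolding slab_D level_D[OF c] by (rule \<phi>(1))
      show "pl_homeomorphism ({y\<in>\<Union>\<D>. F y = c} \<times> {t}) {y\<in>\<Union>\<D>. F y = t} \<phi>" if "t \<in> {a..b}" for t
        unfolding level_D[OF c] level_D[OF that] by (rule \<phi>(2)[OF that])
    qed
  qed
  show ?thesis
  proof (rule exI[of _ \<D>], rule exI[of _ H], unfold H1, intro conjI ballI impI)
    show "polytopal_complex \<D>" "strong_deformation_retraction (\<Union>\<C>) (\<Union>\<D>) H"
      by fact+
    show "\<Union>\<D> \<subseteq> \<Union>\<C>"
      using DE EC by (rule subset_trans)
  qed (fact F_level sublevel superlevel product)+
qed

end
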